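(* Let $0 \le \alpha, \beta \le 2$ and define $a = \min(\alpha,1)$, $b = \min(\beta,1)$ and $$f(\alpha,\beta) = \begin{cases} \beta+1, & \alpha \ge \beta+1,\\ \alpha+1, & \beta \ge \alpha+1,\\ \alpha+\beta-1, & \alpha+\beta \ge 3,\\ \dfrac{a\alpha + b\beta + ab}{a+b}, & \alpha < \beta+1,\ \beta<\alpha+1,\ \alpha+\beta<3,\end{cases}$$ with $f(0,0)=0$ (the formulas agree where the cases overlap). (Upper bound) For every $\varepsilon>0$ there exists a constant $C_\varepsilon>0$ such that for all $K_\alpha, K_\beta \ge 1$, all $\delta\in(0,1]$, every $(\delta,\beta,K_\beta)$-set of balls $P$ and every $(\delta,\alpha,K_\alpha)$-set of tubes $\mathbb{T}$ contained in $[0,1]^2$, $$I(P,\mathbb{T}) \le C_\varepsilon K_\alpha K_\beta\, \delta^{-f(\alpha,\beta)-\varepsilon}.$$ (Sharpness) The bound is sharp up to a factor $C\delta^{-\varepsilon}$: there exist constants $K\ge 1$ and $c_0>0$ (independent of $\delta$) such that for every sufficiently small $\delta>0$ there exist a $(\delta,\beta,K)$-set of balls $P$ and a $(\delta,\alpha,K)$-set of tubes $\mathbb{T}$ contained in $[0,1]^2$ with $I(P,\mathbb{T}) \ge c_0\,\delta^{-f(\alpha,\beta)}$.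
   Context: A $\delta$-ball is a ball of radius $\delta$ in $\mathbb{R}^2$; a $\delta$-tube is a $\delta\times 1$ rectangle in $\mathbb{R}^2$ (any orientation). For a set $P$ of $\delta$-balls and a set $\mathbb{T}$ of $\delta$-tubes, $I(P,\mathbb{T})$ is the number of pairs $(p,t)\in P\times\mathbb{T}$ with $p\cap t\ne\emptyset$. For $0\le\beta\le 2$ and $K\ge 1$ (which may depend on $\delta$), a set $P$ of $\delta$-balls contained in $[0,1]^2$ is a $(\delta,\beta,K)$-set of balls if for every $w\in[\delta,1]$ and every ball $B_w$ of radius $w$, $\#\{p\in P: p\subset B_w\}\le K (w/\delta)^\beta$. For $0\le\alpha\le 2$ and $K\ge 1$, a set $\mathbb{T}$ of $\delta$-tubes contained in $[0,1]^2$ is a $(\delta,\alpha,K)$-set of tubes if for every $w\in[\delta,1]$ and every $w\times 2$ rectangle $T_w$, $\#\{t\in\mathbb{T}: t\subset T_w\}\le K (w/\delta)^\alpha$. *)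

theory Defs
  imports "HOL-Analysis.Analysis"
begin

text \<open>Balls and rectangles are closed and are represented as point sets in the plane, so a set of
  balls or of tubes is a set of point sets and has no repeated members.\<close>

definition is_ball :: "real \<Rightarrow> (real ^ 2) set \<Rightarrow> bool" where
  "is_ball r B \<longleftrightarrow> (\<exists>x. B = cball x r)"

definition is_rectangle :: "real \<Rightarrow> real \<Rightarrow> (real ^ 2) set \<Rightarrow> bool" where
  "is_rectangle w l R \<longleftrightarrow>
     (\<exists>c u v. norm u = 1 \<and> norm v = 1 \<and> u \<bullet> v = 0 \<and>
        R = {c + s *\<^sub>R u + t *\<^sub>R v | s t. 0 \<le> s \<and> s \<le> w \<and> 0 \<le> t \<and> t \<le> l})"

abbreviation is_tube :: "real \<Rightarrow> (real ^ 2) set \<Rightarrow> bool" where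
  "is_tube \<delta> t \<equiv> is_rectangle \<delta> 1 t"

definition unit_square :: "(real ^ 2) set" where
  "unit_square = {x. \<forall>i. 0 \<le> x $ i \<and> x $ i \<le> 1}"

text \<open>Finiteness is stated explicitly because \<open>card\<close> is 0 on infinite sets.\<close>

definition ball_set :: "real \<Rightarrow> real \<Rightarrow> real \<Rightarrow> (real ^ 2) set set \<Rightarrow> bool" where
  "ball_set \<delta> \<beta> K P \<longleftrightarrow>
     (\<forall>p\<in>P. is_ball \<delta> p \<and> p \<subseteq> unit_square) \<and>
     (\<forall>w B. \<delta> \<le> w \<and> w \<le> 1 \<and> is_ball w B \<longrightarrow>
        finite {p\<in>P. p \<subseteq> B} \<and> real (card {p\<in>P. p \<subseteq> B}) \<le> K * (w / \<delta>) powr \<beta>)"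

definition tube_set :: "real \<Rightarrow> real \<Rightarrow> real \<Rightarrow> (real ^ 2) set set \<Rightarrow> bool" where
  "tube_set \<delta> \<alpha> K T \<longleftrightarrow>
     (\<forall>t\<in>T. is_tube \<delta> t \<and> t \<subseteq> unit_square) \<and>
     (\<forall>w R. \<delta> \<le> w \<and> w \<le> 1 \<and> is_rectangle w 2 R \<longrightarrow>
        finite {t\<in>T. t \<subseteq> R} \<and> real (card {t\<in>T. t \<subseteq> R}) \<le> K * (w / \<delta>) powr \<alpha>)"

definition incidences :: "(real ^ 2) set set \<Rightarrow> (real ^ 2) set set \<Rightarrow> nat" where
  "incidences P T = card {(p, t). p \<in> P \<and> t \<in> T \<and> p \<inter> t \<noteq> {}}"

definition incidence_exponent :: "real \<Rightarrow> real \<Rightarrow> real" where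
  "incidence_exponent \<alpha> \<beta> =
     (let a = min \<alpha> 1; b = min \<beta> 1 in
      if \<alpha> = 0 \<and> \<beta> = 0 then 0
      else if \<alpha> \<ge> \<beta> + 1 then \<beta> + 1
      else if \<beta> \<ge> \<alpha> + 1 then \<alpha> + 1
      else if \<alpha> + \<beta> \<ge> 3 then \<alpha> + \<beta> - 1
      else (a * \<alpha> + b * \<beta> + a * b) / (a + b))"

text \<open>On the parameter range the order of the cases is immaterial.\<close>

lemma incidence_exponent_cases:
  assumes "0 \<le> \<alpha>" "\<alpha> \<le> 2" "0 \<le> \<beta>" "\<beta> \<le> 2"
  shows "\<alpha> \<ge> \<beta> + 1 \<Longrightarrow> incidence_exponent \<alpha> \<beta> = \<beta> + 1"
    and "\<beta> \<ge> \<alpha> + 1 \<Longrightarrow> incidence_exponent \<alpha> \<beta> = \<alpha> + 1"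
    and "\<alpha> + \<beta> \<ge> 3 \<Longrightarrow> incidence_exponent \<alpha> \<beta> = \<alpha> + \<beta> - 1"
  using assms unfolding incidence_exponent_def Let_def by auto

text \<open>A single ball of radius 1 and a single 1 by 2 rectangle contain the unit square, so the
  finiteness conditions above (at \<open>w = 1\<close>) make \<open>P\<close> and \<open>T\<close> finite.\<close>

lemma ball_set_finite:
  assumes "ball_set \<delta> \<beta> K P" "\<delta> \<le> 1"
  shows "finite P"
proof -
  have sub: "unit_square \<subseteq> cball (\<chi> i. 1/2) 1"
  proof
    fix x assume "x \<in> unit_square"
    then have "\<bar>(1/2 - x $ i)\<bar> \<le> 1/2" for i
      unfolding abs_le_iff by (auto simp: unit_square_def dest!: spec[of _ i])
    then have "dist (\<chi> i. 1/2) x \<le> (\<Sum>i\<in>(UNIV :: 2 set). 1/2)"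
      unfolding dist_norm by (intro order_trans[OF norm_le_l1_cart] sum_mono) simp
    then show "x \<in> cball (\<chi> i. 1/2) 1" by simp
  qed
  have "{p\<in>P. p \<subseteq> cball (\<chi> i. 1/2) 1} = P"
    using assms(1) sub unfolding ball_set_def by blast
  moreover have "finite {p\<in>P. p \<subseteq> cball (\<chi> i. 1/2) 1}"
    using assms unfolding ball_set_def is_ball_def by blast
  ultimately show ?thesis by simp
qed

lemma tube_set_finite:
  assumes "tube_set \<delta> \<alpha> K T" "\<delta> \<le> 1"
  shows "finite T"
proof -
  define R :: "(real ^ 2) set" where
    "R = {0 + s *\<^sub>R axis 1 1 + t *\<^sub>R axis 2 1 | s t. 0 \<le> s \<and> s \<le> 1 \<and> 0 \<le> t \<and> t \<le> 2}"
  have R: "is_rectangle 1 2 R"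
    unfolding is_rectangle_def R_def
    by (intro exI[of _ 0] exI[of _ "axis 1 1"] exI[of _ "axis 2 1"])
       (auto simp: inner_axis_axis)
  have sub: "unit_square \<subseteq> R"
  proof
    fix x assume x: "x \<in> unit_square"
    have "x = 0 + (x $ 1) *\<^sub>R axis 1 1 + (x $ 2) *\<^sub>R axis 2 1"
      by (simp add: vec_eq_iff forall_2 axis_def)
    moreover have "0 \<le> x $ 1" "x $ 1 \<le> 1" "0 \<le> x $ 2" "x $ 2 \<le> 2"
      using x by (auto simp: unit_square_def intro: order_trans[of _ 1])
    ultimately show "x \<in> R" unfolding R_def by blast
  qed
  have "{t\<in>T. t \<subseteq> R} = T"
    using assms(1) sub unfolding tube_set_def by blast
  moreover have "finite {t\<in>T. t \<subseteq> R}"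
    using assms R unfolding tube_set_def by blast
  ultimately show ?thesis by simp
qed

end

theory Submission
  imports Defs
begin

text \<open>Write a line as y = m x + c, exchanging the coordinates if it is steep. A ball is then a point (x, y)
and a tube is a point (m, c), up to an error of size \<delta>, and the spacing conditions say that a
square of side w around a given centre holds at most about (w/\<delta>) to the power \<beta> of the
points (x, y), and at most about (w/\<delta>) to the power \<alpha> of the points (m, c). The incidence
relation \<open>\<bar>y - m x - c\<bar> \<le> \<delta>\<close> is symmetric under exchanging (x, y) with
(m, -c), so every estimate holds also with the roles of \<alpha> and \<beta> exchanged.

Upper bound, \<open>min \<alpha> \<beta> \<le> 1\<close>. By duality let \<open>\<beta> \<le>
\<alpha>\<close>. Squaring the number of points on a line and summing over the lines counts pairs of
points on a common line. A pair at distance below r is paid for by the spacing of the points along one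
line; a pair at distance s > r lies on few lines, because these have slopes in an interval of length
\<open>\<delta>/s\<close>. The choice \<open>r = \<delta> powr (\<alpha> / (min \<alpha> 1 +
\<beta>))\<close> balances the two contributions (\<open>inc_cauchy_schwarz\<close>). If \<open>\<alpha>
\<ge> \<beta> + 1\<close>, it suffices that a point lies on at most about \<open>1/\<delta>\<close> of
the lines.

Upper bound, \<open>\<alpha> > 1\<close> and \<open>\<beta> > 1\<close>. This is a high-low argument,
carried out without the Fourier transform. Compare the number of pairs at resolution w with the number
at a resolution M w. Up to constants, the former exceeds 1/M times the latter by at most an error: the
average, over the lines near those of the family, of a sum of mean-zero profiles, one for each point. In
the L2 norm over all lines, profiles of two points at distance s are almost orthogonal: the slope
integral of their product gains a second factor w/s from the mean zero property
(\<open>line_kernel_decay\<close>). Since \<open>\<beta> \<le> 2\<close>, the diagonal dominates up to a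
logarithm. So passing from w to M w costs an error of the size of w to the power \<open>(\<alpha> +
\<beta> - 1) / 2\<close> (\<open>inc_coarsen\<close>), and an induction on scales adds the errors up
(\<open>inc_induction_on_scales\<close>). The error at the finest scale dominates if \<open>\<alpha> +
\<beta> < 3\<close>, and the coarsest scale dominates if \<open>\<alpha> + \<beta> > 3\<close>.

Sharpness. Outside the region \<open>\<alpha> + \<beta> \<ge> 3\<close> the extremal configuration is a
union of bushes. In a bush, balls spread along a segment of length \<rho> and width \<delta> are met by
all tubes whose directions lie in an arc of length \<delta>/\<rho> (\<open>sharp_bushes\<close>). In
that region a product of a regular grid and a sparse progression has as many incidences as a random
configuration (\<open>sharp_product_grid\<close>).\<close>

section \<open>Families of parameters with a dimension bound\<close>

text \<open>The common form of the two spacing conditions, for a family S with coordinates f and g. The elements of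
S are indices, so that two of them may have the same coordinates, and w has no upper limit.\<close>

definition dim_spaced :: "real \<Rightarrow> real \<Rightarrow> real \<Rightarrow> 'a set \<Rightarrow> ('a \<Rightarrow> real) \<Rightarrow> ('a \<Rightarrow> real) \<Rightarrow> bool" where
  "dim_spaced \<delta> \<gamma> K S f g \<longleftrightarrow> finite S \<and>
     (\<forall>u v w. \<delta> \<le> w \<longrightarrow>
        real (card {s\<in>S. \<bar>f s - u\<bar> \<le> w \<and> \<bar>g s - v\<bar> \<le> w}) \<le> K * (w / \<delta>) powr \<gamma>)"

text \<open>The resolution w is kept apart from \<delta> because the high-low argument compares the incidences at
different resolutions.\<close>

definition near_pairs ::
  "real \<Rightarrow> 'a set \<Rightarrow> ('a \<Rightarrow> real) \<Rightarrow> ('a \<Rightarrow> real) \<Rightarrow> 'b set \<Rightarrow> ('b \<Rightarrow> real) \<Rightarrow> ('b \<Rightarrow> real) \<Rightarrow> ('a \<times> 'b) set" where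
  "near_pairs w P x y T m c = {(p, t). p \<in> P \<and> t \<in> T \<and> \<bar>y p - m t * x p - c t\<bar> \<le> w}"

lemma dim_spaced_finite: "dim_spaced \<delta> \<gamma> K S f g \<Longrightarrow> finite S"
  by (simp add: dim_spaced_def)

lemma dim_spacedD:
  assumes "dim_spaced \<delta> \<gamma> K S f g" "\<delta> \<le> w"
    and "A \<subseteq> {s\<in>S. \<bar>f s - u\<bar> \<le> w \<and> \<bar>g s - v\<bar> \<le> w}"
  shows "real (card A) \<le> K * (w / \<delta>) powr \<gamma>"
proof -
  have "card A \<le> card {s\<in>S. \<bar>f s - u\<bar> \<le> w \<and> \<bar>g s - v\<bar> \<le> w}"
    using assms by (intro card_mono) (auto simp: dim_spaced_def)
  also have "real \<dots> \<le> K * (w / \<delta>) powr \<gamma>"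
    using assms by (simp add: dim_spaced_def)
  finally show ?thesis by simp
qed

text \<open>Absorbs a constant dilation of the square: an exponent of at most 2 turns a dilation by B into a factor
of at most the square of B.\<close>

lemma dim_spaced_scaled:
  assumes "dim_spaced \<delta> \<gamma> K S f g" "0 < \<delta>" "0 \<le> \<gamma>" "\<gamma> \<le> 2" "0 \<le> K" "1 \<le> B" "\<delta> \<le> w"
    and "A \<subseteq> {s\<in>S. \<bar>f s - u\<bar> \<le> B * w \<and> \<bar>g s - v\<bar> \<le> B * w}"
  shows "real (card A) \<le> B\<^sup>2 * K * (w / \<delta>) powr \<gamma>"
proof -
  have "w \<le> B * w" using assms by (metis dual_order.trans linorder_not_less mult_le_cancel_right1 order_less_le)
  then have "real (card A) \<le> K * (B * w / \<delta>) powr \<gamma>"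
    using assms by (intro dim_spacedD[OF assms(1) _ assms(8)]) linarith
  also have "(B * w / \<delta>) powr \<gamma> = B powr \<gamma> * (w / \<delta>) powr \<gamma>"
    using assms by (simp add: powr_mult flip: times_divide_eq_right)
  also have "B powr \<gamma> \<le> B powr 2" using assms by (intro powr_mono) auto
  also have "B powr 2 = B\<^sup>2" using assms by simp
  finally show ?thesis using assms by (simp add: mult_left_mono mult_right_mono mult_ac)
qed

lemma dim_spaced_card:
  assumes "dim_spaced \<delta> \<gamma> K S f g" "0 < \<delta>" "\<delta> \<le> 1" "0 \<le> \<gamma>" "\<gamma> \<le> 2" "0 \<le> K"
    and "\<And>s. s \<in> S \<Longrightarrow> \<bar>f s\<bar> \<le> 2" "\<And>s. s \<in> S \<Longrightarrow> \<bar>g s\<bar> \<le> 2"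
  shows "real (card S) \<le> 4 * K * \<delta> powr - \<gamma>"
proof -
  have "real (card S) \<le> 2\<^sup>2 * K * (1 / \<delta>) powr \<gamma>"
    using assms by (intro dim_spaced_scaled[OF assms(1), where u = 0 and v = 0]) auto
  then show ?thesis using assms by (simp add: powr_minus_divide powr_divide)
qed

text \<open>Along a line, the dimension of the family drops to at most 1. For \<open>\<gamma> > 1\<close> the strip
is cut into about \<open>r/\<delta>\<close> squares of side comparable to \<delta>, each of which holds
boundedly many elements.\<close>

lemma strip_count:
  assumes sp: "dim_spaced \<delta> \<gamma> K S f g" and "0 < \<delta>" "\<delta> \<le> r" "0 \<le> \<gamma>" "\<gamma> \<le> 2" "0 \<le> K" "\<bar>k\<bar> \<le> 1"
    and A: "A \<subseteq> {s\<in>S. \<bar>f s - u\<bar> \<le> r \<and> \<bar>g s - k * f s - d\<bar> \<le> \<delta>}"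
  shows "real (card A) \<le> 8 * K * (r / \<delta>) powr min \<gamma> 1"
proof (cases "\<gamma> \<le> 1")
  case True
  have *: "\<bar>g s - (k * u + d)\<bar> \<le> 2 * r" if "s \<in> A" for s
  proof -
    have s: "\<bar>f s - u\<bar> \<le> r" "\<bar>g s - k * f s - d\<bar> \<le> \<delta>" using A that by auto
    have "\<bar>k * (f s - u)\<bar> \<le> 1 * \<bar>f s - u\<bar>" unfolding abs_mult using assms by (intro mult_right_mono) auto
    then show ?thesis using s assms(3) by (simp add: algebra_simps)
  qed
  have "real (card A) \<le> 2\<^sup>2 * K * (r / \<delta>) powr \<gamma>"
    using assms * by (intro dim_spaced_scaled[OF sp, where u = u and v = "k * u + d"]) fastforce+
  also have "\<dots> \<le> 8 * K * (r / \<delta>) powr \<gamma>" using assms by (intro mult_right_mono) auto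
  finally show ?thesis using True by (simp add: min_def)
next
  case False
  define n where "n = nat \<lceil>r / \<delta>\<rceil>"
  have n1: "real n \<le> r / \<delta> + 1" "r / \<delta> \<le> real n"
    unfolding n_def using assms by (auto simp: of_nat_nat)
  have n2: "1 \<le> r / \<delta>" using assms by simp
  \<comment> \<open>The windows W i cover the interval around u from its left end, each of length 2 \<delta>.\<close>
  define W where "W i = {s\<in>A. \<bar>f s - (u - r + (2 * real i + 1) * \<delta>)\<bar> \<le> \<delta>}" for i
  have sub: "A \<subseteq> (\<Union>i<n. W i)"
  proof
    fix s assume s: "s \<in> A"
    then have fs: "\<bar>f s - u\<bar> \<le> r" using A by auto
    define i where "i = nat \<lceil>(f s - (u - r)) / (2 * \<delta>)\<rceil> - 1"
    let ?q = "(f s - (u - r)) / (2 * \<delta>)"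
    have q0: "0 \<le> ?q" using fs assms by auto
    have q1: "?q \<le> real n" 
    proof -
      have "?q \<le> (2 * r) / (2 * \<delta>)" using fs assms by (intro divide_right_mono) auto
      then show ?thesis using n1 by simp
    qed
    have i: "real i \<le> ?q" "?q \<le> real i + 1" using q0 unfolding i_def by linarith+
    have "n \<ge> 1" using n1 n2 by linarith
    then have "i < n" using q1 unfolding i_def by linarith
    moreover have "\<bar>f s - (u - r + (2 * real i + 1) * \<delta>)\<bar> \<le> \<delta>"
      using i assms by (simp add: field_simps abs_le_iff)
    ultimately show "s \<in> (\<Union>i<n. W i)" using s by (auto simp: W_def)
  qed
  have Wc: "real (card (W i)) \<le> 4 * K" for i
  proof -
    let ?v = "u - r + (2 * real i + 1) * \<delta>"
    have *: "\<bar>g s - (k * ?v + d)\<bar> \<le> 2 * \<delta>" if "s \<in> W i" for s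
    proof -
      have s: "\<bar>f s - ?v\<bar> \<le> \<delta>" "\<bar>g s - k * f s - d\<bar> \<le> \<delta>" using A that by (auto simp: W_def)
      have "\<bar>k * (f s - ?v)\<bar> \<le> 1 * \<bar>f s - ?v\<bar>" unfolding abs_mult using assms by (intro mult_right_mono) auto
      then show ?thesis using s by (simp add: right_diff_distrib)
    qed
    have **: "\<bar>f s - ?v\<bar> \<le> 2 * \<delta>" "s \<in> S" if "s \<in> W i" for s
      using that assms(2) A by (auto simp: W_def)
    then have "W i \<subseteq> {s\<in>S. \<bar>f s - ?v\<bar> \<le> 2 * \<delta> \<and> \<bar>g s - (k * ?v + d)\<bar> \<le> 2 * \<delta>}"
      using * by blast
    then have "real (card (W i)) \<le> 2\<^sup>2 * K * (\<delta> / \<delta>) powr \<gamma>"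
      using assms by (intro dim_spaced_scaled[OF sp, where u = "?v" and v = "k * ?v + d"]) simp_all
    then show ?thesis using assms by simp
  qed
  have fin: "finite A" using A dim_spaced_finite[OF sp] by (auto intro: finite_subset)
  have "card A \<le> card (\<Union>i<n. W i)" using sub fin by (intro card_mono) (auto simp: W_def)
  also have "\<dots> \<le> (\<Sum>i<n. card (W i))" by (rule card_UN_le) simp
  finally have "real (card A) \<le> (\<Sum>i<n. real (card (W i)))" by (simp flip: of_nat_sum)
  also have "\<dots> \<le> (\<Sum>i<n. 4 * K)" using Wc by (intro sum_mono)
  also have "\<dots> = real n * (4 * K)" by simp
  also have "\<dots> \<le> (2 * (r / \<delta>)) * (4 * K)"
  proof (intro mult_right_mono)
    show "real n \<le> 2 * (r / \<delta>)" using n1 n2 by linarith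
  qed (use assms in auto)
  finally show ?thesis using False assms by (simp add: min_def mult_ac)
qed

definition scale_count :: "real \<Rightarrow> nat" where "scale_count \<delta> = nat \<lceil>log 2 (2 / \<delta>)\<rceil>"

text \<open>The number of dyadic scales between \<delta> and 2 is logarithmic in \<open>1/\<delta>\<close>; this is
one of the two sources of the loss \<open>\<delta> powr -\<epsilon>\<close>.\<close>

lemma dyadic_scales_bound:
  fixes \<epsilon> :: real
  assumes "0 < \<epsilon>"
  obtains C where "1 \<le> C" "\<And>\<delta>. 0 < \<delta> \<Longrightarrow> \<delta> \<le> 1 \<Longrightarrow> real (scale_count \<delta>) + 1 \<le> C * \<delta> powr - \<epsilon>"
proof
  define C where "C = 3 + 1 / (ln 2 * \<epsilon>)"
  show "1 \<le> C" using assms by (simp add: C_def)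
  fix \<delta> :: real assume d: "0 < \<delta>" "\<delta> \<le> 1"
  have one: "1 \<le> \<delta> powr - \<epsilon>" using d assms
    by (metis less_eq_real_def neg_le_0_iff_le powr_mono' powr_zero_eq_one order_less_irrefl)
  have "ln (1 / \<delta>) \<le> (1 / \<delta>) powr \<epsilon> / \<epsilon>" using d assms by (intro ln_powr_bound) auto
  also have "(1 / \<delta>) powr \<epsilon> = \<delta> powr - \<epsilon>" using d by (simp add: powr_divide powr_minus_divide)
  finally have l: "ln (1 / \<delta>) \<le> \<delta> powr - \<epsilon> / \<epsilon>" .
  have nn: "0 \<le> ln (1 / \<delta>)" using d by simp
  have "log 2 (2 / \<delta>) = 1 + ln (1 / \<delta>) / ln 2" using d by (simp add: log_def ln_div field_simps)
  moreover have "0 \<le> ln (1 / \<delta>) / ln 2" using nn by simp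
  ultimately have "real (scale_count \<delta>) \<le> 2 + ln (1 / \<delta>) / ln 2"
    unfolding scale_count_def by linarith
  also have "ln (1 / \<delta>) / ln 2 \<le> \<delta> powr - \<epsilon> / \<epsilon> / ln 2" using l by (intro divide_right_mono) auto
  finally show "real (scale_count \<delta>) + 1 \<le> C * \<delta> powr - \<epsilon>"
    using one by (simp add: C_def field_simps)
qed

lemma dyadic_scales_reach:
  assumes "0 < \<delta>"
  shows "2 \<le> 2 ^ scale_count \<delta> * \<delta>"
proof -
  have "2 / \<delta> = 2 powr (log 2 (2 / \<delta>))" using assms by simp
  also have "\<dots> \<le> 2 powr real (scale_count \<delta>)"
    unfolding scale_count_def by (intro powr_mono) (auto, linarith)
  finally show ?thesis using assms by (simp add: powr_realpow field_simps)
qed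

lemma dyadic_scale_exists:
  fixes r s :: real
  assumes "0 < r" "r < s" "s \<le> 2 ^ J * r"
  obtains j where "j < J" "2 ^ j * r < s" "s \<le> 2 * (2 ^ j * r)"
proof -
  define j where "j = (LEAST j. s \<le> 2 ^ j * r)"
  have 1: "s \<le> 2 ^ j * r" unfolding j_def using assms(3) by (rule LeastI)
  have "j \<le> J" unfolding j_def using assms(3) by (rule Least_le)
  have "j \<noteq> 0" using 1 assms by (intro notI) simp
  then obtain i where i: "j = Suc i" by (cases j) auto
  have "\<not> s \<le> 2 ^ i * r" using not_less_Least[of i "\<lambda>j. s \<le> 2 ^ j * r"] i j_def by simp
  then show thesis using that[of i] 1 i \<open>j \<le> J\<close> by simp
qed

section \<open>Point-line systems and their duality\<close>

lemma near_pairs_dual: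
  "near_pairs w T m (\<lambda>t. - c t) P x (\<lambda>p. - y p) = prod.swap ` near_pairs w P x y T m c"
  by (force simp: near_pairs_def algebra_simps abs_minus_commute image_iff abs_le_iff)

lemma card_near_pairs_dual:
  "card (near_pairs w T m (\<lambda>t. - c t) P x (\<lambda>p. - y p)) = card (near_pairs w P x y T m c)"
  unfolding near_pairs_dual by (intro card_image) simp

lemma near_pairs_subset: "near_pairs w P x y T m c \<subseteq> P \<times> T"
  by (auto simp: near_pairs_def)

lemma finite_near_pairs: "finite P \<Longrightarrow> finite T \<Longrightarrow> finite (near_pairs w P x y T m c)"
  by (rule finite_subset[OF near_pairs_subset]) auto

lemma card_near_pairs_le:
  assumes "finite P" "finite T" 
  shows "card (near_pairs w P x y T m c) \<le> card P * card T"
  using card_mono[OF _ near_pairs_subset, of P T w x y m c] assms by (simp add: card_cartesian_product)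

lemma card_near_pairs_by_points:
  assumes "finite P" "finite T"
  shows "card (near_pairs w P x y T m c) = (\<Sum>p\<in>P. card {t\<in>T. \<bar>y p - m t * x p - c t\<bar> \<le> w})"
proof -
  have "near_pairs w P x y T m c = (SIGMA p:P. {t\<in>T. \<bar>y p - m t * x p - c t\<bar> \<le> w})"
    by (auto simp: near_pairs_def)
  then show ?thesis using assms by (simp add: card_SigmaI)
qed

lemma card_near_pairs_by_lines:
  assumes "finite P" "finite T"
  shows "card (near_pairs w P x y T m c) = (\<Sum>t\<in>T. card {p\<in>P. \<bar>y p - m t * x p - c t\<bar> \<le> w})"
proof -
  have "near_pairs w P x y T m c = prod.swap ` (SIGMA t:T. {p\<in>P. \<bar>y p - m t * x p - c t\<bar> \<le> w})"
    by (auto simp: near_pairs_def)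
  then have "card (near_pairs w P x y T m c) = card (SIGMA t:T. {p\<in>P. \<bar>y p - m t * x p - c t\<bar> \<le> w})"
    by (simp add: card_image)
  then show ?thesis using assms by (simp add: card_SigmaI)
qed

text \<open>The parametrised problem. The assumptions are invariant under exchanging the points (x, y) with the
lines (m, -c), for which the bounds on x and m agree; \<open>point_line_duality\<close> records this.\<close>

locale point_line_system =
  fixes \<delta> \<beta> K\<^sub>\<beta> :: real and P :: "'a set" and x y :: "'a \<Rightarrow> real"
    and \<alpha> K\<^sub>\<alpha> :: real and T :: "'b set" and m c :: "'b \<Rightarrow> real"
  assumes delta: "0 < \<delta>" "\<delta> \<le> 1"
    and beta: "0 \<le> \<beta>" "\<beta> \<le> 2" and alpha: "0 \<le> \<alpha>" "\<alpha> \<le> 2"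
    and K: "1 \<le> K\<^sub>\<beta>" "1 \<le> K\<^sub>\<alpha>"
    and points: "dim_spaced \<delta> \<beta> K\<^sub>\<beta> P x y"
    and lines: "dim_spaced \<delta> \<alpha> K\<^sub>\<alpha> T m c"
    and x_bound: "\<And>p. p \<in> P \<Longrightarrow> \<bar>x p\<bar> \<le> 1" and y_bound: "\<And>p. p \<in> P \<Longrightarrow> \<bar>y p\<bar> \<le> 2"
    and m_bound: "\<And>t. t \<in> T \<Longrightarrow> \<bar>m t\<bar> \<le> 1" and c_bound: "\<And>t. t \<in> T \<Longrightarrow> \<bar>c t\<bar> \<le> 2"
begin

abbreviation inc :: "real \<Rightarrow> real" where
  "inc w \<equiv> real (card (near_pairs w P x y T m c))"

lemma finP: "finite P" and finT: "finite T"
  using points lines by (auto dest: dim_spaced_finite)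

lemma cardP: "real (card P) \<le> 4 * K\<^sub>\<beta> * \<delta> powr - \<beta>"
  using delta beta K x_bound y_bound by (intro dim_spaced_card[OF points]) force+

lemma cardT: "real (card T) \<le> 4 * K\<^sub>\<alpha> * \<delta> powr - \<alpha>"
  using delta alpha K m_bound c_bound by (intro dim_spaced_card[OF lines]) force+

lemma inc_trivial: "inc w \<le> 16 * K\<^sub>\<alpha> * K\<^sub>\<beta> * \<delta> powr - (\<alpha> + \<beta>)"
proof -
  have "inc w \<le> real (card P) * real (card T)"
    using card_near_pairs_le[OF finP finT] by (metis of_nat_le_iff of_nat_mult)
  also have "\<dots> \<le> (4 * K\<^sub>\<beta> * \<delta> powr - \<beta>) * (4 * K\<^sub>\<alpha> * \<delta> powr - \<alpha>)"
    using cardP cardT K by (intro mult_mono) auto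
  also have "\<dots> = 16 * K\<^sub>\<alpha> * K\<^sub>\<beta> * \<delta> powr - (\<alpha> + \<beta>)"
    by (simp add: powr_add[symmetric] add.commute)
  finally show ?thesis .
qed

lemma lines_through_point:
  assumes "p \<in> P" "\<delta> \<le> r" and A: "A \<subseteq> {t\<in>T. \<bar>m t - u\<bar> \<le> r \<and> \<bar>y p - m t * x p - c t\<bar> \<le> \<delta>}"
  shows "real (card A) \<le> 8 * K\<^sub>\<alpha> * (r / \<delta>) powr min \<alpha> 1"
  using assms delta alpha K x_bound[of p] A
  by (intro strip_count[OF lines, where u = u and k = "- x p" and d = "y p"])
     (auto simp: abs_le_iff algebra_simps)

lemma points_on_line:
  assumes "t \<in> T" "\<delta> \<le> r" and A: "A \<subseteq> {p\<in>P. \<bar>x p - u\<bar> \<le> r \<and> \<bar>y p - m t * x p - c t\<bar> \<le> \<delta>}"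
  shows "real (card A) \<le> 8 * K\<^sub>\<beta> * (r / \<delta>) powr min \<beta> 1"
  using assms delta beta K m_bound[of t] A
  by (intro strip_count[OF points, where u = u and k = "m t" and d = "c t"])
     (auto simp: abs_le_iff algebra_simps)

end

lemma dim_spaced_uminus:
  assumes "dim_spaced \<delta> \<gamma> K S f g"
  shows "dim_spaced \<delta> \<gamma> K S f (\<lambda>s. - g s)"
  unfolding dim_spaced_def
proof (intro conjI allI impI)
  fix u v w :: real assume "\<delta> \<le> w"
  then show "real (card {s\<in>S. \<bar>f s - u\<bar> \<le> w \<and> \<bar>- g s - v\<bar> \<le> w}) \<le> K * (w / \<delta>) powr \<gamma>"
    by (intro dim_spacedD[OF assms, where u = u and v = "- v"]) (auto simp: abs_le_iff)
qed (use assms in \<open>simp add: dim_spaced_def\<close>)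

lemma point_line_duality:
  assumes "point_line_system \<delta> \<beta> K\<^sub>\<beta> P x y \<alpha> K\<^sub>\<alpha> T m c"
  shows "point_line_system \<delta> \<alpha> K\<^sub>\<alpha> T m (\<lambda>t. - c t) \<beta> K\<^sub>\<beta> P x (\<lambda>p. - y p)"
  using assms by (simp add: point_line_system_def dim_spaced_uminus)

section \<open>Incidences by Cauchy-Schwarz\<close>

lemma sum_UN_le:
  fixes f :: "'a \<Rightarrow> real"
  assumes "finite I" "\<And>i. i \<in> I \<Longrightarrow> finite (A i)" "\<And>a. 0 \<le> f a"
  shows "sum f (\<Union>i\<in>I. A i) \<le> (\<Sum>i\<in>I. sum f (A i))"
  using assms
proof (induction I rule: finite_induct)
  case (insert i I)
  have "sum f (A i \<union> (\<Union>i\<in>I. A i)) \<le> sum f (A i) + sum f (\<Union>i\<in>I. A i)"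
    using insert.hyps insert.prems by (subst sum_Un) (auto intro: sum_nonneg)
  also have "sum f (\<Union>i\<in>I. A i) \<le> (\<Sum>i\<in>I. sum f (A i))"
    using insert by simp
  finally show ?case using insert.hyps by simp
qed simp

text \<open>Both quadratic estimates below are summed over the dyadic shells of the distance d.\<close>

lemma dyadic_sum_bound:
  fixes d k :: "'a \<Rightarrow> real"
  assumes fin: "finite F" and r: "0 < r"
    and d: "\<And>q. q \<in> F \<Longrightarrow> r < d q" "\<And>q. q \<in> F \<Longrightarrow> d q \<le> 2 ^ J * r"
    and k: "\<And>q. 0 \<le> k q"
    and shell: "\<And>s. r \<le> s \<Longrightarrow> sum k {q\<in>F. s < d q \<and> d q \<le> 2 * s} \<le> B"
  shows "sum k F \<le> real J * B"
proof -
  define G where "G j = {q\<in>F. 2 ^ j * r < d q \<and> d q \<le> 2 * (2 ^ j * r)}" for j :: nat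
  have finG: "finite (G j)" for j using fin by (simp add: G_def)
  have "F \<subseteq> (\<Union>j<J. G j)"
  proof
    fix q assume q: "q \<in> F"
    obtain j where "j < J" "2 ^ j * r < d q" "d q \<le> 2 * (2 ^ j * r)"
      using dyadic_scale_exists[OF r d(1)[OF q] d(2)[OF q]] .
    then show "q \<in> (\<Union>j<J. G j)" using q by (auto simp: G_def)
  qed
  then have "sum k F \<le> sum k (\<Union>j<J. G j)" using finG k by (intro sum_mono2) auto
  also have "\<dots> \<le> (\<Sum>j<J. sum k (G j))" using finG k by (intro sum_UN_le) auto
  also have "\<dots> \<le> (\<Sum>j<J. B)"
  proof (intro sum_mono)
    fix j
    have "r \<le> 2 ^ j * r" using r by (simp add: mult_le_cancel_right1)
    then show "sum k (G j) \<le> B" unfolding G_def by (rule shell)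
  qed
  finally show ?thesis by simp
qed

text \<open>If I exceeded the bound, the first term on the right would be at most half of its square and the second
at most a quarter.\<close>

lemma quadratic_self_bound:
  fixes I X L :: real
  assumes "I\<^sup>2 \<le> 32 * X * I + 1024 * L * X\<^sup>2" "0 \<le> X" "1 \<le> L" "0 \<le> I"
  shows "I \<le> 64 * L * X"
proof (rule ccontr)
  assume "\<not> ?thesis"
  then have *: "64 * L * X < I" by simp
  have XL: "X \<le> L * X" using assms by (simp add: mult_le_cancel_right1)
  have "64 * X \<le> I" using * XL by linarith
  then have 1: "64 * X * I \<le> I * I" using assms by (intro mult_right_mono) auto
  have "(64 * L * X) * (64 * X) \<le> I * I"
    using * \<open>64 * X \<le> I\<close> assms by (intro mult_mono) auto
  then have 2: "4096 * L * X\<^sup>2 \<le> I * I" by (simp add: power2_eq_square mult_ac)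
  have "0 \<le> 64 * L * X" using assms by simp
  then have "0 < I" using * by linarith
  then have "0 < I * I" by simp
  then show False using 1 2 assms(1) by (simp add: power2_eq_square) 
qed

context point_line_system begin

text \<open>Adds up, over the points, the bound \<open>1/\<delta>\<close> for the lines through a single point.
Nothing better is possible if \<open>\<alpha> \<ge> \<beta> + 1\<close>.\<close>

lemma inc_one_point_at_a_time: "inc \<delta> \<le> 32 * K\<^sub>\<alpha> * K\<^sub>\<beta> * \<delta> powr - (\<beta> + 1)"
proof -
  have "real (card {t\<in>T. \<bar>y p - m t * x p - c t\<bar> \<le> \<delta>}) \<le> 8 * K\<^sub>\<alpha> * \<delta> powr - 1" if "p \<in> P" for p
  proof -
    have "real (card {t\<in>T. \<bar>y p - m t * x p - c t\<bar> \<le> \<delta>}) \<le> 8 * K\<^sub>\<alpha> * (1 / \<delta>) powr min \<alpha> 1"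
      using delta that m_bound by (intro lines_through_point[of p _ _ 0]) auto
    also have "\<dots> \<le> 8 * K\<^sub>\<alpha> * (1 / \<delta>) powr 1"
      using delta K by (intro mult_left_mono powr_mono) auto
    finally show ?thesis using delta by (simp add: powr_minus_divide)
  qed
  then have "inc \<delta> \<le> (\<Sum>p\<in>P. 8 * K\<^sub>\<alpha> * \<delta> powr - 1)"
    unfolding card_near_pairs_by_points[OF finP finT] of_nat_sum by (intro sum_mono)
  also have "\<dots> = real (card P) * (8 * K\<^sub>\<alpha> * \<delta> powr - 1)" by simp
  also have "\<dots> \<le> (4 * K\<^sub>\<beta> * \<delta> powr - \<beta>) * (8 * K\<^sub>\<alpha> * \<delta> powr - 1)"
    using cardP K by (intro mult_right_mono) auto
  also have "\<dots> = 32 * K\<^sub>\<alpha> * K\<^sub>\<beta> * \<delta> powr - (\<beta> + 1)"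
    by (simp only: minus_add_distrib powr_add) simp
  finally show ?thesis .
qed

definition common_lines :: "'a \<Rightarrow> 'a \<Rightarrow> 'b set" where
  "common_lines p q =
     {t\<in>T. \<bar>y p - m t * x p - c t\<bar> \<le> \<delta> \<and> \<bar>y q - m t * x q - c t\<bar> \<le> \<delta>}"

text \<open>Counts the triples of a second point q at distance more than r from p and a line through both, by dyadic
distance s. Such lines have slopes in an interval of length about \<open>\<delta>/s\<close>, so there
are at most about s to the power \<open>-a\<close> of them, with \<open>a = min \<alpha> 1\<close>, and
there are about (s/\<delta>) to the power \<beta> points q. As \<open>\<beta> \<le> a\<close>, the
product is largest at s = r. The difference of the abscissas may serve as the distance because slopes
are at most 1.\<close>

lemma far_pairs:
  assumes r: "\<delta> \<le> r" "r \<le> 1" and ba: "\<beta> \<le> min \<alpha> 1" and J: "2 \<le> 2 ^ J * r" and p: "p \<in> P"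
  shows "(\<Sum>q\<in>{q\<in>P. r < \<bar>x q - x p\<bar>}. real (card (common_lines p q)))
    \<le> real J * (64 * K\<^sub>\<alpha> * K\<^sub>\<beta> * \<delta> powr - \<beta> * r powr (\<beta> - min \<alpha> 1))"
proof -
  define a where "a = min \<alpha> 1"
  define F where "F = {q\<in>P. r < \<bar>x q - x p\<bar> \<and> common_lines p q \<noteq> {}}"
  have rpos: "0 < r" using r delta by linarith
  have a: "0 \<le> a" "a \<le> 1" "\<beta> \<le> a" using alpha ba by (auto simp: a_def)
  have finF: "finite F" using finP by (auto simp: F_def)
  have "(\<Sum>q\<in>{q\<in>P. r < \<bar>x q - x p\<bar>}. real (card (common_lines p q))) = (\<Sum>q\<in>F. real (card (common_lines p q)))"
    using finP by (intro sum.mono_neutral_right) (auto simp: F_def)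
  also have "\<dots> \<le> real J * (64 * K\<^sub>\<alpha> * K\<^sub>\<beta> * \<delta> powr - \<beta> * r powr (\<beta> - a))"
  proof (rule dyadic_sum_bound[OF finF rpos, where d = "\<lambda>q. \<bar>x q - x p\<bar>"])
    fix q assume q: "q \<in> F"
    have "\<bar>x q - x p\<bar> \<le> 2" using x_bound[of q] x_bound[OF p] q by (auto simp: F_def)
    then show "r < \<bar>x q - x p\<bar>" "\<bar>x q - x p\<bar> \<le> 2 ^ J * r" using q J by (auto simp: F_def)
  next
    fix s assume sr: "r \<le> s"
    define G where "G = {q\<in>F. s < \<bar>x q - x p\<bar> \<and> \<bar>x q - x p\<bar> \<le> 2 * s}"
    have spos: "0 < s" using sr rpos by linarith
    have lines_q: "real (card (common_lines p q)) \<le> 16 * K\<^sub>\<alpha> * s powr - a" if q: "q \<in> G" for q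
    proof -
      have d: "s < \<bar>x q - x p\<bar>" "q \<in> P" using q by (auto simp: G_def F_def)
      have s2: "s \<le> 2" using d x_bound[of q] x_bound[OF p] by auto
      have mm: "\<bar>m t - (y q - y p) / (x q - x p)\<bar> \<le> 2 * \<delta> / s" if "t \<in> common_lines p q" for t
      proof -
        have "\<bar>(y q - y p) - m t * (x q - x p)\<bar> \<le> 2 * \<delta>"
          using that by (auto simp: common_lines_def abs_le_iff algebra_simps)
        moreover have "m t - (y q - y p) / (x q - x p) = - ((y q - y p) - m t * (x q - x p)) / (x q - x p)"
          using d spos by (simp add: field_simps)
        ultimately have "\<bar>m t - (y q - y p) / (x q - x p)\<bar> \<le> (2 * \<delta>) / \<bar>x q - x p\<bar>"
          by (auto simp: abs_divide intro!: divide_right_mono)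
        also have "\<dots> \<le> 2 * \<delta> / s" using d spos delta by (intro divide_left_mono) auto
        finally show ?thesis .
      qed
      have "real (card (common_lines p q)) \<le> 8 * K\<^sub>\<alpha> * (2 * \<delta> / s / \<delta>) powr a"
        unfolding a_def using mm s2 spos delta p
        by (intro lines_through_point[of p _ _ "(y q - y p) / (x q - x p)"])
           (auto simp: common_lines_def field_simps)
      also have "2 * \<delta> / s / \<delta> = 2 / s" using delta by simp
      also have "(2 / s) powr a = 2 powr a * s powr - a"
        using spos by (simp add: powr_divide powr_minus_divide)
      also have "8 * K\<^sub>\<alpha> * (2 powr a * s powr - a) \<le> 8 * K\<^sub>\<alpha> * (2 powr 1 * s powr - a)"
        using a K by (intro mult_left_mono mult_right_mono powr_mono) auto
      finally show ?thesis by simp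
    qed
    have card_G: "real (card (G)) \<le> 4 * K\<^sub>\<beta> * (s / \<delta>) powr \<beta>"
    proof -
      have *: "\<bar>y q - y p\<bar> \<le> 4 * s" "\<bar>x q - x p\<bar> \<le> 4 * s" "q \<in> P" if "q \<in> G" for q
      proof -
        have d: "\<bar>x q - x p\<bar> \<le> 2 * s" "q \<in> P" "common_lines p q \<noteq> {}" using that by (auto simp: G_def F_def)
        then obtain t where t: "t \<in> T" "\<bar>y p - m t * x p - c t\<bar> \<le> \<delta>" "\<bar>y q - m t * x q - c t\<bar> \<le> \<delta>"
          by (auto simp: common_lines_def)
        have "\<bar>m t * (x q - x p)\<bar> \<le> 1 * \<bar>x q - x p\<bar>"
          unfolding abs_mult using m_bound[OF t(1)] by (intro mult_right_mono) auto
        then have "\<bar>y q - y p\<bar> \<le> \<bar>x q - x p\<bar> + 2 * \<delta>" using t by (simp add: abs_le_iff algebra_simps)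
        then show "\<bar>y q - y p\<bar> \<le> 4 * s" "\<bar>x q - x p\<bar> \<le> 4 * s" "q \<in> P"
          using d sr r spos by linarith+
      qed
      have "real (card (G)) \<le> K\<^sub>\<beta> * ((4 * s) / \<delta>) powr \<beta>"
        using * sr r spos by (intro dim_spacedD[OF points, where u = "x p" and v = "y p"]) (linarith, blast)
      also have "((4 * s) / \<delta>) powr \<beta> = 4 powr \<beta> * (s / \<delta>) powr \<beta>"
        using spos delta by (simp add: powr_mult powr_divide)
      also have "K\<^sub>\<beta> * (4 powr \<beta> * (s / \<delta>) powr \<beta>) \<le> K\<^sub>\<beta> * (4 powr 1 * (s / \<delta>) powr \<beta>)"
        using a K by (intro mult_left_mono mult_right_mono powr_mono) auto
      finally show ?thesis by simp
    qed
    have "(\<Sum>q\<in>G. real (card (common_lines p q))) \<le> (\<Sum>q\<in>G. 16 * K\<^sub>\<alpha> * s powr - a)"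
      using lines_q by (intro sum_mono)
    also have "\<dots> = real (card (G)) * (16 * K\<^sub>\<alpha> * s powr - a)" by simp
    also have "\<dots> \<le> (4 * K\<^sub>\<beta> * (s / \<delta>) powr \<beta>) * (16 * K\<^sub>\<alpha> * s powr - a)"
      using card_G K by (intro mult_right_mono) auto
    also have "\<dots> = 64 * K\<^sub>\<alpha> * K\<^sub>\<beta> * \<delta> powr - \<beta> * s powr (\<beta> - a)"
      using spos delta by (simp add: powr_divide powr_minus_divide powr_diff)
    also have "\<dots> \<le> 64 * K\<^sub>\<alpha> * K\<^sub>\<beta> * \<delta> powr - \<beta> * r powr (\<beta> - a)"
      using K rpos sr a by (intro mult_left_mono powr_mono2') auto
    finally show "(\<Sum>q\<in>{q\<in>F. s < \<bar>x q - x p\<bar> \<and> \<bar>x q - x p\<bar> \<le> 2 * s}. real (card (common_lines p q)))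
        \<le> 64 * K\<^sub>\<alpha> * K\<^sub>\<beta> * \<delta> powr - \<beta> * r powr (\<beta> - a)"
      by (simp add: G_def)
  qed simp
  finally show ?thesis unfolding a_def .
qed

text \<open>The sum counts the pairs of points on a common line. Close pairs are counted by choosing an incidence
and then a second point on the same line; distant pairs are counted by \<open>far_pairs\<close>.\<close>

lemma sum_squares_of_line_degrees:
  assumes r: "\<delta> \<le> r" "r \<le> 1" and ba: "\<beta> \<le> min \<alpha> 1" and J: "2 \<le> 2 ^ J * r"
  shows "(\<Sum>t\<in>T. (real (card {p\<in>P. \<bar>y p - m t * x p - c t\<bar> \<le> \<delta>}))\<^sup>2)
         \<le> 8 * K\<^sub>\<beta> * (r / \<delta>) powr \<beta> * inc \<delta>
            + 256 * real J * K\<^sub>\<alpha> * K\<^sub>\<beta>\<^sup>2 * \<delta> powr (- 2 * \<beta>) * r powr (\<beta> - min \<alpha> 1)"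
proof -
  define a where "a = min \<alpha> 1"
  define Q where "Q t = {p\<in>P. \<bar>y p - m t * x p - c t\<bar> \<le> \<delta>}" for t
  define near where "near t p = {q\<in>Q t. \<bar>x q - x p\<bar> \<le> r}" for t p
  define far where "far t p = {q\<in>Q t. r < \<bar>x q - x p\<bar>}" for t p
  have fin: "finite (Q t)" "finite (near t p)" "finite (far t p)" for t p
    using finP by (auto simp: Q_def near_def far_def)
  have card_eq: "real (card A) = (\<Sum>q\<in>P. if q \<in> A then 1 else 0)" if "A \<subseteq> P" for A
    using that finP by (simp add: sum.If_cases Int_absorb1)
  have "(real (card (Q t)))\<^sup>2 = (\<Sum>p\<in>Q t. real (card (near t p)) + real (card (far t p)))" for t
  proof -
    have "card (Q t) = card (near t p) + card (far t p)" for p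
      using fin by (subst card_Un_disjoint[symmetric]) (auto simp: near_def far_def intro!: arg_cong[where f = card])
    then show ?thesis by (simp add: power2_eq_square flip: of_nat_add)
  qed
  then have "(\<Sum>t\<in>T. (real (card (Q t)))\<^sup>2)
      = (\<Sum>t\<in>T. \<Sum>p\<in>Q t. real (card (near t p))) + (\<Sum>t\<in>T. \<Sum>p\<in>Q t. real (card (far t p)))"
    by (simp add: sum.distrib)
  also have "(\<Sum>t\<in>T. \<Sum>p\<in>Q t. real (card (near t p))) \<le> (\<Sum>t\<in>T. \<Sum>p\<in>Q t. 8 * K\<^sub>\<beta> * (r / \<delta>) powr \<beta>)"
  proof (intro sum_mono)
    fix t p assume "t \<in> T"
    then have "real (card (near t p)) \<le> 8 * K\<^sub>\<beta> * (r / \<delta>) powr min \<beta> 1"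
      using r by (intro points_on_line[of t _ _ "x p"]) (auto simp: near_def Q_def)
    also have "min \<beta> 1 = \<beta>" using ba by simp
    finally show "real (card (near t p)) \<le> 8 * K\<^sub>\<beta> * (r / \<delta>) powr \<beta>" .
  qed
  also have "\<dots> = 8 * K\<^sub>\<beta> * (r / \<delta>) powr \<beta> * inc \<delta>"
    unfolding card_near_pairs_by_lines[OF finP finT] Q_def
    by (simp add: sum_distrib_left sum_distrib_right mult_ac)
  also have "(\<Sum>t\<in>T. \<Sum>p\<in>Q t. real (card (far t p)))
      = (\<Sum>p\<in>P. \<Sum>q\<in>{q\<in>P. r < \<bar>x q - x p\<bar>}. real (card (common_lines p q)))"
    (is "_ = ?far")
  proof -
    define R where "R = {(t, p, q). t \<in> T \<and> p \<in> P \<and> q \<in> P \<and> r < \<bar>x q - x p\<bar>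
        \<and> \<bar>y p - m t * x p - c t\<bar> \<le> \<delta> \<and> \<bar>y q - m t * x q - c t\<bar> \<le> \<delta>}"
    have finC: "finite (common_lines p q)" for p q
      using finT by (simp add: common_lines_def)
    have "R = (SIGMA t:T. SIGMA p:Q t. far t p)"
      by (auto simp: R_def Q_def far_def)
    then have 1: "real (card R) = (\<Sum>t\<in>T. \<Sum>p\<in>Q t. real (card (far t p)))"
      using finT fin by (simp add: card_SigmaI)
    have "R = (\<lambda>(p, q, t). (t, p, q)) ` (SIGMA p:P. SIGMA q:{q\<in>P. r < \<bar>x q - x p\<bar>}. common_lines p q)"
      by (force simp: R_def common_lines_def)
    moreover have "inj_on (\<lambda>(p, q, t). (t, p, q)) A" for A :: "('a \<times> 'a \<times> 'b) set"
      by (auto simp: inj_on_def)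
    ultimately have "card R = card (SIGMA p:P. SIGMA q:{q\<in>P. r < \<bar>x q - x p\<bar>}. common_lines p q)"
      by (simp add: card_image)
    also have "\<dots> = (\<Sum>p\<in>P. \<Sum>q\<in>{q\<in>P. r < \<bar>x q - x p\<bar>}. card (common_lines p q))"
    proof -
      have "card (SIGMA p:P. SIGMA q:{q\<in>P. r < \<bar>x q - x p\<bar>}. common_lines p q)
        = (\<Sum>p\<in>P. card (SIGMA q:{q\<in>P. r < \<bar>x q - x p\<bar>}. common_lines p q))"
        using finP finC by (intro card_SigmaI) (auto intro!: finite_SigmaI)
      also have "\<dots> = (\<Sum>p\<in>P. \<Sum>q\<in>{q\<in>P. r < \<bar>x q - x p\<bar>}. card (common_lines p q))"
        using finP finC by (intro sum.cong refl card_SigmaI) auto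
      finally show ?thesis .
    qed
    finally have "real (card R) = ?far" by simp
    then show ?thesis using 1 by simp
  qed
  also have "?far \<le> (\<Sum>p\<in>P. real J * (64 * K\<^sub>\<alpha> * K\<^sub>\<beta> * \<delta> powr - \<beta> * r powr (\<beta> - a)))"
    unfolding a_def using far_pairs[OF r ba J] by (intro sum_mono)
  also have "\<dots> = real (card P) * (real J * (64 * K\<^sub>\<alpha> * K\<^sub>\<beta> * \<delta> powr - \<beta> * r powr (\<beta> - a)))"
    by simp
  also have "\<dots> \<le> (4 * K\<^sub>\<beta> * \<delta> powr - \<beta>) * (real J * (64 * K\<^sub>\<alpha> * K\<^sub>\<beta> * \<delta> powr - \<beta> * r powr (\<beta> - a)))"
    using cardP K by (intro mult_right_mono) auto
  also have "\<dots> = 256 * real J * K\<^sub>\<alpha> * K\<^sub>\<beta>\<^sup>2 * \<delta> powr (- 2 * \<beta>) * r powr (\<beta> - a)"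
    by (simp add: power2_eq_square powr_add[symmetric])
  finally show ?thesis unfolding Q_def a_def by simp
qed

lemma inc_cauchy_schwarz:
  assumes ba: "\<beta> \<le> min \<alpha> 1" "0 < \<alpha>" "\<alpha> \<le> \<beta> + 1"
  shows "inc \<delta> \<le> 64 * (real (scale_count \<delta>) + 1) * (K\<^sub>\<alpha> * K\<^sub>\<beta> *
           \<delta> powr - (\<alpha> + \<beta> - \<alpha> * \<beta> / (min \<alpha> 1 + \<beta>)))"
proof -
  define a where "a = min \<alpha> 1"
  define J where "J = scale_count \<delta>"
  \<comment> \<open>The exponent of r at which close and distant pairs contribute equally.\<close>
  define e where "e = \<alpha> / (a + \<beta>)"
  define r where "r = \<delta> powr e"
  define X where "X = K\<^sub>\<alpha> * K\<^sub>\<beta> * \<delta> powr - (\<alpha> + \<beta> - \<alpha> * \<beta> / (a + \<beta>))"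
  have a: "0 < a" "a \<le> 1" "\<beta> \<le> a" using assms by (auto simp: a_def)
  have e: "0 \<le> e" "e \<le> 1" using a beta alpha assms(3) by (auto simp: e_def a_def min_def field_simps)
  have "\<delta> powr 1 \<le> \<delta> powr e" using e delta by (intro powr_mono') auto
  then have r1: "\<delta> \<le> r" using delta by (simp add: r_def)
  have r2: "r \<le> 1" unfolding r_def using e delta by (intro powr_le1) auto
  have "2 \<le> 2 ^ J * \<delta>" unfolding J_def by (rule dyadic_scales_reach[OF delta(1)])
  also have "\<dots> \<le> 2 ^ J * r" using r1 by simp
  finally have J2: "2 \<le> 2 ^ J * r" .
  have t1: "4 * K\<^sub>\<alpha> * \<delta> powr - \<alpha> * (8 * K\<^sub>\<beta> * (r / \<delta>) powr \<beta>) = 32 * X"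
  proof -
    have "\<delta> powr - \<alpha> * (r / \<delta>) powr \<beta> = \<delta> powr (- \<alpha> + e * \<beta> - \<beta>)"
      using delta by (simp add: r_def powr_divide powr_powr powr_diff powr_add powr_minus_divide)
    also have "- \<alpha> + e * \<beta> - \<beta> = - (\<alpha> + \<beta> - \<alpha> * \<beta> / (a + \<beta>))"
      by (simp add: e_def)
    finally show ?thesis by (simp add: X_def algebra_simps)
  qed
  have t2: "4 * K\<^sub>\<alpha> * \<delta> powr - \<alpha> * (256 * real J * K\<^sub>\<alpha> * K\<^sub>\<beta>\<^sup>2 * \<delta> powr (- 2 * \<beta>) * r powr (\<beta> - a))
     = 1024 * real J * X\<^sup>2"
  proof -
    have "\<delta> powr - \<alpha> * (\<delta> powr (- 2 * \<beta>) * r powr (\<beta> - a)) = \<delta> powr (- \<alpha> - 2 * \<beta> + e * (\<beta> - a))"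
      using delta by (simp add: r_def powr_powr powr_diff powr_add powr_minus_divide right_diff_distrib)
    also have "- \<alpha> - 2 * \<beta> + e * (\<beta> - a) = 2 * (- (\<alpha> + \<beta> - \<alpha> * \<beta> / (a + \<beta>)))"
    proof -
      have "a + \<beta> \<noteq> 0" using a beta by linarith
      then show ?thesis by (simp add: e_def field_simps) 
    qed
    also have "\<delta> powr \<dots> = (\<delta> powr - (\<alpha> + \<beta> - \<alpha> * \<beta> / (a + \<beta>)))\<^sup>2"
      by (simp only: mult_2 powr_add power2_eq_square)
    finally have *: "\<delta> powr - \<alpha> * (\<delta> powr (- 2 * \<beta>) * r powr (\<beta> - a))
       = (\<delta> powr - (\<alpha> + \<beta> - \<alpha> * \<beta> / (a + \<beta>)))\<^sup>2" .
    have "4 * K\<^sub>\<alpha> * \<delta> powr - \<alpha> * (256 * real J * K\<^sub>\<alpha> * K\<^sub>\<beta>\<^sup>2 * \<delta> powr (- 2 * \<beta>) * r powr (\<beta> - a))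
       = 1024 * real J * (K\<^sub>\<alpha> * K\<^sub>\<beta>)\<^sup>2 * (\<delta> powr - \<alpha> * (\<delta> powr (- 2 * \<beta>) * r powr (\<beta> - a)))"
      by (simp add: power2_eq_square mult_ac)
    then show ?thesis unfolding * by (simp add: X_def power_mult_distrib)
  qed
  have "(inc \<delta>)\<^sup>2 = (\<Sum>t\<in>T. real (card {p\<in>P. \<bar>y p - m t * x p - c t\<bar> \<le> \<delta>}))\<^sup>2"
    by (simp add: card_near_pairs_by_lines[OF finP finT])
  also have "\<dots> \<le> (\<Sum>t\<in>T. (real (card {p\<in>P. \<bar>y p - m t * x p - c t\<bar> \<le> \<delta>}))\<^sup>2) * real (card T)"
    by (rule sum_squared_le_sum_of_squares)
  also have "\<dots> \<le> (8 * K\<^sub>\<beta> * (r / \<delta>) powr \<beta> * inc \<delta>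
            + 256 * real J * K\<^sub>\<alpha> * K\<^sub>\<beta>\<^sup>2 * \<delta> powr (- 2 * \<beta>) * r powr (\<beta> - a)) * (4 * K\<^sub>\<alpha> * \<delta> powr - \<alpha>)"
    using sum_squares_of_line_degrees[OF r1 r2 ba(1) J2] cardT K unfolding a_def
    by (intro mult_mono) (auto intro!: add_nonneg_nonneg mult_nonneg_nonneg)
  also have "\<dots> = (4 * K\<^sub>\<alpha> * \<delta> powr - \<alpha> * (8 * K\<^sub>\<beta> * (r / \<delta>) powr \<beta>)) * inc \<delta>
     + 4 * K\<^sub>\<alpha> * \<delta> powr - \<alpha> * (256 * real J * K\<^sub>\<alpha> * K\<^sub>\<beta>\<^sup>2 * \<delta> powr (- 2 * \<beta>) * r powr (\<beta> - a))"
    by (simp add: algebra_simps)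
  also have "\<dots> = 32 * X * inc \<delta> + 1024 * real J * X\<^sup>2"
    unfolding t1 t2 by simp
  also have "\<dots> \<le> 32 * X * inc \<delta> + 1024 * (real J + 1) * X\<^sup>2"
    by (intro add_left_mono mult_right_mono mult_left_mono) auto
  finally have "inc \<delta> \<le> 64 * (real J + 1) * X"
    using K by (intro quadratic_self_bound) (auto simp: X_def)
  then show ?thesis by (simp add: X_def a_def J_def)
qed

end

section \<open>A mean-zero kernel on the space of lines\<close>

definition hat :: "real \<Rightarrow> real" where "hat u = max 0 (1 - \<bar>u\<bar>)"

text \<open>The difference between a bump of width 1 and the bump of width M with the same integral.\<close>

definition wavelet :: "real \<Rightarrow> real \<Rightarrow> real" where
  "wavelet M u = hat u - hat (u / M) / M"

text \<open>A Lipschitz function that is 1 on \<open>\<bar>m\<bar> \<le> 2\<close> and 0 outside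
\<open>\<bar>m\<bar> \<le> 3\<close>. A sharp cutoff would produce boundary terms that do not decay fast
enough in \<open>line_kernel_decay\<close>.\<close>

definition slope_cutoff :: "real \<Rightarrow> real" where "slope_cutoff m = max 0 (min 1 (3 - \<bar>m\<bar>))"

lemma hat_measurable [measurable]: "hat \<in> borel_measurable borel"
  unfolding hat_def by measurable

lemma wavelet_measurable [measurable]: "wavelet M \<in> borel_measurable borel"
  unfolding wavelet_def by measurable

lemma slope_cutoff_measurable [measurable]: "slope_cutoff \<in> borel_measurable borel"
  unfolding slope_cutoff_def by measurable

lemma fst_snd_measurable [measurable]:
  "fst \<in> borel_measurable (borel :: (real \<times> real) measure)"
  "snd \<in> borel_measurable (borel :: (real \<times> real) measure)"
  by (intro borel_measurable_continuous_onI continuous_intros)+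

lemma emeasure_lborel_interval_finite: "emeasure lborel {a..b :: real} < top"
  using emeasure_lborel_cbox_finite[of a b] by simp

lemma emeasure_lborel_rectangle_finite:
  "emeasure lborel ({a..b} \<times> {c..d} :: (real \<times> real) set) < top"
proof -
  have "{a..b} \<times> {c..d} = cbox (a, c) (b, d)" by auto
  then show ?thesis using emeasure_lborel_cbox_finite by (metis infinity_ennreal_def)
qed

text \<open>The integrability criterion behind every use of Fubini below.\<close>

lemma integrable_bounded_support:
  fixes f :: "'a \<Rightarrow> real"
  assumes "f \<in> borel_measurable N" "S \<in> sets N" "emeasure N S < top"
    and "\<And>z. z \<in> S \<Longrightarrow> \<bar>f z\<bar> \<le> B" "\<And>z. z \<notin> S \<Longrightarrow> f z = 0"
  shows "integrable N f"
proof (rule Bochner_Integration.integrable_bound)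
  show "integrable N (\<lambda>z. B * indicator S z)"
    using assms by (intro integrable_mult_right integrable_real_indicator) auto
  have "norm (f z) \<le> norm (B * indicator S z)" for z
    using assms(4)[of z] assms(5)[of z] by (cases "z \<in> S") auto
  then show "AE z in N. norm (f z) \<le> norm (B * indicator S z)" by simp
qed fact

lemma abs_integral_interval_support:
  fixes f :: "real \<Rightarrow> real"
  assumes "0 \<le> R" "0 \<le> B" "\<And>u. \<bar>u\<bar> \<le> R \<Longrightarrow> \<bar>f u\<bar> \<le> B" "\<And>u. R < \<bar>u\<bar> \<Longrightarrow> f u = 0"
  shows "\<bar>integral\<^sup>L lborel f\<bar> \<le> 2 * R * B"
proof (cases "integrable lborel f")
  case True
  have "\<bar>integral\<^sup>L lborel f\<bar> \<le> integral\<^sup>L lborel (\<lambda>u. \<bar>f u\<bar>)"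
    by (rule integral_abs_bound)
  also have "\<dots> \<le> integral\<^sup>L lborel (\<lambda>u. B * indicator {-R..R} u)"
  proof (intro integral_mono)
    show "\<bar>f u\<bar> \<le> B * indicator {- R..R} u" for u
      using assms(3)[of u] assms(4)[of u] by (cases "\<bar>u\<bar> \<le> R") (auto simp: abs_le_iff indicator_def)
  qed (use True in \<open>auto intro!: integrable_real_indicator simp: emeasure_lborel_interval_finite\<close>)
  also have "\<dots> = 2 * R * B" using assms by simp
  finally show ?thesis .
next
  case False
  then show ?thesis using assms by (simp add: not_integrable_integral_eq)
qed

lemma hat_bounds: "0 \<le> hat u" "hat u \<le> 1"
  by (auto simp: hat_def)

lemma hat_support: "1 \<le> \<bar>u\<bar> \<Longrightarrow> hat u = 0"
  by (auto simp: hat_def)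

lemma hat_ge_half: "\<bar>u\<bar> \<le> 1 / 2 \<Longrightarrow> 1 / 2 \<le> hat u"
  by (auto simp: hat_def)

lemma slope_cutoff_simps:
  "0 \<le> slope_cutoff m" "slope_cutoff m \<le> 1" "3 \<le> \<bar>m\<bar> \<Longrightarrow> slope_cutoff m = 0"
  "\<bar>m\<bar> \<le> 2 \<Longrightarrow> slope_cutoff m = 1"
  by (auto simp: slope_cutoff_def)

lemma slope_cutoff_lipschitz: "\<bar>slope_cutoff m - slope_cutoff m'\<bar> \<le> \<bar>m - m'\<bar>"
  unfolding slope_cutoff_def by linarith

lemma wavelet_support: "1 \<le> M \<Longrightarrow> M \<le> \<bar>u\<bar> \<Longrightarrow> wavelet M u = 0"
  by (simp add: wavelet_def hat_support)

lemma wavelet_bound: assumes "1 \<le> M" shows "\<bar>wavelet M u\<bar> \<le> 1"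
proof -
  have "hat (u / M) / M \<le> 1 / 1" using hat_bounds[of "u / M"] assms by (intro frac_le) auto
  moreover have "0 \<le> hat (u / M) / M" using hat_bounds[of "u / M"] assms by auto
  ultimately show ?thesis using hat_bounds[of u] by (auto simp: wavelet_def)
qed

lemma integrable_hat: assumes "0 < M" shows "integrable lborel (\<lambda>u. hat (u / M))"
proof (rule integrable_bounded_support[where S = "{-M..M}" and B = 1])
  show "\<bar>hat (u / M)\<bar> \<le> 1" for u using hat_bounds[of "u / M"] by auto
  show "hat (u / M) = 0" if "u \<notin> {-M..M}" for u
    using that assms by (intro hat_support) (auto simp: abs_if field_simps split: if_splits)
qed (auto simp: emeasure_lborel_interval_finite)

lemma integral_wavelet: assumes "1 \<le> M" shows "integral\<^sup>L lborel (wavelet M) = 0"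
proof -
  have "integral\<^sup>L lborel (\<lambda>u. hat (u / M)) = M * integral\<^sup>L lborel hat"
    using assms by (subst lborel_integral_real_affine[of M _ 0]) auto
  moreover have "integrable lborel hat" using integrable_hat[of 1] by simp
  ultimately show ?thesis unfolding wavelet_def
    using integrable_hat[of M] assms by (subst Bochner_Integration.integral_diff) auto
qed

lemma integrable_wavelet: assumes "1 \<le> M" shows "integrable lborel (wavelet M)"
  unfolding wavelet_def using assms integrable_hat[of 1] integrable_hat[of M]
  by (intro Bochner_Integration.integrable_diff integrable_divide) auto

text \<open>The source of the orthogonality. After the substitution that makes the argument of the wavelet the
variable of integration, the cutoff varies by at most w M/\<bar>d\<bar> on the support of the wavelet,
and its constant part integrates to 0. So the integral gains a factor w/\<bar>d\<bar> over its trivial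
bound, which is itself of size w/\<bar>d\<bar>.\<close>

lemma slope_average_bound:
  assumes M: "1 \<le> M" and "0 < w" "d \<noteq> 0"
  shows "\<bar>integral\<^sup>L lborel (\<lambda>m. slope_cutoff m * wavelet M (A + (e - m * d) / w))\<bar>
           \<le> 2 * M\<^sup>2 * (w / \<bar>d\<bar>)\<^sup>2"
proof -
  \<comment> \<open>The slope at which the argument of the wavelet vanishes, and the change of slope per unit of that argument.\<close>
  define t where "t = (e + A * w) / d"
  define k where "k = - w / d"
  have k: "k \<noteq> 0" "\<bar>k\<bar> = w / \<bar>d\<bar>" using assms by (auto simp: k_def abs_divide)
  have e: "A + (e - (t + k * v) * d) / w = v" for v
    using assms by (simp add: t_def k_def field_simps)
  have "integral\<^sup>L lborel (\<lambda>m. slope_cutoff m * wavelet M (A + (e - m * d) / w))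
      = \<bar>k\<bar> * integral\<^sup>L lborel (\<lambda>v. slope_cutoff (t + k * v) * wavelet M v)"
    using k by (subst lborel_integral_real_affine[of k _ t]) (auto simp: e)
  also have "integral\<^sup>L lborel (\<lambda>v. slope_cutoff (t + k * v) * wavelet M v)
      = integral\<^sup>L lborel (\<lambda>v. (slope_cutoff (t + k * v) - slope_cutoff t) * wavelet M v)"
  proof -
    have i1: "integrable lborel (\<lambda>v. slope_cutoff (t + k * v) * wavelet M v)"
    proof (rule integrable_bounded_support[where S = "{-M..M}" and B = 1])
      show "\<bar>slope_cutoff (t + k * v) * wavelet M v\<bar> \<le> 1" for v
        unfolding abs_mult using wavelet_bound[OF M, of v] slope_cutoff_simps(1,2)[of "t + k * v"]
        by (intro mult_le_one) auto
      show "slope_cutoff (t + k * v) * wavelet M v = 0" if "v \<notin> {-M..M}" for v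
        using that M by (subst wavelet_support) auto
    qed (auto simp: emeasure_lborel_interval_finite)
    have i2: "integrable lborel (\<lambda>v. slope_cutoff t * wavelet M v)"
      using integrable_wavelet[OF M] by simp
    show ?thesis unfolding left_diff_distrib using i1 i2 integral_wavelet[OF M]
      by (subst Bochner_Integration.integral_diff) auto
  qed
  finally have eq: "integral\<^sup>L lborel (\<lambda>m. slope_cutoff m * wavelet M (A + (e - m * d) / w))
      = \<bar>k\<bar> * integral\<^sup>L lborel (\<lambda>v. (slope_cutoff (t + k * v) - slope_cutoff t) * wavelet M v)" .
  have "\<bar>integral\<^sup>L lborel (\<lambda>v. (slope_cutoff (t + k * v) - slope_cutoff t) * wavelet M v)\<bar>
      \<le> 2 * M * (\<bar>k\<bar> * M)"
  proof (rule abs_integral_interval_support)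
    fix v :: real assume v: "\<bar>v\<bar> \<le> M"
    have "\<bar>slope_cutoff (t + k * v) - slope_cutoff t\<bar> \<le> \<bar>k\<bar> * \<bar>v\<bar>"
      using slope_cutoff_lipschitz[of "t + k * v" t] by (simp add: abs_mult)
    also have "\<dots> \<le> \<bar>k\<bar> * M" using v by (intro mult_left_mono) auto
    finally show "\<bar>(slope_cutoff (t + k * v) - slope_cutoff t) * wavelet M v\<bar> \<le> \<bar>k\<bar> * M"
      unfolding abs_mult using wavelet_bound[OF M, of v] M
      by (metis abs_ge_zero dual_order.trans mult.right_neutral mult_left_mono)
  next
    fix v :: real assume "M < \<bar>v\<bar>"
    then show "(slope_cutoff (t + k * v) - slope_cutoff t) * wavelet M v = 0"
      using M by (simp add: wavelet_support)
  qed (use M in auto)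
  then have "\<bar>k\<bar> * \<bar>integral\<^sup>L lborel (\<lambda>v. (slope_cutoff (t + k * v) - slope_cutoff t) * wavelet M v)\<bar>
      \<le> \<bar>k\<bar> * (2 * M * (\<bar>k\<bar> * M))"
    by (intro mult_left_mono) auto
  then show ?thesis unfolding eq abs_mult using k(2) assms(2) by (simp add: power2_eq_square mult_ac)
qed

text \<open>The product of the profiles of the points (x, y) and (x', y') at the line z = (slope, intercept). Its
integral \<open>line_kernel\<close> measures how far the two profiles are from being orthogonal.\<close>

definition line_product ::
  "real \<Rightarrow> real \<Rightarrow> real \<Rightarrow> real \<Rightarrow> real \<Rightarrow> real \<Rightarrow> real \<times> real \<Rightarrow> real" where
  "line_product M w x y x' y' z = slope_cutoff (fst z) *
      (wavelet M ((y - fst z * x - snd z) / w) * wavelet M ((y' - fst z * x' - snd z) / w))"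

definition line_kernel :: "real \<Rightarrow> real \<Rightarrow> real \<Rightarrow> real \<Rightarrow> real \<Rightarrow> real \<Rightarrow> real" where
  "line_kernel M w x y x' y' = integral\<^sup>L lborel (line_product M w x y x' y')"

lemma integrable_line_product:
  assumes M: "1 \<le> M" and w: "0 < w"
  shows "integrable lborel (line_product M w x y x' y')"
proof -
  define R where "R = \<bar>y\<bar> + 3 * \<bar>x\<bar> + w * M"
  show ?thesis
  proof (rule integrable_bounded_support[where S = "{-3..3} \<times> {-R..R}" and B = 1])
    fix z :: "real \<times> real"
    show "\<bar>line_product M w x y x' y' z\<bar> \<le> 1"
      unfolding line_product_def abs_mult using wavelet_bound[OF M] slope_cutoff_simps(1,2)[of "fst z"]
      by (intro mult_le_one) auto
    assume z: "z \<notin> {-3..3} \<times> {-R..R}"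
    show "line_product M w x y x' y' z = 0"
    proof (cases "\<bar>fst z\<bar> \<le> 3")
      case True
      then have "R < \<bar>snd z\<bar>" using z by (cases z) (auto simp: abs_le_iff)
      moreover have "\<bar>fst z * x\<bar> \<le> 3 * \<bar>x\<bar>" unfolding abs_mult using True by (intro mult_right_mono) auto
      ultimately have "w * M \<le> \<bar>y - fst z * x - snd z\<bar>" unfolding R_def by linarith
      then have "M \<le> \<bar>(y - fst z * x - snd z) / w\<bar>" using w by (simp add: abs_divide field_simps)
      then show ?thesis using M by (simp add: line_product_def wavelet_support)
    qed (simp add: line_product_def slope_cutoff_simps)
  next
    show "{-3..3} \<times> {-R..R} \<in> sets (lborel :: (real \<times> real) measure)"
      by (simp add: borel_closed closed_Times)
    show "line_product M w x y x' y' \<in> borel_measurable lborel"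
      unfolding line_product_def[abs_def] by simp
  qed (simp_all add: emeasure_lborel_rectangle_finite)
qed

text \<open>On each vertical line of the parameter plane, measuring the intercept from the first point in units of w
turns the first profile into a function of A alone. The slope integral can then be taken first.\<close>

lemma line_kernel_fubini:
  assumes M: "1 \<le> M" and w: "0 < w"
  shows "line_kernel M w x y x' y' = w * integral\<^sup>L lborel (\<lambda>A. wavelet M A *
     integral\<^sup>L lborel (\<lambda>m. slope_cutoff m * wavelet M (A + ((y' - y) - m * (x' - x)) / w)))"
proof -
  let ?f = "\<lambda>m c. slope_cutoff m * (wavelet M ((y - m * x - c) / w) * wavelet M ((y' - m * x' - c) / w))"
  let ?g = "\<lambda>m A. slope_cutoff m * (wavelet M A * wavelet M (A + ((y' - y) - m * (x' - x)) / w))"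
  have split: "case_prod h = (\<lambda>z. h (fst z) (snd z))" for h :: "real \<Rightarrow> real \<Rightarrow> real"
    by auto
  have "integrable (lborel \<Otimes>\<^sub>M lborel) (case_prod ?f)"
    unfolding lborel_prod split
    using integrable_line_product[OF M w, of x y x' y'] unfolding line_product_def[abs_def] .
  from lborel_pair.integral_fst[OF this]
  have "(\<integral>m. (\<integral>c. ?f m c \<partial>lborel) \<partial>lborel) = line_kernel M w x y x' y'"
    unfolding lborel_prod split line_kernel_def line_product_def[abs_def] .
  then have "line_kernel M w x y x' y' = (\<integral>m. (\<integral>c. ?f m c \<partial>lborel) \<partial>lborel)" ..
  also have "\<dots> = (\<integral>m. w * (\<integral>A. ?g m A \<partial>lborel) \<partial>lborel)"
  proof (intro Bochner_Integration.integral_cong refl)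
    fix m :: real
    have e: "(y - m * x - (y - m * x + - w * A)) / w = A"
      "(y' - m * x' - (y - m * x + - w * A)) / w = A + ((y' - y) - m * (x' - x)) / w" for A
      using w by (auto simp: field_simps)
    show "(\<integral>c. ?f m c \<partial>lborel) = w * (\<integral>A. ?g m A \<partial>lborel)"
      using w by (subst lborel_integral_real_affine[of "- w" _ "y - m * x"]) (auto simp only: e, simp)
  qed
  also have "\<dots> = w * (\<integral>m. (\<integral>A. ?g m A \<partial>lborel) \<partial>lborel)" by simp
  also have "(\<integral>m. (\<integral>A. ?g m A \<partial>lborel) \<partial>lborel) = (\<integral>A. (\<integral>m. ?g m A \<partial>lborel) \<partial>lborel)"
  proof (rule lborel_pair.Fubini_integral[symmetric])
    have "integrable lborel (\<lambda>z. ?g (fst z) (snd z))"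
    proof (rule integrable_bounded_support[where S = "{-3..3} \<times> {-M..M}" and B = 1])
      fix z :: "real \<times> real" 
      show "\<bar>?g (fst z) (snd z)\<bar> \<le> 1"
        unfolding abs_mult using wavelet_bound[OF M] slope_cutoff_simps(1,2)[of "fst z"]
        by (intro mult_le_one) auto
      assume z: "z \<notin> {-3..3} \<times> {-M..M}"
      show "?g (fst z) (snd z) = 0"
      proof (cases "\<bar>fst z\<bar> \<le> 3")
        case True
        then have "M \<le> \<bar>snd z\<bar>" using z by (cases z) (auto simp: abs_le_iff)
        then show ?thesis using M by (simp add: wavelet_support)
      qed (simp add: slope_cutoff_simps)
    next
      show "{-3..3} \<times> {-M..M} \<in> sets (lborel :: (real \<times> real) measure)"
        by (simp add: borel_closed closed_Times)
    qed (simp_all add: emeasure_lborel_rectangle_finite)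
    then show "integrable (lborel \<Otimes>\<^sub>M lborel) (case_prod ?g)"
      unfolding lborel_prod split .
  qed
  also have "(\<integral>A. (\<integral>m. ?g m A \<partial>lborel) \<partial>lborel) = (\<integral>A. wavelet M A *
     (\<integral>m. slope_cutoff m * wavelet M (A + ((y' - y) - m * (x' - x)) / w) \<partial>lborel) \<partial>lborel)"
    by (simp only: mult.left_commute[of "slope_cutoff _"] integral_mult_right_zero)
  finally show ?thesis .
qed

lemma line_kernel_le_aux:
  assumes M: "1 \<le> M" and w: "0 < w" and "0 \<le> B"
    and "\<And>A. \<bar>integral\<^sup>L lborel (\<lambda>m. slope_cutoff m * wavelet M (A + ((y' - y) - m * (x' - x)) / w))\<bar> \<le> B"
  shows "\<bar>line_kernel M w x y x' y'\<bar> \<le> 2 * M * w * B"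
proof -
  let ?G = "\<lambda>A. integral\<^sup>L lborel (\<lambda>m. slope_cutoff m * wavelet M (A + ((y' - y) - m * (x' - x)) / w))"
  have "\<bar>integral\<^sup>L lborel (\<lambda>A. wavelet M A * ?G A)\<bar> \<le> 2 * M * B"
  proof (rule abs_integral_interval_support)
    fix A :: real
    have "\<bar>wavelet M A\<bar> * \<bar>?G A\<bar> \<le> 1 * B"
      using wavelet_bound[OF M, of A] assms(4)[of A] by (intro mult_mono) auto
    then show "\<bar>wavelet M A * ?G A\<bar> \<le> B" by (simp add: abs_mult)
    assume "M < \<bar>A\<bar>"
    then show "wavelet M A * ?G A = 0" using M by (simp add: wavelet_support)
  qed (use assms in auto)
  then have "w * \<bar>integral\<^sup>L lborel (\<lambda>A. wavelet M A * ?G A)\<bar> \<le> w * (2 * M * B)"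
    using w by (intro mult_left_mono) auto
  then show ?thesis unfolding line_kernel_fubini[OF M w] abs_mult using w by (simp add: mult_ac)
qed

lemma line_kernel_trivial:
  assumes M: "1 \<le> M" and w: "0 < w"
  shows "\<bar>line_kernel M w x y x' y'\<bar> \<le> 12 * M * w"
proof -
  have "\<bar>line_kernel M w x y x' y'\<bar> \<le> 2 * M * w * (2 * 3 * 1)"
  proof (rule line_kernel_le_aux[OF M w])
    fix A
    show "\<bar>integral\<^sup>L lborel (\<lambda>m. slope_cutoff m * wavelet M (A + ((y' - y) - m * (x' - x)) / w))\<bar> \<le> 2 * 3 * 1"
    proof (rule abs_integral_interval_support)
      fix m :: real
      show "\<bar>slope_cutoff m * wavelet M (A + ((y' - y) - m * (x' - x)) / w)\<bar> \<le> 1"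
        unfolding abs_mult using wavelet_bound[OF M] slope_cutoff_simps(1,2)[of m]
        by (intro mult_le_one) auto
      show "slope_cutoff m * wavelet M (A + ((y' - y) - m * (x' - x)) / w) = 0" if "3 < \<bar>m\<bar>"
        using that by (simp add: slope_cutoff_simps)
    qed auto
  qed auto
  then show ?thesis by simp
qed

lemma line_kernel_decay:
  assumes M: "1 \<le> M" and w: "0 < w" and "x' \<noteq> x"
  shows "\<bar>line_kernel M w x y x' y'\<bar> \<le> 4 * M ^ 3 * w * (w / \<bar>x' - x\<bar>)\<^sup>2"
proof -
  have "\<bar>line_kernel M w x y x' y'\<bar> \<le> 2 * M * w * (2 * M\<^sup>2 * (w / \<bar>x' - x\<bar>)\<^sup>2)"
    using assms by (intro line_kernel_le_aux[OF M w] slope_average_bound) auto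
  then show ?thesis by (simp add: power2_eq_square power3_eq_cube mult_ac)
qed

lemma line_kernel_support:
  assumes M: "1 \<le> M" and w: "0 < w" and nz: "line_kernel M w x y x' y' \<noteq> 0"
  shows "\<bar>y' - y\<bar> \<le> 3 * \<bar>x' - x\<bar> + 2 * M * w"
proof (rule ccontr)
  assume *: "\<not> ?thesis"
  have "line_product M w x y x' y' z = 0" for z
  proof (rule ccontr)
    assume nz: "\<not> ?thesis"
    have 1: "\<bar>fst z\<bar> \<le> 3" using nz slope_cutoff_simps(3)[of "fst z"]
      by (cases "3 \<le> \<bar>fst z\<bar>") (auto simp: line_product_def)
    have small: "\<bar>u\<bar> \<le> M" if "wavelet M u \<noteq> 0" for u
      using wavelet_support[OF M, of u] that by linarith
    have "\<bar>(y - fst z * x - snd z) / w\<bar> \<le> M" "\<bar>(y' - fst z * x' - snd z) / w\<bar> \<le> M"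
      by (rule small; use nz in \<open>simp add: line_product_def\<close>)+
    then have 2: "\<bar>y - fst z * x - snd z\<bar> \<le> M * w" "\<bar>y' - fst z * x' - snd z\<bar> \<le> M * w"
      using w by (auto simp: abs_divide field_simps)
    have "\<bar>fst z * (x' - x)\<bar> \<le> 3 * \<bar>x' - x\<bar>" unfolding abs_mult using 1 by (intro mult_right_mono) auto
    then show False using 2 * by (simp add: algebra_simps)
  qed
  then have "line_kernel M w x y x' y' = 0"
    unfolding line_kernel_def by (intro integral_eq_zero_AE) simp
  then show False using nz by simp
qed

section \<open>One high-low step\<close>

context point_line_system begin

text \<open>How much the number of points near the line z at resolution w exceeds the number predicted by the
resolution M w.\<close>

definition fluctuation :: "real \<Rightarrow> real \<Rightarrow> real \<times> real \<Rightarrow> real" where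
  "fluctuation M w z = (\<Sum>p\<in>P. wavelet M ((y p - fst z * x p - snd z) / w))"

definition fluctuation_energy :: "real \<Rightarrow> real \<Rightarrow> real" where
  "fluctuation_energy M w = integral\<^sup>L lborel (\<lambda>z. slope_cutoff (fst z) * (fluctuation M w z)\<^sup>2)"

lemma energy_integrand_expand:
  "slope_cutoff (fst z) * (fluctuation M w z)\<^sup>2 = (\<Sum>p\<in>P. \<Sum>q\<in>P. line_product M w (x p) (y p) (x q) (y q) z)"
  by (simp only: fluctuation_def power2_eq_square sum_product line_product_def) (simp only: sum_distrib_left)

lemma integrable_energy:
  assumes "1 \<le> M" "0 < w"
  shows "integrable lborel (\<lambda>z. slope_cutoff (fst z) * (fluctuation M w z)\<^sup>2)"
  unfolding energy_integrand_expand using assms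
  by (intro Bochner_Integration.integrable_sum integrable_line_product)

lemma energy_eq_kernel_sum:
  assumes "1 \<le> M" "0 < w"
  shows "fluctuation_energy M w = (\<Sum>p\<in>P. \<Sum>q\<in>P. line_kernel M w (x p) (y p) (x q) (y q))"
  unfolding fluctuation_energy_def energy_integrand_expand line_kernel_def
  using integrable_line_product[OF assms]
  by (subst Bochner_Integration.integral_sum; (intro Bochner_Integration.integrable_sum)?;
      (intro sum.cong refl Bochner_Integration.integral_sum)?; simp)

text \<open>Points at distance up to about w contribute w each, and there are about (w/\<delta>) to the power
\<beta> of them. At distance s = 2^j w the number of points grows by the factor 2^(j \<beta>), at most
4^j, which the decay of the kernel cancels. So each of the J dyadic scales contributes at most as much
as the diagonal.\<close>

lemma kernel_row_sum:
  assumes M: "1 \<le> M" and w: "\<delta> \<le> w" and J: "2 \<le> 2 ^ J * w" and p: "p \<in> P"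
  shows "(\<Sum>q\<in>P. line_kernel M w (x p) (y p) (x q) (y q))
         \<le> (1 + real J) * (300 * M ^ 5 * K\<^sub>\<beta> * w * (w / \<delta>) powr \<beta>)"
proof -
  define k where "k q = \<bar>line_kernel M w (x p) (y p) (x q) (y q)\<bar>" for q
  define near where "near = {q\<in>P. \<bar>x q - x p\<bar> \<le> w \<and> k q \<noteq> 0}"
  define F where "F = {q\<in>P. w < \<bar>x q - x p\<bar> \<and> k q \<noteq> 0}"
  have wpos: "0 < w" using w delta by linarith
  have fin: "finite near" "finite F" using finP by (auto simp: near_def F_def)
  have supp: "\<bar>y q - y p\<bar> \<le> 3 * \<bar>x q - x p\<bar> + 2 * (M * w)" if "k q \<noteq> 0" for q
    using line_kernel_support[OF M wpos, of "x p" "y p" "x q" "y q"] that by (simp add: k_def mult.assoc)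
  have Mw: "w \<le> M * w" using M wpos by simp
  have "(\<Sum>q\<in>P. line_kernel M w (x p) (y p) (x q) (y q)) \<le> (\<Sum>q\<in>P. k q)"
    by (intro sum_mono) (simp add: k_def)
  also have "\<dots> = (\<Sum>q\<in>near \<union> F. k q)"
    using finP by (intro sum.mono_neutral_right) (auto simp: near_def F_def)
  also have "\<dots> = (\<Sum>q\<in>near. k q) + (\<Sum>q\<in>F. k q)"
    using fin by (intro sum.union_disjoint) (auto simp: near_def F_def)
  also have "(\<Sum>q\<in>near. k q) \<le> 300 * M ^ 5 * K\<^sub>\<beta> * w * (w / \<delta>) powr \<beta>"
  proof -
    have sub: "near \<subseteq> {q\<in>P. \<bar>x q - x p\<bar> \<le> (5 * M) * w \<and> \<bar>y q - y p\<bar> \<le> (5 * M) * w}"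
    proof
      fix q assume q: "q \<in> near"
      then have "\<bar>x q - x p\<bar> \<le> w" "\<bar>y q - y p\<bar> \<le> 3 * \<bar>x q - x p\<bar> + 2 * (M * w)" "q \<in> P"
        using supp[of q] by (auto simp: near_def)
      then have "\<bar>x q - x p\<bar> \<le> 5 * (M * w)" "\<bar>y q - y p\<bar> \<le> 5 * (M * w)" "q \<in> P"
        using Mw wpos by (smt (verit))+
      then show "q \<in> {q\<in>P. \<bar>x q - x p\<bar> \<le> (5 * M) * w \<and> \<bar>y q - y p\<bar> \<le> (5 * M) * w}"
        by (simp add: mult.assoc)
    qed
    have "real (card near) \<le> (5 * M)\<^sup>2 * K\<^sub>\<beta> * (w / \<delta>) powr \<beta>"
      using delta beta K M w by (intro dim_spaced_scaled[OF points _ _ _ _ _ _ sub]) auto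
    then have "real (card near) * (12 * M * w) \<le> ((5 * M)\<^sup>2 * K\<^sub>\<beta> * (w / \<delta>) powr \<beta>) * (12 * M * w)"
      using M wpos by (intro mult_right_mono) auto
    moreover have "(\<Sum>q\<in>near. k q) \<le> (\<Sum>q\<in>near. 12 * M * w)"
      unfolding k_def by (intro sum_mono line_kernel_trivial M wpos)
    moreover have "(\<Sum>q\<in>near. 12 * M * w) = real (card near) * (12 * M * w)"
      by simp
    ultimately have "(\<Sum>q\<in>near. k q) \<le> ((5 * M)\<^sup>2 * K\<^sub>\<beta> * (w / \<delta>) powr \<beta>) * (12 * M * w)"
      by linarith
    also have "\<dots> = M ^ 3 * (300 * K\<^sub>\<beta> * w * (w / \<delta>) powr \<beta>)"
      by (simp add: power2_eq_square power3_eq_cube)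
    also have "\<dots> \<le> M ^ 5 * (300 * K\<^sub>\<beta> * w * (w / \<delta>) powr \<beta>)"
      using M wpos K by (intro mult_right_mono power_increasing) auto
    finally show ?thesis by (simp add: mult_ac)
  qed
  also have "(\<Sum>q\<in>F. k q) \<le> real J * (300 * M ^ 5 * K\<^sub>\<beta> * w * (w / \<delta>) powr \<beta>)"
  proof (rule dyadic_sum_bound[OF fin(2) wpos, where d = "\<lambda>q. \<bar>x q - x p\<bar>"])
    fix q assume q: "q \<in> F"
    have "\<bar>x q - x p\<bar> \<le> 2" using x_bound[of q] x_bound[OF p] q by (auto simp: F_def)
    then show "w < \<bar>x q - x p\<bar>" "\<bar>x q - x p\<bar> \<le> 2 ^ J * w" using q J by (auto simp: F_def)
  next
    fix s assume sw: "w \<le> s"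
    define G where "G = {q\<in>F. s < \<bar>x q - x p\<bar> \<and> \<bar>x q - x p\<bar> \<le> 2 * s}"
    have spos: "0 < s" using sw wpos by linarith
    have Ms: "s \<le> M * s" "M * w \<le> M * s" using M spos sw by auto
    have sub: "G \<subseteq> {q\<in>P. \<bar>x q - x p\<bar> \<le> (8 * M) * s \<and> \<bar>y q - y p\<bar> \<le> (8 * M) * s}"
    proof
      fix q assume q: "q \<in> G"
      then have "\<bar>x q - x p\<bar> \<le> 2 * s" "\<bar>y q - y p\<bar> \<le> 3 * \<bar>x q - x p\<bar> + 2 * (M * w)" "q \<in> P"
        using supp[of q] by (auto simp: G_def F_def)
      then have "\<bar>x q - x p\<bar> \<le> 8 * (M * s)" "\<bar>y q - y p\<bar> \<le> 8 * (M * s)" "q \<in> P"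
        using Ms spos by (smt (verit))+
      then show "q \<in> {q\<in>P. \<bar>x q - x p\<bar> \<le> (8 * M) * s \<and> \<bar>y q - y p\<bar> \<le> (8 * M) * s}"
        by (simp add: mult.assoc)
    qed
    have "real (card (G)) \<le> (8 * M)\<^sup>2 * K\<^sub>\<beta> * (s / \<delta>) powr \<beta>"
      using delta beta K M w sw by (intro dim_spaced_scaled[OF points _ _ _ _ _ _ sub]) auto
    moreover have "(\<Sum>q\<in>G. k q) \<le> (\<Sum>q\<in>G. 4 * M ^ 3 * w * (w / s)\<^sup>2)"
    proof (intro sum_mono)
      fix q assume q: "q \<in> G"
      then have d: "s < \<bar>x q - x p\<bar>" by (auto simp: G_def)
      have "k q \<le> 4 * M ^ 3 * w * (w / \<bar>x q - x p\<bar>)\<^sup>2"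
        unfolding k_def using d spos by (intro line_kernel_decay M wpos) auto
      also have "\<dots> \<le> 4 * M ^ 3 * w * (w / s)\<^sup>2"
        using d spos wpos M by (intro mult_left_mono power_mono divide_left_mono) auto
      finally show "k q \<le> 4 * M ^ 3 * w * (w / s)\<^sup>2" .
    qed
    moreover have "(\<Sum>q\<in>G. 4 * M ^ 3 * w * (w / s)\<^sup>2) = real (card (G)) * (4 * M ^ 3 * w * (w / s)\<^sup>2)"
      by simp
    moreover have "0 \<le> 4 * M ^ 3 * w * (w / s)\<^sup>2" using M wpos by simp
    ultimately have "(\<Sum>q\<in>G. k q) \<le> ((8 * M)\<^sup>2 * K\<^sub>\<beta> * (s / \<delta>) powr \<beta>) * (4 * M ^ 3 * w * (w / s)\<^sup>2)"
      using mult_right_mono[of "real (card (G))" "(8 * M)\<^sup>2 * K\<^sub>\<beta> * (s / \<delta>) powr \<beta>"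
        "4 * M ^ 3 * w * (w / s)\<^sup>2"] by linarith
    also have "\<dots> = (256 * M ^ 5 * K\<^sub>\<beta> * w) * ((s / \<delta>) powr \<beta> * (w / s)\<^sup>2)"
      by (simp add: power_mult_distrib numeral_eq_Suc mult_ac)
    also have "(s / \<delta>) powr \<beta> * (w / s)\<^sup>2 = (w / \<delta>) powr \<beta> * (s / w) powr (\<beta> - 2)"
      using wpos spos delta by (simp add: powr_divide powr_diff powr_numeral power_divide)
    also have "\<dots> \<le> (w / \<delta>) powr \<beta> * 1"
    proof (intro mult_left_mono)
      have "(s / w) powr (\<beta> - 2) \<le> 1 powr (\<beta> - 2)"
        using sw wpos beta by (intro powr_mono2') auto
      then show "(s / w) powr (\<beta> - 2) \<le> 1" by simp
    qed simp
    also have "(256 * M ^ 5 * K\<^sub>\<beta> * w) * ((w / \<delta>) powr \<beta> * 1) \<le> (300 * M ^ 5 * K\<^sub>\<beta> * w) * ((w / \<delta>) powr \<beta> * 1)"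
      using M K wpos by (intro mult_right_mono) auto
    finally show "sum k {q\<in>F. s < \<bar>x q - x p\<bar> \<and> \<bar>x q - x p\<bar> \<le> 2 * s}
        \<le> 300 * M ^ 5 * K\<^sub>\<beta> * w * (w / \<delta>) powr \<beta>"
      using M K wpos by (simp add: G_def mult_ac)
  qed (simp add: k_def)
  finally show ?thesis by (simp add: algebra_simps)
qed

lemma energy_bound:
  assumes M: "1 \<le> M" and w: "\<delta> \<le> w" and J: "2 \<le> 2 ^ J * w"
  shows "fluctuation_energy M w \<le> 1200 * (1 + real J) * M ^ 5 * K\<^sub>\<beta>\<^sup>2 * w * \<delta> powr - \<beta> * (w / \<delta>) powr \<beta>"
proof -
  have wpos: "0 < w" using w delta by linarith
  have "fluctuation_energy M w \<le> (\<Sum>p\<in>P. (1 + real J) * (300 * M ^ 5 * K\<^sub>\<beta> * w * (w / \<delta>) powr \<beta>))"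
    unfolding energy_eq_kernel_sum[OF M wpos] by (intro sum_mono kernel_row_sum[OF M w J])
  also have "\<dots> = real (card P) * ((1 + real J) * (300 * M ^ 5 * K\<^sub>\<beta> * w * (w / \<delta>) powr \<beta>))"
    by simp
  also have "\<dots> \<le> (4 * K\<^sub>\<beta> * \<delta> powr - \<beta>) * ((1 + real J) * (300 * M ^ 5 * K\<^sub>\<beta> * w * (w / \<delta>) powr \<beta>))"
    using cardP K M wpos by (intro mult_right_mono) auto
  finally show ?thesis by (simp add: power2_eq_square algebra_simps)
qed

text \<open>If z is within w of the line t in both parameters, then z passes within 3 w of every point that is
within w of t; there the bump of width 6 w is at least one half. Conversely the wide bump at z lives on
points within 8 M w of t.\<close>

lemma high_low_pointwise:
  assumes M: "1 \<le> M" and w: "0 < w" and p: "p \<in> P" "t \<in> T"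
    and z: "\<bar>fst z - m t\<bar> \<le> w" "\<bar>snd z - c t\<bar> \<le> w"
  shows "of_bool (\<bar>y p - m t * x p - c t\<bar> \<le> w)
     \<le> 2 * wavelet M ((y p - fst z * x p - snd z) / (6 * w))
        + 2 / M * of_bool (\<bar>y p - m t * x p - c t\<bar> \<le> 8 * M * w)"
proof -
  let ?v = "y p - fst z * x p - snd z"
  let ?d = "y p - m t * x p - c t"
  have "\<bar>(fst z - m t) * x p\<bar> \<le> w * 1" unfolding abs_mult using z x_bound[OF p(1)] w by (intro mult_mono) auto
  then have close: "\<bar>?v - ?d\<bar> \<le> 2 * w" using z by (simp add: algebra_simps)
  have eq: "wavelet M (?v / (6 * w)) = hat (?v / (6 * w)) - hat (?v / (6 * w) / M) / M"
    by (simp add: wavelet_def)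
  have low: "hat (?v / (6 * w) / M) / M \<le> 1 / M * of_bool (\<bar>?d\<bar> \<le> 8 * M * w)"
  proof (cases "\<bar>?d\<bar> \<le> 8 * M * w")
    case True
    then show ?thesis using M hat_bounds[of "?v / (6 * w) / M"] by (simp add: divide_right_mono)
  next
    case False
    have "w \<le> M * w" using M w by simp
    then have "6 * M * w \<le> \<bar>?v\<bar>" using False close by linarith
    then have "1 \<le> \<bar>?v / (6 * w) / M\<bar>" using M w by (simp add: abs_divide abs_mult field_simps)
    then show ?thesis using False by (simp add: hat_support)
  qed
  have high: "of_bool (\<bar>?d\<bar> \<le> w) \<le> 2 * hat (?v / (6 * w))"
  proof (cases "\<bar>?d\<bar> \<le> w")
    case True
    then have "\<bar>?v\<bar> \<le> 3 * w" using close by linarith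
    then have "\<bar>?v / (6 * w)\<bar> \<le> 1 / 2" using w by (simp add: abs_divide field_simps)
    from hat_ge_half[OF this] show ?thesis using True by simp
  qed (simp add: hat_bounds)
  show ?thesis using low high unfolding eq by (simp add: algebra_simps)
qed

text \<open>Integrates \<open>high_low_pointwise\<close> over the square of side 2 w around each line of the family.
The squares overlap at most \<open>K\<^sub>\<alpha> * (w / \<delta>) powr \<alpha>\<close> times, so
that the sum of the local L2 norms is controlled by the global energy. The free parameter \<mu> comes
from using 2 D \<le> \<mu> + D^2/\<mu> in place of the Cauchy-Schwarz inequality.\<close>

lemma high_low_step:
  assumes M: "1 \<le> M" and w: "\<delta> \<le> w" "w \<le> 1" and lam: "0 < \<mu>"
  shows "inc w \<le> 2 / M * inc (8 * M * w) + \<mu> * real (card T)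
     + K\<^sub>\<alpha> * (w / \<delta>) powr \<alpha> * fluctuation_energy M (6 * w) / (4 * w\<^sup>2 * \<mu>)"
proof -
  define n where "n r t = real (card {p\<in>P. \<bar>y p - m t * x p - c t\<bar> \<le> r})" for r t
  define N where "N t = {m t - w..m t + w} \<times> {c t - w..c t + w}" for t
  define h where "h z = slope_cutoff (fst z) * (fluctuation M (6 * w) z)\<^sup>2" for z
  define Q where "Q t = n w t - 2 / M * n (8 * M * w) t - \<mu>" for t
  have wpos: "0 < w" using w delta by linarith
  have hint: "integrable lborel h"
    unfolding h_def using M wpos by (intro integrable_energy) auto
  have h0: "0 \<le> h z" for z by (simp add: h_def slope_cutoff_simps)
  have Nsets: "N t \<in> sets lborel" for t by (simp add: N_def borel_closed closed_Times)
  have Nint: "integrable lborel (\<lambda>z. indicator (N t) z :: real)" for t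
    using Nsets emeasure_lborel_rectangle_finite unfolding N_def by (intro integrable_real_indicator) auto
  have Nmeas: "measure lborel (N t) = 4 * w\<^sup>2" for t
  proof -
    have "N t = cbox (m t - w, c t - w) (m t + w, c t + w)" by (auto simp: N_def)
    then show ?thesis using wpos
      by (simp add: content_Pair power2_eq_square)
  qed
  have n_eq: "n r t = (\<Sum>p\<in>P. of_bool (\<bar>y p - m t * x p - c t\<bar> \<le> r))" for r t
    using finP by (simp add: n_def of_bool_def sum.If_cases Int_def)
  have point: "Q t \<le> h z / \<mu>" if "t \<in> T" "z \<in> N t" for t z
  proof -
    have z: "\<bar>fst z - m t\<bar> \<le> w" "\<bar>snd z - c t\<bar> \<le> w" using that by (auto simp: N_def abs_le_iff)
    have "n w t \<le> (\<Sum>p\<in>P. 2 * wavelet M ((y p - fst z * x p - snd z) / (6 * w))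
        + 2 / M * of_bool (\<bar>y p - m t * x p - c t\<bar> \<le> 8 * M * w))"
      unfolding n_eq using that z by (intro sum_mono high_low_pointwise M wpos)
    also have "\<dots> = 2 * fluctuation M (6 * w) z + 2 / M * n (8 * M * w) t"
      by (simp add: n_eq fluctuation_def sum.distrib sum_distrib_left)
    finally have 1: "Q t \<le> 2 * fluctuation M (6 * w) z - \<mu>" by (simp add: Q_def)
    have "0 \<le> (fluctuation M (6 * w) z - \<mu>)\<^sup>2 / \<mu>" using lam by simp
    also have "\<dots> = (fluctuation M (6 * w) z)\<^sup>2 / \<mu> - 2 * fluctuation M (6 * w) z + \<mu>"
      using lam by (simp add: power2_eq_square field_simps)
    finally have "Q t \<le> (fluctuation M (6 * w) z)\<^sup>2 / \<mu>" using 1 by simp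
    moreover have "\<bar>fst z\<bar> \<le> 2" using z m_bound[OF that(1)] w by linarith
    ultimately show ?thesis by (simp add: h_def slope_cutoff_simps)
  qed
  have overlap: "(\<Sum>t\<in>T. indicator (N t) z) \<le> K\<^sub>\<alpha> * (w / \<delta>) powr \<alpha>" for z
  proof -
    have "(\<Sum>t\<in>T. indicator (N t) z :: real) = real (card {t\<in>T. z \<in> N t})"
      using finT by (simp add: indicator_def of_bool_def sum.If_cases Int_def)
    also have "\<dots> \<le> K\<^sub>\<alpha> * (w / \<delta>) powr \<alpha>"
      using w by (intro dim_spacedD[OF lines, where u = "fst z" and v = "snd z"])
        (auto simp: N_def abs_le_iff)
    finally show ?thesis .
  qed
  have "(\<Sum>t\<in>T. Q t) * (4 * w\<^sup>2) = integral\<^sup>L lborel (\<lambda>z. \<Sum>t\<in>T. Q t * indicator (N t) z)"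
  proof -
    have "integral\<^sup>L lborel (\<lambda>z. \<Sum>t\<in>T. Q t * indicator (N t) z)
        = (\<Sum>t\<in>T. integral\<^sup>L lborel (\<lambda>z. Q t * indicator (N t) z))"
      using Nint by (intro Bochner_Integration.integral_sum integrable_mult_right)
    also have "\<dots> = (\<Sum>t\<in>T. Q t * (4 * w\<^sup>2))" using Nmeas by simp
    finally show ?thesis by (simp add: sum_distrib_right)
  qed
  also have "\<dots> \<le> integral\<^sup>L lborel (\<lambda>z. K\<^sub>\<alpha> * (w / \<delta>) powr \<alpha> / \<mu> * h z)"
  proof (intro integral_mono Bochner_Integration.integrable_sum integrable_mult_right Nint hint)
    fix z
    have "(\<Sum>t\<in>T. Q t * indicator (N t) z) \<le> (\<Sum>t\<in>T. h z / \<mu> * indicator (N t) z)"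
      using point by (intro sum_mono) (auto simp: indicator_def)
    also have "\<dots> = h z / \<mu> * (\<Sum>t\<in>T. indicator (N t) z)" by (simp add: sum_distrib_left)
    also have "\<dots> \<le> h z / \<mu> * (K\<^sub>\<alpha> * (w / \<delta>) powr \<alpha>)"
      using h0 lam overlap by (intro mult_left_mono) auto
    finally show "(\<Sum>t\<in>T. Q t * indicator (N t) z) \<le> K\<^sub>\<alpha> * (w / \<delta>) powr \<alpha> / \<mu> * h z"
      by (simp add: mult_ac)
  qed
  also have "\<dots> = K\<^sub>\<alpha> * (w / \<delta>) powr \<alpha> / \<mu> * fluctuation_energy M (6 * w)"
    by (simp add: fluctuation_energy_def h_def)
  finally have "(\<Sum>t\<in>T. Q t) \<le> K\<^sub>\<alpha> * (w / \<delta>) powr \<alpha> / \<mu> * fluctuation_energy M (6 * w) / (4 * w\<^sup>2)"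
    by (subst pos_le_divide_eq) (use wpos in auto)
  moreover have "(\<Sum>t\<in>T. Q t) = inc w - 2 / M * inc (8 * M * w) - \<mu> * real (card T)"
    unfolding card_near_pairs_by_lines[OF finP finT]
    by (simp add: Q_def n_def sum_subtractf sum_distrib_left)
  ultimately show ?thesis by (simp add: field_simps)
qed

end

section \<open>Induction on scales\<close>

context point_line_system begin

text \<open>The high-low step with the optimal \<mu>. The exponent of w is half of \<open>\<alpha> + \<beta> -
1\<close>: the overlap of the squares gives \<alpha>, the diagonal energy gives \<open>\<beta> +
1\<close>, and the area of a square takes 2 away.\<close>

lemma inc_coarsen:
  assumes M: "1 \<le> M" and w: "\<delta> \<le> w" "w \<le> 1"
  shows "inc w \<le> 2 / M * inc (8 * M * w)
     + 64804 * (real (scale_count \<delta>) + 1) * M ^ 5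
       * (K\<^sub>\<alpha> * K\<^sub>\<beta> * \<delta> powr - (\<alpha> + \<beta>)) * w powr ((\<alpha> + \<beta> - 1) / 2)"
proof -
  define L where "L = real (scale_count \<delta>) + 1"
  define \<kappa> where "\<kappa> = (\<alpha> + \<beta> - 1) / 2"
  define X where "X = K\<^sub>\<alpha> * K\<^sub>\<beta> * \<delta> powr - (\<alpha> + \<beta>)"
  \<comment> \<open>This balances the two error terms of high_low_step.\<close>
  define \<mu> where "\<mu> = K\<^sub>\<beta> * \<delta> powr - \<beta> * w powr \<kappa>"
  have Xeq: "X = K\<^sub>\<alpha> * K\<^sub>\<beta> * (\<delta> powr - \<alpha> * \<delta> powr - \<beta>)"
    by (simp add: X_def flip: powr_add)
  have wpos: "0 < w" using w delta by linarith
  have mu: "0 < \<mu>" using K wpos delta by (simp add: \<mu>_def)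
  have L1: "1 \<le> L" by (simp add: L_def)
  have "2 \<le> 2 ^ scale_count \<delta> * \<delta>" by (rule dyadic_scales_reach[OF delta(1)])
  also have "\<dots> \<le> 2 ^ scale_count \<delta> * (6 * w)" using w wpos by (intro mult_left_mono) auto
  finally have J: "2 \<le> 2 ^ scale_count \<delta> * (6 * w)" .
  have "\<mu> * real (card T) \<le> \<mu> * (4 * K\<^sub>\<alpha> * \<delta> powr - \<alpha>)"
    using cardT mu by (intro mult_left_mono) auto
  also have "\<dots> = 4 * X * w powr \<kappa>"
    by (simp add: \<mu>_def Xeq mult_ac)
  also have "\<dots> \<le> 4 * L * M ^ 5 * X * w powr \<kappa>"
  proof -
    have "1 * 1 \<le> L * M ^ 5" using L1 M by (intro mult_mono one_le_power) auto
    then have "1 * (4 * X * w powr \<kappa>) \<le> L * M ^ 5 * (4 * X * w powr \<kappa>)"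
      using K by (intro mult_right_mono) (auto simp: X_def)
    then show ?thesis by (simp add: mult_ac)
  qed
  finally have first: "\<mu> * real (card T) \<le> 4 * L * M ^ 5 * X * w powr \<kappa>" .
  have "fluctuation_energy M (6 * w)
      \<le> 1200 * L * M ^ 5 * K\<^sub>\<beta>\<^sup>2 * (6 * w) * \<delta> powr - \<beta> * (6 * w / \<delta>) powr \<beta>"
    using energy_bound[OF M _ J] w wpos by (simp add: L_def add.commute)
  also have "\<dots> \<le> 1200 * L * M ^ 5 * K\<^sub>\<beta>\<^sup>2 * (6 * w) * \<delta> powr - \<beta> * (36 * (w / \<delta>) powr \<beta>)"
  proof (intro mult_left_mono)
    have "(6 * w / \<delta>) powr \<beta> = 6 powr \<beta> * (w / \<delta>) powr \<beta>"
      using wpos delta by (simp add: powr_mult flip: times_divide_eq_right)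
    also have "\<dots> \<le> 6 powr 2 * (w / \<delta>) powr \<beta>"
      using beta by (intro mult_right_mono powr_mono) auto
    finally show "(6 * w / \<delta>) powr \<beta> \<le> 36 * (w / \<delta>) powr \<beta>" by simp
  qed (use L1 M wpos in auto)
  finally have "K\<^sub>\<alpha> * (w / \<delta>) powr \<alpha> * fluctuation_energy M (6 * w) / (4 * w\<^sup>2 * \<mu>)
    \<le> K\<^sub>\<alpha> * (w / \<delta>) powr \<alpha> * (1200 * L * M ^ 5 * K\<^sub>\<beta>\<^sup>2 * (6 * w) * \<delta> powr - \<beta> * (36 * (w / \<delta>) powr \<beta>))
        / (4 * w\<^sup>2 * \<mu>)"
    using K mu wpos by (intro divide_right_mono mult_left_mono) auto
  also have "\<dots> = 64800 * L * M ^ 5 * X * w powr \<kappa>"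
  proof -
    have "w powr \<kappa> * w powr \<kappa> = w powr (\<alpha> + \<beta> - 1)"
      by (simp add: \<kappa>_def flip: powr_add)
    also have "\<dots> = w powr \<alpha> * w powr \<beta> / w"
      using wpos by (simp add: powr_diff powr_add)
    finally have *: "w powr \<alpha> * w powr \<beta> = w * (w powr \<kappa> * w powr \<kappa>)" using wpos by simp
    have "K\<^sub>\<alpha> * (w / \<delta>) powr \<alpha> * (1200 * L * M ^ 5 * K\<^sub>\<beta>\<^sup>2 * (6 * w) * \<delta> powr - \<beta> * (36 * (w / \<delta>) powr \<beta>))
      = 259200 * L * M ^ 5 * K\<^sub>\<beta>\<^sup>2 * K\<^sub>\<alpha> * w * \<delta> powr - \<beta> * \<delta> powr - \<alpha> * \<delta> powr - \<beta> * (w powr \<alpha> * w powr \<beta>)"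
      using wpos delta by (simp add: powr_divide powr_minus_divide mult_ac)
    also have "\<dots> = (64800 * L * M ^ 5 * X * w powr \<kappa>) * (4 * w\<^sup>2 * \<mu>)"
      unfolding * by (simp add: \<mu>_def Xeq power2_eq_square mult_ac)
    finally have eq: "K\<^sub>\<alpha> * (w / \<delta>) powr \<alpha> * (1200 * L * M ^ 5 * K\<^sub>\<beta>\<^sup>2 * (6 * w) * \<delta> powr - \<beta> * (36 * (w / \<delta>) powr \<beta>))
      = (64800 * L * M ^ 5 * X * w powr \<kappa>) * (4 * w\<^sup>2 * \<mu>)" .
    have "4 * w\<^sup>2 * \<mu> \<noteq> 0" using wpos mu by simp
    then show ?thesis unfolding eq by (rule nonzero_mult_div_cancel_right)
  qed
  finally have second: "K\<^sub>\<alpha> * (w / \<delta>) powr \<alpha> * fluctuation_energy M (6 * w) / (4 * w\<^sup>2 * \<mu>)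
      \<le> 64800 * L * M ^ 5 * X * w powr \<kappa>" .
  show ?thesis
    using high_low_step[OF M w mu] first second unfolding L_def[symmetric] X_def[symmetric] \<kappa>_def[symmetric]
    by (simp add: algebra_simps)
qed

text \<open>Each step multiplies the resolution by 8 M and the count by 2/M, a loss of the constant 16 against exact
scaling. Taking M so large that this constant is at most half of (8 M) to the power \<epsilon> turns the
loss into \<open>w powr -\<epsilon>\<close> and leaves room for the error term of every step.\<close>

lemma inc_induction_on_scales:
  assumes M: "1 \<le> M" "32 \<le> (8 * M) powr \<epsilon>" and eps: "0 < \<epsilon>"
    and g: "\<gamma> \<le> 1" "\<gamma> \<le> (\<alpha> + \<beta> - 1) / 2"
    and A: "A = 129608 * (real (scale_count \<delta>) + 1) * M ^ 5 + 128 * M"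
  shows "\<delta> \<le> w \<Longrightarrow> w \<le> 1 \<Longrightarrow> 1 \<le> (8 * M) ^ n * w \<Longrightarrow>
    inc w \<le> A * (K\<^sub>\<alpha> * K\<^sub>\<beta> * \<delta> powr - (\<alpha> + \<beta>)) * w powr (\<gamma> - \<epsilon>)"
proof (induction n arbitrary: w)
  case 0
  define X where "X = K\<^sub>\<alpha> * K\<^sub>\<beta> * \<delta> powr - (\<alpha> + \<beta>)"
  have X0: "0 \<le> X" using K by (simp add: X_def)
  have "16 \<le> A" unfolding A using M by (intro add_increasing) auto
  have "inc w \<le> 16 * X" using inc_trivial by (simp add: X_def mult_ac)
  also have "\<dots> \<le> A * X" using \<open>16 \<le> A\<close> X0 by (intro mult_right_mono) auto
  finally show ?case using 0 unfolding X_def[symmetric] by simp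
next
  case (Suc n)
  define X where "X = K\<^sub>\<alpha> * K\<^sub>\<beta> * \<delta> powr - (\<alpha> + \<beta>)"
  define B where "B = 64804 * (real (scale_count \<delta>) + 1) * M ^ 5"
  have AB: "A = 2 * B + 128 * M" by (simp add: A B_def)
  have B0: "0 \<le> B" using M by (simp add: B_def)
  have X0: "0 \<le> X" using K by (simp add: X_def)
  have wpos: "0 < w" using Suc.prems delta by linarith
  show ?case
  proof (cases "8 * M * w \<le> 1")
    case True
    have "w \<le> 8 * M * w" using M wpos by simp
    then have "inc (8 * M * w) \<le> A * X * (8 * M * w) powr (\<gamma> - \<epsilon>)"
      unfolding X_def using Suc.prems True by (intro Suc.IH) (auto simp: mult_ac)
    then have "2 / M * inc (8 * M * w) \<le> 2 / M * (A * X * (8 * M * w) powr (\<gamma> - \<epsilon>))"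
      using M by (intro mult_left_mono) auto
    also have "\<dots> = (2 / M * (8 * M) powr (\<gamma> - \<epsilon>)) * (A * X * w powr (\<gamma> - \<epsilon>))"
      using M wpos by (simp add: powr_mult)
    also have "\<dots> \<le> 1 / 2 * (A * X * w powr (\<gamma> - \<epsilon>))"
    proof (intro mult_right_mono)
      have "(8 * M) powr (\<gamma> - \<epsilon>) \<le> (8 * M) powr (1 - \<epsilon>)" using M g by (intro powr_mono) auto
      also have "\<dots> = 8 * M / (8 * M) powr \<epsilon>" using M by (simp add: powr_diff)
      also have "\<dots> \<le> 8 * M / 32" using M by (intro divide_left_mono) auto
      finally show "2 / M * (8 * M) powr (\<gamma> - \<epsilon>) \<le> 1 / 2" using M by (simp add: field_simps)
    qed (use AB B0 X0 M in auto)
    finally have 1: "2 / M * inc (8 * M * w) \<le> 1 / 2 * (A * X * w powr (\<gamma> - \<epsilon>))" .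
    have "B * X * w powr ((\<alpha> + \<beta> - 1) / 2) \<le> B * X * w powr (\<gamma> - \<epsilon>)"
      using B0 X0 wpos Suc.prems g eps by (intro mult_left_mono powr_mono') auto
    also have "\<dots> \<le> (1 / 2 * A) * X * w powr (\<gamma> - \<epsilon>)"
      using AB M X0 by (intro mult_right_mono) auto
    finally have "B * X * w powr ((\<alpha> + \<beta> - 1) / 2) \<le> 1 / 2 * (A * X * w powr (\<gamma> - \<epsilon>))" by simp
    then have "inc w \<le> A * X * w powr (\<gamma> - \<epsilon>)"
      using inc_coarsen[OF M(1) Suc.prems(1,2)] 1 unfolding X_def[symmetric] B_def[symmetric] by linarith
    then show ?thesis by (simp add: X_def)
  next
    case False
    have "w powr 1 \<le> w powr (\<gamma> - \<epsilon>)" using wpos Suc.prems g eps by (intro powr_mono') auto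
    then have "8 * M * w \<le> 8 * M * w powr (\<gamma> - \<epsilon>)" using wpos M by (intro mult_left_mono) auto
    then have 1: "1 \<le> 8 * M * w powr (\<gamma> - \<epsilon>)" using False by linarith
    have "inc w \<le> 16 * X * 1" using inc_trivial by (simp add: X_def mult_ac)
    also have "\<dots> \<le> 16 * X * (8 * M * w powr (\<gamma> - \<epsilon>))" using 1 X0 by (intro mult_left_mono) auto
    also have "\<dots> = (128 * M) * X * w powr (\<gamma> - \<epsilon>)" by simp
    also have "\<dots> \<le> A * X * w powr (\<gamma> - \<epsilon>)" using AB B0 X0 by (intro mult_right_mono) auto
    finally show ?thesis by (simp add: X_def)
  qed
qed

end

section \<open>The exponent of a point-line system\<close>

text \<open>The estimate with exponent e and a constant that does not depend on the system. The last two arguments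
fix the index types, over which a formula cannot quantify.\<close>

definition incidence_bound :: "real \<Rightarrow> real \<Rightarrow> real \<Rightarrow> 'a itself \<Rightarrow> 'b itself \<Rightarrow> bool" where
  "incidence_bound \<alpha> \<beta> e _ _ \<longleftrightarrow> (\<exists>C>0. \<forall>\<delta> K\<^sub>\<beta> (P :: 'a set) x y K\<^sub>\<alpha> (T :: 'b set) m c.
      point_line_system \<delta> \<beta> K\<^sub>\<beta> P x y \<alpha> K\<^sub>\<alpha> T m c \<longrightarrow>
      real (card (near_pairs \<delta> P x y T m c)) \<le> C * K\<^sub>\<alpha> * K\<^sub>\<beta> * \<delta> powr - e)"

lemma incidence_bound_dual:
  assumes "incidence_bound \<alpha> \<beta> e TYPE('a) TYPE('b)"
  shows "incidence_bound \<beta> \<alpha> e TYPE('b) TYPE('a)"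
proof -
  obtain C where C: "C > 0" "\<And>\<delta> K\<^sub>\<beta> (P :: 'a set) x y K\<^sub>\<alpha> (T :: 'b set) m c.
      point_line_system \<delta> \<beta> K\<^sub>\<beta> P x y \<alpha> K\<^sub>\<alpha> T m c \<Longrightarrow>
      real (card (near_pairs \<delta> P x y T m c)) \<le> C * K\<^sub>\<alpha> * K\<^sub>\<beta> * \<delta> powr - e"
    using assms unfolding incidence_bound_def by blast
  show ?thesis unfolding incidence_bound_def
  proof (intro exI[of _ C] conjI C(1) allI impI)
    fix \<delta> K\<^sub>\<alpha> K\<^sub>\<beta> x y m c and P :: "'b set" and T :: "'a set"
    assume "point_line_system \<delta> \<alpha> K\<^sub>\<alpha> P x y \<beta> K\<^sub>\<beta> T m c"
    from C(2)[OF point_line_duality[OF this]]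
    show "real (card (near_pairs \<delta> P x y T m c)) \<le> C * K\<^sub>\<beta> * K\<^sub>\<alpha> * \<delta> powr - e"
      by (simp add: card_near_pairs_dual mult_ac)
  qed
qed

lemma incidence_boundI:
  assumes "0 < C" "\<And>\<delta> K\<^sub>\<beta> (P :: 'a set) x y K\<^sub>\<alpha> (T :: 'b set) m c.
      point_line_system \<delta> \<beta> K\<^sub>\<beta> P x y \<alpha> K\<^sub>\<alpha> T m c \<Longrightarrow>
      real (card (near_pairs \<delta> P x y T m c)) \<le> C * K\<^sub>\<alpha> * K\<^sub>\<beta> * \<delta> powr - e"
  shows "incidence_bound \<alpha> \<beta> e TYPE('a) TYPE('b)"
  using assms unfolding incidence_bound_def by blast

lemma incidence_bound_mono:
  assumes "incidence_bound \<alpha> \<beta> e TYPE('a) TYPE('b)" "e \<le> e'"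
  shows "incidence_bound \<alpha> \<beta> e' TYPE('a) TYPE('b)"
proof -
  obtain C where C: "C > 0" "\<And>\<delta> K\<^sub>\<beta> (P :: 'a set) x y K\<^sub>\<alpha> (T :: 'b set) m c.
      point_line_system \<delta> \<beta> K\<^sub>\<beta> P x y \<alpha> K\<^sub>\<alpha> T m c \<Longrightarrow>
      real (card (near_pairs \<delta> P x y T m c)) \<le> C * K\<^sub>\<alpha> * K\<^sub>\<beta> * \<delta> powr - e"
    using assms unfolding incidence_bound_def by blast
  show ?thesis
  proof (rule incidence_boundI[OF C(1)])
    fix \<delta> K\<^sub>\<beta> K\<^sub>\<alpha> x y m c and P :: "'a set" and T :: "'b set"
    assume sys: "point_line_system \<delta> \<beta> K\<^sub>\<beta> P x y \<alpha> K\<^sub>\<alpha> T m c"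
    then interpret point_line_system \<delta> \<beta> K\<^sub>\<beta> P x y \<alpha> K\<^sub>\<alpha> T m c .
    have "\<delta> powr - e \<le> \<delta> powr - e'" using delta assms by (intro powr_mono') auto
    then have "C * K\<^sub>\<alpha> * K\<^sub>\<beta> * \<delta> powr - e \<le> C * K\<^sub>\<alpha> * K\<^sub>\<beta> * \<delta> powr - e'"
      using C(1) K by (intro mult_left_mono) auto
    then show "inc \<delta> \<le> C * K\<^sub>\<alpha> * K\<^sub>\<beta> * \<delta> powr - e'" using C(2)[OF sys] by linarith
  qed
qed

lemma incidence_bound_cauchy_schwarz:
  assumes "0 \<le> \<beta>" "\<beta> \<le> min \<alpha> 1" "0 < \<alpha>" "\<alpha> \<le> \<beta> + 1" "0 < \<epsilon>"
  shows "incidence_bound \<alpha> \<beta> (\<alpha> + \<beta> - \<alpha> * \<beta> / (min \<alpha> 1 + \<beta>) + \<epsilon>) TYPE('a) TYPE('b)"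
proof -
  obtain C where C: "1 \<le> C" "\<And>\<delta>. 0 < \<delta> \<Longrightarrow> \<delta> \<le> 1 \<Longrightarrow> real (scale_count \<delta>) + 1 \<le> C * \<delta> powr - \<epsilon>"
    using dyadic_scales_bound[OF assms(5)] by metis
  let ?e = "\<alpha> + \<beta> - \<alpha> * \<beta> / (min \<alpha> 1 + \<beta>)"
  show ?thesis
  proof (rule incidence_boundI)
    fix \<delta> K\<^sub>\<beta> K\<^sub>\<alpha> x y m c and P :: "'a set" and T :: "'b set"
    assume "point_line_system \<delta> \<beta> K\<^sub>\<beta> P x y \<alpha> K\<^sub>\<alpha> T m c"
    then interpret point_line_system \<delta> \<beta> K\<^sub>\<beta> P x y \<alpha> K\<^sub>\<alpha> T m c .
    have "inc \<delta> \<le> 64 * (real (scale_count \<delta>) + 1) * (K\<^sub>\<alpha> * K\<^sub>\<beta> * \<delta> powr - ?e)"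
      using assms by (intro inc_cauchy_schwarz) auto
    also have "\<dots> \<le> 64 * (C * \<delta> powr - \<epsilon>) * (K\<^sub>\<alpha> * K\<^sub>\<beta> * \<delta> powr - ?e)"
      using C(2)[OF delta] K by (intro mult_right_mono mult_left_mono) auto
    also have "\<dots> = (64 * C) * K\<^sub>\<alpha> * K\<^sub>\<beta> * (\<delta> powr - \<epsilon> * \<delta> powr - ?e)" by simp
    also have "\<delta> powr - \<epsilon> * \<delta> powr - ?e = \<delta> powr - (?e + \<epsilon>)" by (simp flip: powr_add)
    finally show "inc \<delta> \<le> (64 * C) * K\<^sub>\<alpha> * K\<^sub>\<beta> * \<delta> powr - (?e + \<epsilon>)" .
  qed (use C in auto)
qed

lemma incidence_bound_high_low:
  assumes "0 < \<epsilon>"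
  shows "incidence_bound \<alpha> \<beta> (\<alpha> + \<beta> - min ((\<alpha> + \<beta> - 1) / 2) 1 + \<epsilon>) TYPE('a) TYPE('b)"
proof -
  define \<eta> where "\<eta> = \<epsilon> / 2"
  have eta: "0 < \<eta>" using assms by (simp add: \<eta>_def)
  obtain C where C: "1 \<le> C" "\<And>\<delta>. 0 < \<delta> \<Longrightarrow> \<delta> \<le> 1 \<Longrightarrow> real (scale_count \<delta>) + 1 \<le> C * \<delta> powr - \<eta>"
    using dyadic_scales_bound[OF eta] by metis
  \<comment> \<open>Large enough for (8 M) to the power \<eta> to exceed 32.\<close>
  define M :: real where "M = 32 powr (1 / \<eta>)"
  define \<gamma> where "\<gamma> = min ((\<alpha> + \<beta> - 1) / 2) 1"
  have g: "\<gamma> \<le> 1" "\<gamma> \<le> (\<alpha> + \<beta> - 1) / 2" unfolding \<gamma>_def by (rule min.cobounded2, rule min.cobounded1)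
  have M1: "1 \<le> M" unfolding M_def using eta by (intro ge_one_powr_ge_zero) auto
  have "32 = M powr \<eta>" using eta by (simp add: M_def powr_powr)
  also have "\<dots> \<le> (8 * M) powr \<eta>" using M1 eta by (intro powr_mono2) auto
  finally have M2: "32 \<le> (8 * M) powr \<eta>" .
  show ?thesis
  proof (rule incidence_boundI)
    fix \<delta> K\<^sub>\<beta> K\<^sub>\<alpha> x y m c and P :: "'a set" and T :: "'b set"
    assume "point_line_system \<delta> \<beta> K\<^sub>\<beta> P x y \<alpha> K\<^sub>\<alpha> T m c"
    then interpret point_line_system \<delta> \<beta> K\<^sub>\<beta> P x y \<alpha> K\<^sub>\<alpha> T m c .
    define X where "X = K\<^sub>\<alpha> * K\<^sub>\<beta> * \<delta> powr - (\<alpha> + \<beta>)"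
    define L where "L = real (scale_count \<delta>) + 1"
    obtain n where n: "1 / \<delta> < (8 * M) ^ n" using real_arch_pow[of "8 * M" "1 / \<delta>"] M1 by auto
    have "inc \<delta> \<le> (129608 * L * M ^ 5 + 128 * M) * X * \<delta> powr (\<gamma> - \<eta>)"
      unfolding X_def L_def
    proof (rule inc_induction_on_scales[OF M1 M2 eta g refl])
      show "1 \<le> (8 * M) ^ n * \<delta>" using n delta by (simp add: field_simps)
    qed (use delta in auto)
    also have "\<dots> \<le> ((129608 * M ^ 5 + 128 * M) * L) * X * \<delta> powr (\<gamma> - \<eta>)"
    proof (intro mult_right_mono)
      have "128 * M * 1 \<le> 128 * M * L" using M1 by (intro mult_left_mono) (auto simp: L_def)
      then show "129608 * L * M ^ 5 + 128 * M \<le> (129608 * M ^ 5 + 128 * M) * L"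
        by (simp add: algebra_simps)
    qed (use K in \<open>auto simp: X_def\<close>)
    also have "\<dots> \<le> ((129608 * M ^ 5 + 128 * M) * (C * \<delta> powr - \<eta>)) * X * \<delta> powr (\<gamma> - \<eta>)"
      using C(2)[OF delta] K M1 by (intro mult_right_mono mult_left_mono) (auto simp: X_def L_def)
    also have "\<dots> = ((129608 * M ^ 5 + 128 * M) * C) * K\<^sub>\<alpha> * K\<^sub>\<beta>
        * (\<delta> powr - \<eta> * \<delta> powr - (\<alpha> + \<beta>) * \<delta> powr (\<gamma> - \<eta>))"
      by (simp add: X_def)
    also have "\<delta> powr - \<eta> * \<delta> powr - (\<alpha> + \<beta>) * \<delta> powr (\<gamma> - \<eta>) = \<delta> powr - (\<alpha> + \<beta> - \<gamma> + \<epsilon>)"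
      by (simp add: \<eta>_def algebra_simps flip: powr_add)
    finally show "inc \<delta> \<le> ((129608 * M ^ 5 + 128 * M) * C) * K\<^sub>\<alpha> * K\<^sub>\<beta>
        * \<delta> powr - (\<alpha> + \<beta> - min ((\<alpha> + \<beta> - 1) / 2) 1 + \<epsilon>)"
      by (simp add: \<gamma>_def)
  qed (use C M1 in \<open>auto intro!: mult_pos_pos add_pos_pos\<close>)
qed

lemma incidence_bound_one_point_at_a_time:
  "incidence_bound \<alpha> \<beta> (\<beta> + 1) TYPE('a) TYPE('b)"
  by (rule incidence_boundI[where C = 32]) (auto dest: point_line_system.inc_one_point_at_a_time)

lemma incidence_exponent_commute: "incidence_exponent \<alpha> \<beta> = incidence_exponent \<beta> \<alpha>"
  by (auto simp: incidence_exponent_def Let_def algebra_simps)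

text \<open>On this range the exponent is what remains after saving \<open>\<alpha> \<beta> / (a + b)\<close> from
the trivial \<open>\<alpha> + \<beta>\<close>, which is how \<open>inc_cauchy_schwarz\<close> produces
it.\<close>

lemma incidence_exponent_small:
  assumes "0 \<le> \<beta>" "\<beta> \<le> min \<alpha> 1" "0 < \<alpha>" "\<alpha> < \<beta> + 1"
  shows "incidence_exponent \<alpha> \<beta> = \<alpha> + \<beta> - \<alpha> * \<beta> / (min \<alpha> 1 + \<beta>)"
proof -
  have b: "min \<beta> 1 = \<beta>" and pos: "0 < min \<alpha> 1 + \<beta>" using assms by auto
  have "incidence_exponent \<alpha> \<beta> = (min \<alpha> 1 * \<alpha> + \<beta> * \<beta> + min \<alpha> 1 * \<beta>) / (min \<alpha> 1 + \<beta>)"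
    using assms unfolding incidence_exponent_def Let_def b by auto
  also have "\<dots> = \<alpha> + \<beta> - \<alpha> * \<beta> / (min \<alpha> 1 + \<beta>)"
    using pos by (simp add: field_simps)
  finally show ?thesis .
qed

lemma incidence_bound_small:
  assumes "0 \<le> \<beta>" "\<beta> \<le> min \<alpha> 1" "\<alpha> \<le> 2" "0 < \<epsilon>"
  shows "incidence_bound \<alpha> \<beta> (incidence_exponent \<alpha> \<beta> + \<epsilon>) TYPE('a) TYPE('b)"
proof -
  consider "\<alpha> \<ge> \<beta> + 1" | "\<alpha> = 0" | "0 < \<alpha>" "\<alpha> < \<beta> + 1" using assms by fastforce
  then show ?thesis
  proof cases
    case 1
    then have "incidence_exponent \<alpha> \<beta> = \<beta> + 1" using assms by (intro incidence_exponent_cases) auto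
    then show ?thesis
      by (intro incidence_bound_mono[OF incidence_bound_one_point_at_a_time]) (use assms in auto)
  next
    case 2
    then have "\<beta> = 0" using assms by simp
    have "incidence_bound \<alpha> \<beta> 0 TYPE('a) TYPE('b)"
    proof (rule incidence_boundI[where C = 16])
      fix \<delta> K\<^sub>\<beta> K\<^sub>\<alpha> x y m c and P :: "'a set" and T :: "'b set"
      assume "point_line_system \<delta> \<beta> K\<^sub>\<beta> P x y \<alpha> K\<^sub>\<alpha> T m c"
      then interpret point_line_system \<delta> \<beta> K\<^sub>\<beta> P x y \<alpha> K\<^sub>\<alpha> T m c .
      show "inc \<delta> \<le> 16 * K\<^sub>\<alpha> * K\<^sub>\<beta> * \<delta> powr - 0"
        using inc_trivial[of \<delta>] 2 \<open>\<beta> = 0\<close> by simp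
    qed simp
    moreover have "incidence_exponent \<alpha> \<beta> = 0" using 2 \<open>\<beta> = 0\<close> by (simp add: incidence_exponent_def)
    ultimately show ?thesis using assms(4) by (elim incidence_bound_mono) simp
  next
    case 3
    have e: "incidence_exponent \<alpha> \<beta> = \<alpha> + \<beta> - \<alpha> * \<beta> / (min \<alpha> 1 + \<beta>)"
      by (rule incidence_exponent_small[OF assms(1,2) 3])
    show ?thesis unfolding e
      by (rule incidence_bound_cauchy_schwarz[OF assms(1,2) 3(1) less_imp_le[OF 3(2)] assms(4)])
  qed
qed

lemma incidence_bound_all:
  assumes "0 \<le> \<alpha>" "\<alpha> \<le> 2" "0 \<le> \<beta>" "\<beta> \<le> 2" "0 < \<epsilon>"
  shows "incidence_bound \<alpha> \<beta> (incidence_exponent \<alpha> \<beta> + \<epsilon>) TYPE('a) TYPE('b)"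
proof -
  consider "\<beta> \<le> min \<alpha> 1" | "\<alpha> \<le> min \<beta> 1" | "1 < \<alpha>" "1 < \<beta>" by linarith
  then show ?thesis
  proof cases
    case 1
    then show ?thesis using assms by (intro incidence_bound_small) auto
  next
    case 2
    have "incidence_bound \<beta> \<alpha> (incidence_exponent \<beta> \<alpha> + \<epsilon>) TYPE('b) TYPE('a)"
      using assms 2 by (intro incidence_bound_small) auto
    from incidence_bound_dual[OF this] show ?thesis
      by (simp add: incidence_exponent_commute)
  next
    case 3
    have "incidence_exponent \<alpha> \<beta> = \<alpha> + \<beta> - min ((\<alpha> + \<beta> - 1) / 2) 1"
      using 3 assms by (auto simp: incidence_exponent_def Let_def min_def field_simps)
    then show ?thesis using incidence_bound_high_low[OF assms(5)] by simp
  qed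
qed

section \<open>From balls and tubes to points and lines\<close>

lemma inner_coords:
  fixes u v :: "real ^ 2"
  assumes "i \<noteq> j"
  shows "u \<bullet> v = u $ i * v $ i + u $ j * v $ j"
  using exhaust_2[of i] exhaust_2[of j] assms by (auto simp: inner_vec_def sum_2)

lemma norm_le_coords:
  fixes u :: "real ^ 2"
  assumes "i \<noteq> j"
  shows "norm u \<le> \<bar>u $ i\<bar> + \<bar>u $ j\<bar>"
  using norm_le_l1_cart[of u] exhaust_2[of i] exhaust_2[of j] assms by (auto simp: sum_2)

lemma vec_eq_coords:
  fixes u v :: "real ^ 2"
  assumes "i \<noteq> j"
  shows "u = v \<longleftrightarrow> u $ i = v $ i \<and> u $ j = v $ j"
  using exhaust_2[of i] exhaust_2[of j] assms by (auto simp: vec_eq_iff forall_2)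

text \<open>The indices i and j name the abscissa and the ordinate. Exchanging them makes the slope of a steep tube
at most 1.\<close>

definition hugs_line :: "2 \<Rightarrow> 2 \<Rightarrow> real \<Rightarrow> real \<Rightarrow> real \<Rightarrow> (real ^ 2) set \<Rightarrow> bool" where
  "hugs_line i j m c \<delta> t \<longleftrightarrow> \<bar>m\<bar> \<le> 1 \<and> \<bar>c\<bar> \<le> 2 \<and> (\<forall>z\<in>t. \<bar>z $ j - m * z $ i - c\<bar> \<le> 2 * \<delta>)"

lemma unit_square_coords: "z \<in> unit_square \<Longrightarrow> 0 \<le> z $ i \<and> z $ i \<le> 1"
  by (simp add: unit_square_def)

lemma tube_hugs_line_coords:
  assumes "i \<noteq> j" and unit: "norm u = 1" "norm v = 1" and dom: "\<bar>v $ j\<bar> \<le> \<bar>v $ i\<bar>" and "0 < \<delta>"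
    and t: "t = {p + s *\<^sub>R u + r *\<^sub>R v | s r. 0 \<le> s \<and> s \<le> \<delta> \<and> 0 \<le> r \<and> r \<le> 1}" "t \<subseteq> unit_square"
  shows "\<exists>m c. hugs_line i j m c \<delta> t"
proof -
  have "v $ i \<noteq> 0"
  proof
    assume "v $ i = 0"
    then have "v = 0" using dom by (subst vec_eq_coords[OF assms(1)]) auto
    then show False using unit by simp
  qed
  define m where "m = v $ j / v $ i"
  define c where "c = p $ j - m * p $ i"
  have m: "\<bar>m\<bar> \<le> 1" using dom \<open>v $ i \<noteq> 0\<close> by (simp add: m_def abs_divide)
  have mv: "v $ j = m * v $ i" using \<open>v $ i \<noteq> 0\<close> by (simp add: m_def)
  have "p \<in> t" unfolding t(1) using \<open>0 < \<delta>\<close> by (auto intro!: exI[of _ 0])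
  then have p: "0 \<le> p $ i" "p $ i \<le> 1" "0 \<le> p $ j" "p $ j \<le> 1"
    using t(2) unit_square_coords by blast+
  have "\<bar>m * p $ i\<bar> \<le> 1 * 1" unfolding abs_mult using m p by (intro mult_mono) auto
  then have c: "\<bar>c\<bar> \<le> 2" using p unfolding c_def by linarith
  have ui: "\<bar>u $ i\<bar> \<le> 1" "\<bar>u $ j\<bar> \<le> 1" using component_le_norm_cart[of u] unit by auto
  have "\<bar>z $ j - m * z $ i - c\<bar> \<le> 2 * \<delta>" if zt: "z \<in> t" for z
  proof -
    obtain s r where z: "z = p + s *\<^sub>R u + r *\<^sub>R v" "0 \<le> s" "s \<le> \<delta>" using zt t(1) by auto
    have "z $ j - m * z $ i - c = s * (u $ j - m * u $ i)" by (simp add: z c_def mv algebra_simps)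
    also have "\<bar>\<dots>\<bar> \<le> \<delta> * 2"
    proof -
      have "\<bar>m * u $ i\<bar> \<le> 1 * 1" unfolding abs_mult using m ui by (intro mult_mono) auto
      then have "\<bar>u $ j - m * u $ i\<bar> \<le> 2" using ui by linarith
      then show ?thesis unfolding abs_mult using z by (intro mult_mono) auto
    qed
    finally show ?thesis by simp
  qed
  then show ?thesis using m c by (auto simp: hugs_line_def)
qed

lemma tube_hugs_line:
  assumes "is_tube \<delta> t" "t \<subseteq> unit_square" "0 < \<delta>"
  shows "(\<exists>m c. hugs_line 1 2 m c \<delta> t) \<or> (\<exists>m c. hugs_line 2 1 m c \<delta> t)"
proof -
  obtain p u v where t: "norm u = 1" "norm v = 1"
    "t = {p + s *\<^sub>R u + r *\<^sub>R v | s r. 0 \<le> s \<and> s \<le> \<delta> \<and> 0 \<le> r \<and> r \<le> 1}"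
    using assms(1) unfolding is_rectangle_def by blast
  show ?thesis
  proof (cases "\<bar>v $ 2\<bar> \<le> \<bar>v $ 1\<bar>")
    case True
    then show ?thesis using tube_hugs_line_coords[of 1 2 u v \<delta> t p] t assms by auto
  next
    case False
    then show ?thesis using tube_hugs_line_coords[of 2 1 u v \<delta> t p] t assms by auto
  qed
qed

text \<open>The unit square has diameter below 2, so that a rectangle of length 2 in the direction of the line can
be long enough.\<close>

lemma strip_in_rectangle:
  assumes ij: "i \<noteq> j" and "0 < r"
  obtains R where "is_rectangle r 2 R" "{z\<in>unit_square. \<bar>z $ j - m * z $ i - c\<bar> \<le> r / 2} \<subseteq> R"
proof -
  define n where "n = sqrt (1 + m\<^sup>2)"
  have n1: "1 \<le> n" by (simp add: n_def)
  have n2: "n * n = 1 + m\<^sup>2" by (simp add: n_def)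
  define u v :: "real ^ 2" where "u = (\<chi> k. if k = i then - m / n else 1 / n)"
    and "v = (\<chi> k. if k = i then 1 / n else m / n)"
  have uv: "u $ i = - m / n" "u $ j = 1 / n" "v $ i = 1 / n" "v $ j = m / n"
    using ij by (auto simp: u_def v_def)
  have e: "1 / (n * n) + m\<^sup>2 / (n * n) = 1" using n1 n2
    by (metis add_divide_distrib divide_self_if mult_eq_0_iff not_one_le_zero)
  have norms: "norm u = 1" "norm v = 1" "u \<bullet> v = 0"
    using e by (auto simp: norm_eq_1 inner_coords[OF ij] uv power2_eq_square)
  define a where "a = (c - r / 2) / n"
  define b where "b = min 0 m / n"
  define R where "R = {(a *\<^sub>R u + b *\<^sub>R v) + s *\<^sub>R u + t *\<^sub>R v | s t. 0 \<le> s \<and> s \<le> r \<and> 0 \<le> t \<and> t \<le> 2}"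
  show thesis
  proof
    show "is_rectangle r 2 R" unfolding is_rectangle_def R_def using norms by blast
    show "{z\<in>unit_square. \<bar>z $ j - m * z $ i - c\<bar> \<le> r / 2} \<subseteq> R"
    proof safe
      fix z assume z: "z \<in> unit_square" "\<bar>z $ j - m * z $ i - c\<bar> \<le> r / 2"
      have sq: "0 \<le> z $ i" "z $ i \<le> 1" "0 \<le> z $ j" "z $ j \<le> 1" using z(1) unit_square_coords by blast+
      have strip: "- (r / 2) \<le> z $ j - m * z $ i - c" "z $ j - m * z $ i - c \<le> r / 2"
        using z(2) by linarith+
      define s where "s = (z $ j - m * z $ i) / n - a"
      define t where "t = (z $ i + m * z $ j) / n - b"
      have s_eq: "s = (z $ j - m * z $ i - c + r / 2) / n" by (simp add: s_def a_def diff_divide_distrib add_divide_distrib)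
      have "0 \<le> s" unfolding s_eq using strip n1 by (intro divide_nonneg_nonneg) linarith+
      have "s \<le> r / 1" unfolding s_eq using strip n1 assms by (intro frac_le) linarith+
      have t_eq: "t = (z $ i + (m * z $ j - min 0 m)) / n" by (simp add: t_def b_def diff_divide_distrib add_divide_distrib)
      have mz: "0 \<le> m * z $ j - min 0 m" "m * z $ j - min 0 m \<le> \<bar>m\<bar>"
      proof -
        have 1: "m * z $ j \<le> m * 1" if "0 \<le> m" using that sq by (intro mult_left_mono) auto
        have 2: "m * 1 \<le> m * z $ j" if "m \<le> 0" using that sq by (intro mult_left_mono_neg) auto
        have 3: "0 \<le> m * z $ j" if "0 \<le> m" using that sq by simp
        have 4: "m * z $ j \<le> 0" if "m \<le> 0" using that sq by (simp add: mult_nonpos_nonneg)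
        show "0 \<le> m * z $ j - min 0 m" "m * z $ j - min 0 m \<le> \<bar>m\<bar>"
          using 1 2 3 4 by (auto simp: min_def abs_if)
      qed
      have "\<bar>m\<bar> \<le> n" unfolding n_def by (rule real_le_rsqrt) simp
      have "0 \<le> t" unfolding t_eq using sq mz n1 by (intro divide_nonneg_nonneg) auto
      have "z $ i + (m * z $ j - min 0 m) \<le> 2 * n" using sq mz n1 \<open>\<bar>m\<bar> \<le> n\<close> by linarith
      then have "t \<le> 2" unfolding t_eq using n1 by (simp add: pos_divide_le_eq)
      have "z = (a *\<^sub>R u + b *\<^sub>R v) + s *\<^sub>R u + t *\<^sub>R v"
      proof -
        have as: "a + s = (z $ j - m * z $ i) / n" and bt: "b + t = (z $ i + m * z $ j) / n"
          by (simp_all add: s_def t_def)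
        have i: "z $ i = (a + s) * (- m / n) + (b + t) * (1 / n)"
        proof -
          have "(a + s) * (- m / n) + (b + t) * (1 / n) = z $ i * (1 / (n * n) + m\<^sup>2 / (n * n))"
            by (simp add: as bt power2_eq_square add_divide_distrib diff_divide_distrib algebra_simps)
          then show ?thesis using e by simp
        qed
        have j: "z $ j = (a + s) * (1 / n) + (b + t) * (m / n)"
        proof -
          have "(a + s) * (1 / n) + (b + t) * (m / n) = z $ j * (1 / (n * n) + m\<^sup>2 / (n * n))"
            by (simp add: as bt power2_eq_square add_divide_distrib diff_divide_distrib algebra_simps)
          then show ?thesis using e by simp
        qed
        show ?thesis unfolding vec_eq_coords[OF ij] using i j by (simp add: uv add_divide_distrib algebra_simps)
      qed
      then show "z \<in> R" unfolding R_def using \<open>0 \<le> s\<close> \<open>s \<le> r / 1\<close> \<open>0 \<le> t\<close> \<open>t \<le> 2\<close> by auto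
    qed
  qed
qed

lemma tube_set_card:
  assumes "tube_set \<delta> \<alpha> K T" "\<delta> \<le> 1"
  shows "real (card T) \<le> K * (1 / \<delta>) powr \<alpha>"
proof -
  have ij: "(1::2) \<noteq> 2" by simp
  obtain R where R: "is_rectangle 1 2 R"
      "{z\<in>unit_square. \<bar>z $ 2 - 0 * z $ 1 - 1 / 2\<bar> \<le> 1 / 2} \<subseteq> R"
    by (rule strip_in_rectangle[OF ij, where r = 1 and m = 0 and c = "1 / 2"]) auto
  have "unit_square \<subseteq> R" 
  proof
    fix z assume z: "z \<in> unit_square"
    then have "0 \<le> z $ 2" "z $ 2 \<le> 1" using unit_square_coords by blast+
    then have "\<bar>z $ 2 - 0 * z $ 1 - 1 / 2\<bar> \<le> 1 / 2" by linarith
    then show "z \<in> R" using R(2) z by blast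
  qed
  then have "{t\<in>T. t \<subseteq> R} = T" using assms by (auto simp: tube_set_def)
  moreover have "real (card {t\<in>T. t \<subseteq> R}) \<le> K * (1 / \<delta>) powr \<alpha>"
    using assms R(1) unfolding tube_set_def by blast
  ultimately show ?thesis by simp
qed

text \<open>Tubes whose slopes and intercepts agree up to w lie in a common strip of width 8 w, and hence in a
rectangle that the hypothesis on T speaks about. If 8 w exceeds 1, the whole family is counted by a
rectangle of width 1 that contains the unit square.\<close>

lemma tubes_dim_spaced:
  assumes T: "tube_set \<delta> \<alpha> K T" and "0 < \<delta>" "\<delta> \<le> 1" "0 \<le> \<alpha>" "\<alpha> \<le> 2" "1 \<le> K" "i \<noteq> j"
    and S: "S \<subseteq> T" "\<And>t. t \<in> S \<Longrightarrow> hugs_line i j (m t) (c t) \<delta> t"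
  shows "dim_spaced \<delta> \<alpha> (64 * K) S m c"
  unfolding dim_spaced_def
proof (intro conjI allI impI)
  have finT: "finite T" using T assms(3) by (rule tube_set_finite)
  then show "finite S" using S(1) finite_subset by blast
  fix u v w :: real assume w: "\<delta> \<le> w"
  have wpos: "0 < w" using w assms by linarith
  define A where "A = {s\<in>S. \<bar>m s - u\<bar> \<le> w \<and> \<bar>c s - v\<bar> \<le> w}"
  have A: "A \<subseteq> T" using S(1) by (auto simp: A_def)
  have "real (card A) \<le> K * (8 * w / \<delta>) powr \<alpha>"
  proof (cases "8 * w \<le> 1")
    case True
    obtain R where R: "is_rectangle (8 * w) 2 R"
        "{z\<in>unit_square. \<bar>z $ j - u * z $ i - v\<bar> \<le> 8 * w / 2} \<subseteq> R"
      using strip_in_rectangle[OF assms(7), of "8 * w" u v] wpos by auto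
    have "A \<subseteq> {t\<in>T. t \<subseteq> R}"
    proof safe
      fix t z assume t: "t \<in> A" and z: "z \<in> t"
      have sq: "z \<in> unit_square" using z t A T by (auto simp: tube_set_def)
      have zi: "0 \<le> z $ i" "z $ i \<le> 1" using unit_square_coords[OF sq, of i] by auto
      have h: "\<bar>z $ j - m t * z $ i - c t\<bar> \<le> 2 * \<delta>" "\<bar>m t - u\<bar> \<le> w" "\<bar>c t - v\<bar> \<le> w"
        using t z S(2)[of t] by (auto simp: A_def hugs_line_def)
      have "\<bar>(m t - u) * z $ i\<bar> \<le> w * 1" unfolding abs_mult using h zi wpos by (intro mult_mono) auto
      then have "\<bar>z $ j - u * z $ i - v\<bar> \<le> 8 * w / 2" using h w by (simp add: algebra_simps)
      then show "z \<in> R" using R(2) sq by blast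
    qed (use A in auto)
    then have "card A \<le> card {t\<in>T. t \<subseteq> R}" using finT by (intro card_mono) auto
    moreover have "real (card {t\<in>T. t \<subseteq> R}) \<le> K * (8 * w / \<delta>) powr \<alpha>"
      using T R(1) True w wpos unfolding tube_set_def by (meson dual_order.trans less_eq_real_def mult_le_cancel_right1 one_le_numeral linorder_not_less)
    ultimately show ?thesis by linarith
  next
    case False
    have "real (card A) \<le> real (card T)" using A finT by (simp add: card_mono)
    also have "\<dots> \<le> K * (1 / \<delta>) powr \<alpha>" using T assms(3) by (rule tube_set_card)
    also have "\<dots> \<le> K * (8 * w / \<delta>) powr \<alpha>"
      using False assms by (intro mult_left_mono powr_mono2 divide_right_mono) auto
    finally show ?thesis .
  qed
  also have "(8 * w / \<delta>) powr \<alpha> = 8 powr \<alpha> * (w / \<delta>) powr \<alpha>"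
    using wpos assms by (simp add: powr_mult flip: times_divide_eq_right)
  also have "K * (8 powr \<alpha> * (w / \<delta>) powr \<alpha>) \<le> K * (8 powr 2 * (w / \<delta>) powr \<alpha>)"
    using assms by (intro mult_left_mono mult_right_mono powr_mono) auto
  finally show "real (card {s\<in>S. \<bar>m s - u\<bar> \<le> w \<and> \<bar>c s - v\<bar> \<le> w}) \<le> 64 * K * (w / \<delta>) powr \<alpha>"
    by (simp add: A_def)
qed

lemma ball_set_card:
  assumes "ball_set \<delta> \<beta> K P" "\<delta> \<le> 1"
  shows "real (card P) \<le> K * (1 / \<delta>) powr \<beta>"
proof -
  have sub: "unit_square \<subseteq> cball (\<chi> i. 1 / 2) 1"
  proof
    fix z :: "real ^ 2" assume "z \<in> unit_square"
    then have "0 \<le> z $ 1" "z $ 1 \<le> 1" "0 \<le> z $ 2" "z $ 2 \<le> 1" using unit_square_coords by blast+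
    then have "norm ((\<chi> i. 1 / 2) - z) \<le> 1"
      by (intro order_trans[OF norm_le_coords[of 1 2]]) (auto simp: abs_if)
    then show "z \<in> cball (\<chi> i. 1 / 2) 1" by (simp add: dist_norm)
  qed
  have "{p\<in>P. p \<subseteq> cball (\<chi> i. 1 / 2) 1} = P" using assms(1) sub unfolding ball_set_def by blast
  moreover have "real (card {p\<in>P. p \<subseteq> cball (\<chi> i. 1 / 2) 1}) \<le> K * (1 / \<delta>) powr \<beta>"
    using assms unfolding ball_set_def is_ball_def by blast
  ultimately show ?thesis by simp
qed

lemma balls_dim_spaced:
  assumes P: "ball_set \<delta> \<beta> K P" and "0 < \<delta>" "\<delta> \<le> 1" "0 \<le> \<beta>" "\<beta> \<le> 2" "1 \<le> K" "i \<noteq> j"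
    and ctr: "\<And>p. p \<in> P \<Longrightarrow> p = cball (ctr p) \<delta>"
  shows "dim_spaced \<delta> \<beta> (9 * K) P (\<lambda>p. ctr p $ i) (\<lambda>p. ctr p $ j)"
  unfolding dim_spaced_def
proof (intro conjI allI impI)
  show finP: "finite P" using P assms(3) by (rule ball_set_finite)
  fix u v w :: real assume w: "\<delta> \<le> w"
  have wpos: "0 < w" using w assms by linarith
  define A where "A = {s\<in>P. \<bar>ctr s $ i - u\<bar> \<le> w \<and> \<bar>ctr s $ j - v\<bar> \<le> w}"
  have "real (card A) \<le> K * (3 * w / \<delta>) powr \<beta>"
  proof (cases "3 * w \<le> 1")
    case True
    define q :: "real ^ 2" where "q = (\<chi> k. if k = i then u else v)"
    have q: "q $ i = u" "q $ j = v" using assms(7) by (auto simp: q_def)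
    have "A \<subseteq> {p\<in>P. p \<subseteq> cball q (3 * w)}"
    proof safe
      fix p z assume p: "p \<in> A" and z: "z \<in> p"
      have "dist q (ctr p) \<le> w + w"
        unfolding dist_norm using p by (intro order_trans[OF norm_le_coords[OF assms(7)]])
          (auto simp: q A_def abs_minus_commute)
      moreover have "dist (ctr p) z \<le> \<delta>" using ctr[of p] p z by (auto simp: A_def)
      ultimately have "dist q z \<le> 3 * w" using w dist_triangle[of q z "ctr p"] by linarith
      then show "z \<in> cball q (3 * w)" by simp
    qed (auto simp: A_def)
    then have "card A \<le> card {p\<in>P. p \<subseteq> cball q (3 * w)}" using finP by (intro card_mono) auto
    moreover have "\<delta> \<le> 3 * w" using w wpos by linarith
    then have "real (card {p\<in>P. p \<subseteq> cball q (3 * w)}) \<le> K * (3 * w / \<delta>) powr \<beta>"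
      using P True unfolding ball_set_def is_ball_def by blast
    ultimately show ?thesis by linarith
  next
    case False
    have "real (card A) \<le> real (card P)" using finP by (auto simp: A_def intro: card_mono)
    also have "\<dots> \<le> K * (1 / \<delta>) powr \<beta>" using P assms(3) by (rule ball_set_card)
    also have "\<dots> \<le> K * (3 * w / \<delta>) powr \<beta>"
      using False assms by (intro mult_left_mono powr_mono2 divide_right_mono) auto
    finally show ?thesis .
  qed
  also have "(3 * w / \<delta>) powr \<beta> = 3 powr \<beta> * (w / \<delta>) powr \<beta>"
    using wpos assms by (simp add: powr_mult flip: times_divide_eq_right)
  also have "K * (3 powr \<beta> * (w / \<delta>) powr \<beta>) \<le> K * (3 powr 2 * (w / \<delta>) powr \<beta>)"
    using assms by (intro mult_left_mono mult_right_mono powr_mono) auto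
  finally show "real (card {s\<in>P. \<bar>ctr s $ i - u\<bar> \<le> w \<and> \<bar>ctr s $ j - v\<bar> \<le> w}) \<le> 9 * K * (w / \<delta>) powr \<beta>"
    by (simp add: A_def)
qed

lemma dim_spaced_rescale:
  assumes sp: "dim_spaced \<delta> \<gamma> K S f g" and "0 < \<delta>" "0 \<le> \<gamma>" "\<gamma> \<le> 2" "0 \<le> K"
  shows "dim_spaced (4 * \<delta>) \<gamma> (16 * K) S f g"
  unfolding dim_spaced_def
proof (intro conjI allI impI)
  show "finite S" using sp by (rule dim_spaced_finite)
  fix u v w :: real assume w: "4 * \<delta> \<le> w"
  have "real (card {s\<in>S. \<bar>f s - u\<bar> \<le> w \<and> \<bar>g s - v\<bar> \<le> w}) \<le> K * (w / \<delta>) powr \<gamma>"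
    using w assms by (intro dim_spacedD[OF sp]) auto
  also have "(w / \<delta>) powr \<gamma> = 4 powr \<gamma> * (w / (4 * \<delta>)) powr \<gamma>"
    using w assms by (simp flip: powr_mult)
  also have "K * (4 powr \<gamma> * (w / (4 * \<delta>)) powr \<gamma>) \<le> K * (4 powr 2 * (w / (4 * \<delta>)) powr \<gamma>)"
    using assms by (intro mult_left_mono mult_right_mono powr_mono) auto
  finally show "real (card {s\<in>S. \<bar>f s - u\<bar> \<le> w \<and> \<bar>g s - v\<bar> \<le> w}) \<le> 16 * K * (w / (4 * \<delta>)) powr \<gamma>"
    by simp
qed

section \<open>The upper bound\<close>

lemma incidence_exponent_nonneg:
  assumes "0 \<le> \<alpha>" "0 \<le> \<beta>"
  shows "0 \<le> incidence_exponent \<alpha> \<beta>"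
  using assms by (auto simp: incidence_exponent_def Let_def intro!: divide_nonneg_nonneg add_nonneg_nonneg)

text \<open>A ball that meets a tube has its centre within \<open>4 * \<delta>\<close> of the line of the tube,
measured vertically, so that the estimate for point-line systems is applied at the scale \<open>4 *
\<delta>\<close>, once for the flat tubes and once for the steep ones. For \<open>\<delta> > 1/4\<close>
the trivial bound is already a constant.\<close>

lemma incidences_upper_bound:
  assumes ab: "0 \<le> \<alpha>" "\<alpha> \<le> 2" "0 \<le> \<beta>" "\<beta> \<le> 2" and eps: "0 < \<epsilon>"
  shows "\<exists>C>0. \<forall>K\<^sub>\<alpha>\<ge>1. \<forall>K\<^sub>\<beta>\<ge>1. \<forall>\<delta> P T.
            0 < \<delta> \<and> \<delta> \<le> 1 \<and> ball_set \<delta> \<beta> K\<^sub>\<beta> P \<and> tube_set \<delta> \<alpha> K\<^sub>\<alpha> T \<longrightarrow>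
            real (incidences P T) \<le> C * K\<^sub>\<alpha> * K\<^sub>\<beta> * \<delta> powr (- incidence_exponent \<alpha> \<beta> - \<epsilon>)"
proof -
  define e where "e = incidence_exponent \<alpha> \<beta> + \<epsilon>"
  have e0: "0 \<le> e" using incidence_exponent_nonneg[OF ab(1,3)] eps by (simp add: e_def)
  obtain C where C: "C > 0" "\<And>\<delta> K\<^sub>\<beta> (P :: (real ^ 2) set set) x y K\<^sub>\<alpha> (T :: (real ^ 2) set set) m c.
      point_line_system \<delta> \<beta> K\<^sub>\<beta> P x y \<alpha> K\<^sub>\<alpha> T m c \<Longrightarrow>
      real (card (near_pairs \<delta> P x y T m c)) \<le> C * K\<^sub>\<alpha> * K\<^sub>\<beta> * \<delta> powr - e"
    using incidence_bound_all[OF ab eps, where 'a = "(real ^ 2) set" and 'b = "(real ^ 2) set"]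
    unfolding incidence_bound_def e_def by blast
  define C' where "C' = 2 * (147456 * C) + 256"
  have "real (incidences P T) \<le> C' * K\<^sub>\<alpha> * K\<^sub>\<beta> * \<delta> powr - e"
    if K: "1 \<le> K\<^sub>\<alpha>" "1 \<le> K\<^sub>\<beta>" and d: "0 < \<delta>" "\<delta> \<le> 1"
      and P: "ball_set \<delta> \<beta> K\<^sub>\<beta> P" and T: "tube_set \<delta> \<alpha> K\<^sub>\<alpha> T" for K\<^sub>\<alpha> K\<^sub>\<beta> \<delta> P T
  proof (cases "4 * \<delta> \<le> 1")
    case True
    have finP: "finite P" and finT: "finite T"
      using P T d ball_set_finite tube_set_finite by blast+
    define ctr where "ctr p = (SOME x. p = cball x \<delta>)" for p :: "(real ^ 2) set"
    have ctr: "p = cball (ctr p) \<delta>" if "p \<in> P" for p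
      unfolding ctr_def using that P by (intro someI_ex[of "\<lambda>x. p = cball x \<delta>"]) (auto simp: ball_set_def is_ball_def)
    define line where "line i j t = (SOME l. hugs_line i j (fst l) (snd l) \<delta> t)" for i j t
    define S where "S i j = {t\<in>T. \<exists>m c. hugs_line i j m c \<delta> t}" for i j
    have line: "hugs_line i j (fst (line i j t)) (snd (line i j t)) \<delta> t" if "t \<in> S i j" for i j t
      unfolding line_def using that by (intro someI_ex[of "\<lambda>l. hugs_line i j (fst l) (snd l) \<delta> t"]) (auto simp: S_def)
    define I where "I i j = near_pairs (4 * \<delta>) P (\<lambda>p. ctr p $ i) (\<lambda>p. ctr p $ j) (S i j)
        (\<lambda>t. fst (line i j t)) (\<lambda>t. snd (line i j t))" for i j
    have bound: "real (card (I i j)) \<le> 147456 * C * K\<^sub>\<alpha> * K\<^sub>\<beta> * \<delta> powr - e" if ij: "i \<noteq> j" for i j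
    proof -
      have ctr_sq: "0 \<le> ctr p $ k \<and> ctr p $ k \<le> 1" if "p \<in> P" for p k
      proof -
        have "ctr p \<in> p" using ctr[OF that] d by (metis centre_in_cball less_eq_real_def)
        then have "ctr p \<in> unit_square" using that P by (auto simp: ball_set_def)
        then show ?thesis by (rule unit_square_coords)
      qed
      have "point_line_system (4 * \<delta>) \<beta> (16 * (9 * K\<^sub>\<beta>)) P (\<lambda>p. ctr p $ i) (\<lambda>p. ctr p $ j)
          \<alpha> (16 * (64 * K\<^sub>\<alpha>)) (S i j) (\<lambda>t. fst (line i j t)) (\<lambda>t. snd (line i j t))"
      proof
        show "dim_spaced (4 * \<delta>) \<beta> (16 * (9 * K\<^sub>\<beta>)) P (\<lambda>p. ctr p $ i) (\<lambda>p. ctr p $ j)"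
          using ab d K by (intro dim_spaced_rescale balls_dim_spaced[OF P _ _ _ _ _ ij ctr]) auto
        show "dim_spaced (4 * \<delta>) \<alpha> (16 * (64 * K\<^sub>\<alpha>)) (S i j) (\<lambda>t. fst (line i j t)) (\<lambda>t. snd (line i j t))"
          using ab d K by (intro dim_spaced_rescale tubes_dim_spaced[OF T _ _ _ _ _ ij _ line]) (auto simp: S_def)
        show "\<bar>ctr p $ i\<bar> \<le> 1" if "p \<in> P" for p using ctr_sq[OF that, of i] by simp
        show "\<bar>ctr p $ j\<bar> \<le> 2" if "p \<in> P" for p using ctr_sq[OF that, of j] by simp
        show "\<bar>fst (line i j t)\<bar> \<le> 1" "\<bar>snd (line i j t)\<bar> \<le> 2" if "t \<in> S i j" for t
          using line[OF that] by (auto simp: hugs_line_def)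
      qed (use True d ab K in auto)
      from C(2)[OF this]
      have "real (card (I i j)) \<le> C * (16 * (64 * K\<^sub>\<alpha>)) * (16 * (9 * K\<^sub>\<beta>)) * (4 * \<delta>) powr - e"
        by (simp add: I_def)
      also have "\<dots> \<le> C * (16 * (64 * K\<^sub>\<alpha>)) * (16 * (9 * K\<^sub>\<beta>)) * \<delta> powr - e"
        using C(1) K d e0 by (intro mult_left_mono powr_mono2') auto
      finally show ?thesis by simp
    qed
    have "{(p, t). p \<in> P \<and> t \<in> T \<and> p \<inter> t \<noteq> {}} \<subseteq> I 1 2 \<union> I 2 1"
    proof
      fix pt assume "pt \<in> {(p, t). p \<in> P \<and> t \<in> T \<and> p \<inter> t \<noteq> {}}"
      then obtain p t z where pt: "pt = (p, t)" and p: "p \<in> P" and t: "t \<in> T" and z: "z \<in> p" "z \<in> t"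
        by auto
      have incident: "(p, t) \<in> I i j" if h: "t \<in> S i j" for i j
      proof -
        let ?m = "fst (line i j t)" and ?c = "snd (line i j t)"
        have l: "\<bar>?m\<bar> \<le> 1" "\<bar>z $ j - ?m * z $ i - ?c\<bar> \<le> 2 * \<delta>"
          using line[OF h] z by (auto simp: hugs_line_def)
        have "norm (ctr p - z) \<le> \<delta>" using ctr[OF p] z by (metis dist_norm mem_cball)
        then have dz: "\<bar>ctr p $ k - z $ k\<bar> \<le> \<delta>" for k
          using component_le_norm_cart[of "ctr p - z" k] by simp
        have "\<bar>?m * (ctr p $ i - z $ i)\<bar> \<le> 1 * \<delta>" unfolding abs_mult using l dz by (intro mult_mono) auto
        then have "\<bar>ctr p $ j - ?m * ctr p $ i - ?c\<bar> \<le> 4 * \<delta>"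
          using l(2) dz[of j] by (simp add: algebra_simps)
        then show ?thesis using p h by (simp add: I_def near_pairs_def)
      qed
      have "t \<in> S 1 2 \<or> t \<in> S 2 1" using tube_hugs_line[of \<delta> t] T t d by (auto simp: S_def tube_set_def)
      then show "pt \<in> I 1 2 \<union> I 2 1" using incident pt by auto
    qed
    moreover have "finite (I i j)" for i j
      unfolding I_def using finP finT by (intro finite_near_pairs) (auto simp: S_def)
    ultimately have "incidences P T \<le> card (I 1 2 \<union> I 2 1)"
      unfolding incidences_def by (intro card_mono) auto
    also have "\<dots> \<le> card (I 1 2) + card (I 2 1)" by (rule card_Un_le)
    finally have "real (incidences P T) \<le> real (card (I 1 2)) + real (card (I 2 1))" by linarith
    also have "\<dots> \<le> 2 * (147456 * C * K\<^sub>\<alpha> * K\<^sub>\<beta> * \<delta> powr - e)" using bound[of 1 2] bound[of 2 1] by simp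
    also have "\<dots> = (2 * (147456 * C)) * (K\<^sub>\<alpha> * K\<^sub>\<beta> * \<delta> powr - e)" by simp
    also have "\<dots> \<le> C' * (K\<^sub>\<alpha> * K\<^sub>\<beta> * \<delta> powr - e)"
      using K by (intro mult_right_mono) (auto simp: C'_def)
    finally show ?thesis by simp
  next
    case False
    have four: "(1 / \<delta>) powr \<gamma> \<le> 16" if "0 \<le> \<gamma>" "\<gamma> \<le> 2" for \<gamma>
    proof -
      have "(1 / \<delta>) powr \<gamma> \<le> 4 powr \<gamma>" using False d that by (intro powr_mono2) (auto simp: field_simps)
      also have "\<dots> \<le> 4 powr 2" using that by (intro powr_mono) auto
      finally show ?thesis by simp
    qed
    have finP: "finite P" and finT: "finite T"
      using P T d ball_set_finite tube_set_finite by blast+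
    have cP: "real (card P) \<le> K\<^sub>\<beta> * 16"
      using ball_set_card[OF P d(2)] four[OF ab(3,4)] K by (elim order_trans) (intro mult_left_mono, auto)
    have cT: "real (card T) \<le> K\<^sub>\<alpha> * 16"
      using tube_set_card[OF T d(2)] four[OF ab(1,2)] K by (elim order_trans) (intro mult_left_mono, auto)
    have "incidences P T \<le> card (P \<times> T)"
      unfolding incidences_def using finP finT by (intro card_mono) auto
    then have "real (incidences P T) \<le> real (card P) * real (card T)"
      by (metis card_cartesian_product of_nat_le_iff of_nat_mult)
    also have "\<dots> \<le> (K\<^sub>\<beta> * 16) * (K\<^sub>\<alpha> * 16)" using cP cT K by (intro mult_mono) auto
    also have "\<dots> = 256 * K\<^sub>\<alpha> * K\<^sub>\<beta> * 1" by simp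
    also have "\<dots> \<le> C' * K\<^sub>\<alpha> * K\<^sub>\<beta> * \<delta> powr - e"
    proof (intro mult_mono)
      have "\<delta> powr 0 \<le> \<delta> powr - e" using d e0 by (intro powr_mono') auto
      then show "1 \<le> \<delta> powr - e" using d by simp
    qed (use C(1) K in \<open>auto simp: C'_def\<close>)
    finally show ?thesis .
  qed
  then show ?thesis
    using C(1) by (intro exI[of _ C']) (auto simp: C'_def e_def)
qed

section \<open>Counting in skew grids\<close>

text \<open>Lets the constructions work with index sets: distinct indices may define the same ball or the same tube,
at the cost of a constant factor only.\<close>

lemma card_le_fibre_bound:
  fixes B :: real
  assumes "finite A" "\<And>b. b \<in> f ` A \<Longrightarrow> real (card {a\<in>A. f a = b}) \<le> B"
  shows "real (card A) \<le> B * real (card (f ` A))"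
proof -
  have "A = (\<Union>b\<in>f ` A. {a\<in>A. f a = b})" by auto
  then have "card A \<le> (\<Sum>b\<in>f ` A. card {a\<in>A. f a = b})"
    using card_UN_le[of "f ` A" "\<lambda>b. {a\<in>A. f a = b}"] assms(1) by simp
  then have "real (card A) \<le> (\<Sum>b\<in>f ` A. real (card {a\<in>A. f a = b}))"
    by (simp flip: of_nat_sum)
  also have "\<dots> \<le> (\<Sum>b\<in>f ` A. B)" using assms(2) by (intro sum_mono)
  finally show ?thesis by (simp add: mult.commute)
qed

lemma card_progression_window:
  fixes a d u w :: real
  assumes "d \<noteq> 0" "0 \<le> w"
  shows "real (card {i::nat. i < n \<and> \<bar>a + d * real i - u\<bar> \<le> w}) \<le> 1 + 2 * w / \<bar>d\<bar>"
proof (cases "{i::nat. i < n \<and> \<bar>a + d * real i - u\<bar> \<le> w} = {}")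
  case False
  define A where "A = {i::nat. i < n \<and> \<bar>a + d * real i - u\<bar> \<le> w}"
  have fin: "finite A" by (simp add: A_def)
  have ne: "A \<noteq> {}" using False by (simp add: A_def)
  have ends: "Min A \<in> A" "Max A \<in> A" using fin ne by auto
  have le: "Min A \<le> Max A" using fin ends by auto
  have "\<bar>d * (real (Max A) - real (Min A))\<bar> \<le> 2 * w"
    using ends by (simp add: A_def abs_le_iff algebra_simps)
  then have "real (Max A) - real (Min A) \<le> 2 * w / \<bar>d\<bar>"
    using assms le by (simp add: abs_mult field_simps)
  moreover have "A \<subseteq> {Min A..Max A}" using fin by auto
  then have "card A \<le> Suc (Max A) - Min A" by (metis card_atLeastAtMost card_mono finite_atLeastAtMost)
  then have "real (card A) \<le> 1 + (real (Max A) - real (Min A))" using le by linarith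
  ultimately show ?thesis unfolding A_def by linarith
next
  case True
  have "0 \<le> 2 * w / \<bar>d\<bar>" using assms by simp
  then show ?thesis unfolding True by simp
qed

lemma card_triple_le:
  fixes I\<^sub>0 :: "'i set" and A B C :: real
  assumes "X \<subseteq> {(i, k, l). i \<in> I\<^sub>0 \<and> l \<in> L\<^sub>0 i \<and> k \<in> K\<^sub>0 i l}"
    and "finite I\<^sub>0" "\<And>i. finite (L\<^sub>0 i)" "\<And>i l. finite (K\<^sub>0 i l)"
    and "real (card I\<^sub>0) \<le> A" "\<And>i. real (card (L\<^sub>0 i)) \<le> B" "\<And>i l. real (card (K\<^sub>0 i l)) \<le> C"
  shows "real (card X) \<le> A * B * C"
proof -
  have nn: "0 \<le> B" "0 \<le> C" using assms(6,7) by (meson of_nat_0_le_iff order_trans)+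
  have "{(i, k, l). i \<in> I\<^sub>0 \<and> l \<in> L\<^sub>0 i \<and> k \<in> K\<^sub>0 i l}
      = (\<lambda>(i, l, k). (i, k, l)) ` (SIGMA i:I\<^sub>0. SIGMA l:L\<^sub>0 i. K\<^sub>0 i l)" (is "?Y = ?f ` ?Z") by force
  moreover have finZ: "finite ?Z" using assms by (intro finite_SigmaI) auto
  ultimately have "card X \<le> card ?Z"
    using assms(1) by (metis (no_types, lifting) card_image_le card_mono finite_imageI order_trans)
  also have "\<dots> = (\<Sum>i\<in>I\<^sub>0. \<Sum>l\<in>L\<^sub>0 i. card (K\<^sub>0 i l))"
  proof -
    have "card ?Z = (\<Sum>i\<in>I\<^sub>0. card (SIGMA l:L\<^sub>0 i. K\<^sub>0 i l))"
      using assms by (intro card_SigmaI) (auto intro!: finite_SigmaI)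
    also have "\<dots> = (\<Sum>i\<in>I\<^sub>0. \<Sum>l\<in>L\<^sub>0 i. card (K\<^sub>0 i l))"
      using assms by (intro sum.cong refl card_SigmaI) auto
    finally show ?thesis .
  qed
  finally have "real (card X) \<le> (\<Sum>i\<in>I\<^sub>0. \<Sum>l\<in>L\<^sub>0 i. real (card (K\<^sub>0 i l)))" by (simp flip: of_nat_sum)
  also have "\<dots> \<le> (\<Sum>i\<in>I\<^sub>0. \<Sum>l\<in>L\<^sub>0 i. C)" using assms by (intro sum_mono)
  also have "\<dots> \<le> (\<Sum>i\<in>I\<^sub>0. B * C)"
    using assms(6) nn by (intro sum_mono) (simp add: mult_right_mono)
  also have "\<dots> \<le> A * (B * C)" using assms(5) nn by (simp add: mult_right_mono)
  finally show ?thesis by (simp add: mult.assoc)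
qed

definition grid :: "nat \<Rightarrow> nat \<Rightarrow> nat \<Rightarrow> (nat \<times> nat \<times> nat) set" where
  "grid n n' L = {..<n} \<times> {..<n'} \<times> {..<L}"

lemma finite_grid [simp]: "finite (grid n n' L)"
  by (simp add: grid_def)

text \<open>A skew grid: L elements spread over a stretch of length comparable to \<sigma>, repeated at n abscissas
that are at least \<sigma> apart (up to a constant) and in n' rows. Such a grid is spaced at every scale
because it is a product of progressions, even after shearing the rows by a slope that depends on the
abscissa. For w below \<sigma> a square meets boundedly many of the n stretches; for w above \<sigma> it
meets whole stretches, and their number is compared with the total. The lower bound on the slopes h
keeps the rows at distance about 1/n'.\<close>

lemma grid_dim_spaced:
  fixes n n' L :: nat and \<delta> \<sigma> \<gamma> :: real
  defines "b \<equiv> min \<gamma> 1"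
  assumes d: "0 < \<delta>" "\<delta> \<le> \<sigma>" "\<sigma> \<le> 1" and g: "0 \<le> \<gamma>" "\<gamma> \<le> 2"
    and n: "1 \<le> n" "1 \<le> n'" "1 \<le> L"
    and n\<sigma>: "real n * \<sigma> \<le> 1" and L: "real L \<le> (\<sigma> / \<delta>) powr b"
    and n'\<sigma>: "\<sigma> * real n' \<le> (\<sigma> / \<delta>) powr (\<gamma> - b)"
    and total: "real n * real n' * (\<sigma> / \<delta>) powr b \<le> \<delta> powr - \<gamma>"
    and f: "\<And>i k l. f (i, k, l) = u\<^sub>0 + real i / (8 * real n) + \<sigma> * real l / (16 * real L)"
    and h: "\<And>i k l. i < n \<Longrightarrow> l < L \<Longrightarrow> g (i, k, l) = p i l + h i l * (real k / real n')"
    and h_big: "\<And>i l. i < n \<Longrightarrow> l < L \<Longrightarrow> 1 / 128 \<le> \<bar>h i l\<bar>"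
  shows "dim_spaced \<delta> \<gamma> 160000 (grid n n' L) f g"
  unfolding dim_spaced_def
proof (intro conjI allI impI)
  fix u v w :: real assume w: "\<delta> \<le> w"
  define X where "X = {s\<in>grid n n' L. \<bar>f s - u\<bar> \<le> w \<and> \<bar>g s - v\<bar> \<le> w}"
  have pos: "0 < w" "0 < \<sigma>" using w d by linarith+
  have b: "0 \<le> b" "b \<le> 1" "b \<le> \<gamma>" "\<gamma> - b \<le> 1" using g by (auto simp: b_def)
  have wd: "1 \<le> w / \<delta>" "1 \<le> \<sigma> / \<delta>" using w d by auto
  define I\<^sub>0 where "I\<^sub>0 = {i. i < n \<and> \<bar>u\<^sub>0 + 1 / (8 * real n) * real i - u\<bar> \<le> w + \<sigma> / 16}"
  define L\<^sub>0 where "L\<^sub>0 i = {l. l < L \<and> \<bar>(u\<^sub>0 + real i / (8 * real n)) + \<sigma> / (16 * real L) * real l - u\<bar> \<le> w}" for i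
  define K\<^sub>0 where "K\<^sub>0 i l = (if i < n \<and> l < L then
      {k. k < n' \<and> \<bar>p i l + h i l / real n' * real k - v\<bar> \<le> w} else {})" for i l
  have XD: "X \<subseteq> {(i, k, l). i \<in> I\<^sub>0 \<and> l \<in> L\<^sub>0 i \<and> k \<in> K\<^sub>0 i l}"
  proof
    fix s assume s: "s \<in> X"
    obtain i k l where ikl: "s = (i, k, l)" by (cases s)
    have r: "i < n" "k < n'" "l < L" and fs: "\<bar>f s - u\<bar> \<le> w" and gs: "\<bar>g s - v\<bar> \<le> w"
      using s ikl by (auto simp: X_def grid_def)
    have "0 \<le> \<sigma> * real l / (16 * real L)" "\<sigma> * real l / (16 * real L) \<le> \<sigma> / 16"
      using r pos by (auto simp: field_simps)
    then have "i \<in> I\<^sub>0" using fs r unfolding ikl f by (simp add: I\<^sub>0_def)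
    moreover have "l \<in> L\<^sub>0 i" using fs r unfolding ikl f by (simp add: L\<^sub>0_def)
    moreover have "k \<in> K\<^sub>0 i l" using gs r h[OF r(1,3)] unfolding ikl by (simp add: K\<^sub>0_def)
    ultimately show "s \<in> {(i, k, l). i \<in> I\<^sub>0 \<and> l \<in> L\<^sub>0 i \<and> k \<in> K\<^sub>0 i l}" using ikl by simp
  qed
  have cI: "real (card I\<^sub>0) \<le> 2 + 16 * (w * real n)"
  proof -
    have "real (card I\<^sub>0) \<le> 1 + 2 * (w + \<sigma> / 16) / \<bar>1 / (8 * real n)\<bar>"
      unfolding I\<^sub>0_def using n pos by (intro card_progression_window) auto
    also have "\<dots> = 1 + 16 * (w * real n) + real n * \<sigma>" using n by (simp add: field_simps)
    finally show ?thesis using n\<sigma> by linarith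
  qed
  have cL1: "real (card (L\<^sub>0 i)) \<le> 1 + 32 * (w * real L / \<sigma>)" for i
  proof -
    have "real (card (L\<^sub>0 i)) \<le> 1 + 2 * w / \<bar>\<sigma> / (16 * real L)\<bar>"
      unfolding L\<^sub>0_def using n pos by (intro card_progression_window) auto
    then show ?thesis using n pos by (simp add: field_simps)
  qed
  have cL2: "real (card (L\<^sub>0 i)) \<le> (\<sigma> / \<delta>) powr b" for i
  proof -
    have "card (L\<^sub>0 i) \<le> card {..<L}" unfolding L\<^sub>0_def by (intro card_mono) auto
    then show ?thesis using L by simp
  qed
  have cK: "real (card (K\<^sub>0 i l)) \<le> 1 + 256 * (w * real n')" for i l
  proof (cases "i < n \<and> l < L")
    case True
    then have hb: "1 / 128 \<le> \<bar>h i l\<bar>" using h_big by blast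
    then have nz: "h i l / real n' \<noteq> 0" using n by auto
    have "real (card (K\<^sub>0 i l)) \<le> 1 + 2 * w / \<bar>h i l / real n'\<bar>"
      using card_progression_window[OF nz, of w n' "p i l" v] True pos by (simp add: K\<^sub>0_def)
    also have "\<dots> = 1 + 2 * w * real n' / \<bar>h i l\<bar>" by (simp add: abs_divide)
    also have "\<dots> \<le> 1 + 2 * w * real n' / (1 / 128)"
      using hb pos by (intro add_left_mono divide_left_mono) auto
    finally show ?thesis by simp
  next
    case False
    have "0 \<le> 256 * (w * real n')" using pos by simp
    then show ?thesis using False unfolding K\<^sub>0_def by (auto intro: add_increasing2)
  qed
  have fin: "finite I\<^sub>0" "finite (L\<^sub>0 i)" "finite (K\<^sub>0 i l)" for i l
    by (auto simp: I\<^sub>0_def L\<^sub>0_def K\<^sub>0_def)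
  have ge1: "1 \<le> (w / \<delta>) powr e" if "0 \<le> e" for e using wd that by (intro ge_one_powr_ge_zero) auto
  \<comment> \<open>Below \<sigma> one sees part of a stretch, above \<sigma> several stretches, and above 1 everything.\<close>
  consider "w \<le> \<sigma>" | "\<sigma> < w" "w \<le> 1" | "1 < w" by linarith
  then have "real (card X) \<le> 160000 * (w / \<delta>) powr \<gamma>"
  proof cases
    case 1
    have ws: "w / \<sigma> \<le> 1" "0 < w / \<sigma>" using 1 pos by auto
    have shrink: "w / \<sigma> * (\<sigma> / \<delta>) powr e \<le> (w / \<delta>) powr e" if "e \<le> 1" for e
    proof -
      have "(w / \<sigma>) powr 1 \<le> (w / \<sigma>) powr e" using ws that by (intro powr_mono') auto
      moreover have "(w / \<sigma>) powr 1 = w / \<sigma>" using ws(2) by (intro powr_one less_imp_le)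
      ultimately have "w / \<sigma> \<le> (w / \<sigma>) powr e" by linarith
      then have "w / \<sigma> * (\<sigma> / \<delta>) powr e \<le> (w / \<sigma>) powr e * (\<sigma> / \<delta>) powr e"
        by (intro mult_right_mono) auto
      also have "\<dots> = (w / \<delta>) powr e" using pos d by (simp flip: powr_mult)
      finally show ?thesis .
    qed
    have A: "real (card I\<^sub>0) \<le> 18"
    proof -
      have "w * real n \<le> \<sigma> * real n" using 1 by (intro mult_right_mono) auto
      then show ?thesis using cI n\<sigma> by (simp add: mult.commute)
    qed
    have B: "real (card (L\<^sub>0 i)) \<le> 33 * (w / \<delta>) powr b" for i
    proof -
      have "w * real L / \<sigma> = w / \<sigma> * real L" by simp
      also have "\<dots> \<le> w / \<sigma> * (\<sigma> / \<delta>) powr b" using L ws by (intro mult_left_mono) auto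
      also have "\<dots> \<le> (w / \<delta>) powr b" using b by (intro shrink)
      finally show ?thesis using cL1[of i] ge1[OF b(1)] by linarith
    qed
    have C: "real (card (K\<^sub>0 i l)) \<le> 257 * (w / \<delta>) powr (\<gamma> - b)" for i l
    proof -
      have "w * real n' = w / \<sigma> * (\<sigma> * real n')" using pos by simp
      also have "\<dots> \<le> w / \<sigma> * (\<sigma> / \<delta>) powr (\<gamma> - b)" using n'\<sigma> ws by (intro mult_left_mono) auto
      also have "\<dots> \<le> (w / \<delta>) powr (\<gamma> - b)" using b by (intro shrink)
      finally show ?thesis using cK[of i l] ge1[of "\<gamma> - b"] b by linarith
    qed
    have "real (card X) \<le> 18 * (33 * (w / \<delta>) powr b) * (257 * (w / \<delta>) powr (\<gamma> - b))"
      by (rule card_triple_le[OF XD fin A B C])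
    also have "\<dots> = 152658 * (w / \<delta>) powr \<gamma>" by (simp flip: powr_add)
    also have "\<dots> \<le> 160000 * (w / \<delta>) powr \<gamma>" by (intro mult_right_mono) auto
    finally show ?thesis .
  next
    case 2
    define Y where "Y = (\<sigma> / \<delta>) powr b"
    define W where "W = (w / \<delta>) powr \<gamma>"
    have Y1: "1 \<le> Y" unfolding Y_def using wd b by (intro ge_one_powr_ge_zero) auto
    have mono: "(\<sigma> / \<delta>) powr e \<le> (w / \<delta>) powr e" if "0 \<le> e" for e
      using that 2 pos d by (intro powr_mono2 divide_right_mono) auto
    have W_eq: "W = w powr \<gamma> * \<delta> powr - \<gamma>"
      using pos d by (simp add: W_def powr_divide powr_minus_divide)
    have t0: "Y \<le> W"
    proof -
      have "Y \<le> (w / \<delta>) powr b" unfolding Y_def using b by (intro mono)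
      also have "\<dots> \<le> W" unfolding W_def using wd b by (intro powr_mono) auto
      finally show ?thesis .
    qed
    have t3: "w * w * real n * real n' * Y \<le> W"
    proof -
      have "w * w * (real n * real n' * Y) \<le> w powr 2 * \<delta> powr - \<gamma>"
        using total pos unfolding Y_def by (intro mult_mono) (auto simp: power2_eq_square)
      also have "\<dots> \<le> W" unfolding W_eq using 2 pos g by (intro mult_right_mono powr_mono') auto
      finally show ?thesis by (simp add: mult.assoc)
    qed
    have t12: "w * real n * Y \<le> W \<and> w * real n' * Y \<le> W"
    proof (cases "\<gamma> \<le> 1")
      case True
      have *: "w * (real n * real n' * Y) \<le> W"
      proof -
        have "w * (real n * real n' * Y) \<le> w powr 1 * \<delta> powr - \<gamma>"
          using total pos unfolding Y_def by (intro mult_mono) auto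
        also have "\<dots> \<le> W" unfolding W_eq using 2 pos True by (intro mult_right_mono powr_mono') auto
        finally show ?thesis .
      qed
      have "real n * 1 \<le> real n * real n'" "1 * real n' \<le> real n * real n'"
        using n by (intro mult_mono; simp)+
      then have "real n * (w * Y) \<le> (real n * real n') * (w * Y)"
        "real n' * (w * Y) \<le> (real n * real n') * (w * Y)"
        using pos Y1 by (simp_all only: mult_1 mult_1_right mult_right_mono mult_nonneg_nonneg order.trans[OF zero_le_one] less_imp_le)
      then show ?thesis using * by (simp add: mult_ac)
    next
      case False
      then have b1: "b = 1" by (simp add: b_def)
      have Yeq: "Y = \<sigma> / \<delta>" using pos d by (simp add: Y_def b1)
      have "w * real n * Y = (w / \<delta>) * (real n * \<sigma>)" by (simp add: Yeq)
      also have "\<dots> \<le> (w / \<delta>) * 1" using n\<sigma> wd by (intro mult_left_mono) auto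
      also have "\<dots> \<le> (w / \<delta>) powr \<gamma>" using False wd pos d powr_mono[of 1 \<gamma> "w / \<delta>"] by simp
      finally have 1: "w * real n * Y \<le> W" by (simp add: W_def)
      have "w * real n' * Y = (w / \<delta>) * (\<sigma> * real n')" by (simp add: Yeq)
      also have "\<dots> \<le> (w / \<delta>) * (\<sigma> / \<delta>) powr (\<gamma> - 1)"
        using n'\<sigma> wd b1 by (intro mult_left_mono) auto
      also have "\<dots> \<le> (w / \<delta>) * (w / \<delta>) powr (\<gamma> - 1)"
        using wd False by (intro mult_left_mono mono) auto
      also have "\<dots> = W" using pos d by (simp add: W_def powr_diff)
      finally show ?thesis using 1 by simp
    qed
    have "real (card X) \<le> (2 + 16 * (w * real n)) * Y * (1 + 256 * (w * real n'))"
      unfolding Y_def by (rule card_triple_le[OF XD fin cI cL2 cK])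
    also have "\<dots> = 2 * Y + 16 * (w * real n * Y) + 512 * (w * real n' * Y) + 4096 * (w * w * real n * real n' * Y)"
      by (simp add: algebra_simps)
    also have "\<dots> \<le> 4626 * W" using t0 t12 t3 by linarith
    also have "\<dots> \<le> 160000 * W" unfolding W_def by (intro mult_right_mono) auto
    finally show ?thesis by (simp add: W_def)
  next
    case 3
    have "card X \<le> card (grid n n' L)" unfolding X_def by (intro card_mono) auto
    also have "\<dots> = n * n' * L" by (simp add: grid_def)
    finally have "real (card X) \<le> real (n * n' * L)" by linarith
    also have "\<dots> \<le> real n * real n' * (\<sigma> / \<delta>) powr b"
      using L by (auto intro!: mult_left_mono)
    also have "\<dots> \<le> 1 * \<delta> powr - \<gamma>" using total by simp
    also have "\<dots> \<le> w powr \<gamma> * \<delta> powr - \<gamma>"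
      using 3 g by (intro mult_right_mono ge_one_powr_ge_zero) auto
    also have "\<dots> = 1 * (w / \<delta>) powr \<gamma>" using pos d by (simp add: powr_divide powr_minus_divide)
    also have "\<dots> \<le> 160000 * (w / \<delta>) powr \<gamma>" by (intro mult_right_mono) auto
    finally show ?thesis .
  qed
  then show "real (card {s\<in>grid n n' L. \<bar>f s - u\<bar> \<le> w \<and> \<bar>g s - v\<bar> \<le> w}) \<le> 160000 * (w / \<delta>) powr \<gamma>"
    by (simp add: X_def)
qed simp

text \<open>The hypotheses of \<open>grid_dim_spaced\<close> for sizes that are powers of \<delta>. With \<open>b =
min \<gamma> 1\<close>, the condition on the rows reduces to \<open>(1 - r) * b * r \<le> r\<close>, and
the condition on the abscissas to \<open>\<nu> \<le> 1\<close>. It applies to the balls with r and to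
the tubes with 1 - r, in which the roles of n and n' are exchanged.\<close>

lemma grid_dim_spaced_powers:
  fixes n n' L :: nat and \<delta> r \<gamma> \<nu> :: real
  assumes d: "0 < \<delta>" "\<delta> \<le> 1" and g: "0 \<le> \<gamma>" "\<gamma> \<le> 2" and r: "0 \<le> r" "r \<le> 1"
    and nu: "\<nu> = \<gamma> - min \<gamma> 1 * (1 - r)" "\<nu> \<le> 1"
    and n: "1 \<le> n" "1 \<le> n'" "1 \<le> L"
    and n_le: "real n \<le> \<delta> powr - (r * \<nu>)" and n'_le: "real n' \<le> \<delta> powr - ((1 - r) * \<nu>)"
    and L_le: "real L \<le> \<delta> powr - ((1 - r) * min \<gamma> 1)"
    and f: "\<And>i k l. f (i, k, l) = u\<^sub>0 + real i / (8 * real n) + \<delta> powr r * real l / (16 * real L)"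
    and h: "\<And>i k l. i < n \<Longrightarrow> l < L \<Longrightarrow> g (i, k, l) = p i l + h i l * (real k / real n')"
    and h_big: "\<And>i l. i < n \<Longrightarrow> l < L \<Longrightarrow> 1 / 128 \<le> \<bar>h i l\<bar>"
  shows "dim_spaced \<delta> \<gamma> 160000 (grid n n' L) f g"
proof (rule grid_dim_spaced[where \<sigma> = "\<delta> powr r", OF d(1) _ _ g n])
  define b where "b = min \<gamma> 1"
  have b: "0 \<le> b" "b \<le> 1" using g by (auto simp: b_def)
  have \<sigma>\<delta>: "(\<delta> powr r / \<delta>) powr e = \<delta> powr - ((1 - r) * e)" for e
  proof -
    have "\<delta> powr r / \<delta> = \<delta> powr (r - 1)" using d by (simp add: powr_diff)
    then show ?thesis using d by (simp add: powr_powr algebra_simps)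
  qed
  show "\<delta> \<le> \<delta> powr r" using d r powr_mono'[of r 1 \<delta>] by simp
  show "\<delta> powr r \<le> 1" using d r by (intro powr_le1) auto
  show "real n * \<delta> powr r \<le> 1"
  proof -
    have "real n * \<delta> powr r \<le> \<delta> powr - (r * \<nu>) * \<delta> powr r" using n_le by (intro mult_right_mono) auto
    also have "\<dots> = \<delta> powr (r * (1 - \<nu>))" by (simp add: algebra_simps flip: powr_add)
    also have "\<dots> \<le> 1" using d r nu by (intro powr_le1) auto
    finally show ?thesis .
  qed
  show "real L \<le> (\<delta> powr r / \<delta>) powr min \<gamma> 1" using L_le by (simp only: \<sigma>\<delta>)
  show "\<delta> powr r * real n' \<le> (\<delta> powr r / \<delta>) powr (\<gamma> - min \<gamma> 1)"
  proof -
    have "\<delta> powr r * real n' \<le> \<delta> powr r * \<delta> powr - ((1 - r) * \<nu>)" using n'_le by (intro mult_left_mono) auto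
    also have "\<dots> = \<delta> powr (r - (1 - r) * \<nu>)" by (simp flip: powr_add)
    also have "\<dots> \<le> \<delta> powr - ((1 - r) * (\<gamma> - b))"
    proof (intro powr_mono')
      have "(1 - r) * b * r \<le> 1 * 1 * r" using r b by (intro mult_mono) auto
      moreover have "r - (1 - r) * \<nu> + (1 - r) * (\<gamma> - b) = r - (1 - r) * b * r"
        by (simp add: nu(1) b_def algebra_simps)
      ultimately show "- ((1 - r) * (\<gamma> - b)) \<le> r - (1 - r) * \<nu>" by linarith
    qed (use d in auto)
    finally show ?thesis by (simp add: \<sigma>\<delta> b_def)
  qed
  show "real n * real n' * (\<delta> powr r / \<delta>) powr min \<gamma> 1 \<le> \<delta> powr - \<gamma>"
  proof -
    have "real n * real n' * (\<delta> powr r / \<delta>) powr b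
        \<le> \<delta> powr - (r * \<nu>) * \<delta> powr - ((1 - r) * \<nu>) * \<delta> powr - ((1 - r) * b)"
      unfolding \<sigma>\<delta> using n_le n'_le by (intro mult_mono) auto
    also have "\<dots> = \<delta> powr - \<gamma>" by (simp add: nu(1) b_def algebra_simps flip: powr_add)
    finally show ?thesis by (simp add: b_def)
  qed
qed (use f h h_big in auto)

definition nfloor :: "real \<Rightarrow> nat" where "nfloor X = nat \<lfloor>X\<rfloor>"

lemma nfloor_bounds:
  assumes "1 \<le> X"
  shows "1 \<le> nfloor X" "real (nfloor X) \<le> X" "X / 2 \<le> real (nfloor X)"
proof -
  have 1: "1 \<le> \<lfloor>X\<rfloor>" using assms by simp
  then have "real (nfloor X) = of_int \<lfloor>X\<rfloor>" by (simp add: nfloor_def)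
  then show "real (nfloor X) \<le> X" "X / 2 \<le> real (nfloor X)" using 1 by linarith+
  show "1 \<le> nfloor X" using 1 unfolding nfloor_def by linarith
qed

section \<open>From points and lines to balls and tubes\<close>

definition plane_point :: "real \<Rightarrow> real \<Rightarrow> real ^ 2" where
  "plane_point a b = (\<chi> k. if k = 1 then a else b)"

lemma plane_point_simps [simp]: "plane_point a b $ 1 = a" "plane_point a b $ 2 = b"
  by (auto simp: plane_point_def)

definition centred_ball :: "real \<Rightarrow> real \<Rightarrow> real \<Rightarrow> (real ^ 2) set" where
  "centred_ball \<delta> a b = cball (plane_point (1 / 2 + a) (1 / 2 + b)) \<delta>"

text \<open>The rectangle of width \<delta> and length l along the line of slope m and intercept c in coordinates
centred at (1/2, 1/2). For l = 1 the midpoint of its axis is (1/2, 1/2 + c); a larger l prolongs it at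
one end.\<close>

definition centred_strip :: "real \<Rightarrow> real \<Rightarrow> real \<Rightarrow> real \<Rightarrow> (real ^ 2) set" where
  "centred_strip \<delta> l m c =
     (let n = sqrt (1 + m\<^sup>2); u = plane_point (- m / n) (1 / n); v = plane_point (1 / n) (m / n) in
      {(plane_point (1 / 2) (1 / 2 + c) - (\<delta> / 2) *\<^sub>R u - (1 / 2) *\<^sub>R v) + s *\<^sub>R u + t *\<^sub>R v
        | s t. 0 \<le> s \<and> s \<le> \<delta> \<and> 0 \<le> t \<and> t \<le> l})"

lemma coords_12: "(1 :: 2) \<noteq> 2" by simp

lemma is_rectangle_centred_strip: "is_rectangle \<delta> l (centred_strip \<delta> l m c)"
proof -
  define n where "n = sqrt (1 + m\<^sup>2)"
  have n: "0 < n" "n * n = 1 + m\<^sup>2" by (auto simp: n_def add_pos_nonneg)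
  have "1 / (n * n) + m\<^sup>2 / (n * n) = 1" using n
    by (metis add_divide_distrib divide_self_if less_irrefl mult_eq_0_iff)
  then have "norm (plane_point (- m / n) (1 / n)) = 1" "norm (plane_point (1 / n) (m / n)) = 1"
    "plane_point (- m / n) (1 / n) \<bullet> plane_point (1 / n) (m / n) = 0"
    by (auto simp: norm_eq_1 inner_coords[OF coords_12] power2_eq_square)
  then show ?thesis unfolding is_rectangle_def centred_strip_def Let_def n_def[symmetric] by blast
qed

lemma centred_strip_mono: "l \<le> l' \<Longrightarrow> centred_strip \<delta> l m c \<subseteq> centred_strip \<delta> l' m c"
  unfolding centred_strip_def Let_def by fastforce

lemma centred_ball_subset:
  assumes "\<bar>a\<bar> \<le> 1 / 4" "\<bar>b\<bar> \<le> 1 / 4" "\<delta> \<le> 1 / 16"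
  shows "centred_ball \<delta> a b \<subseteq> unit_square"
proof
  fix z assume "z \<in> centred_ball \<delta> a b"
  then have "norm (plane_point (1 / 2 + a) (1 / 2 + b) - z) \<le> \<delta>"
    by (simp add: centred_ball_def dist_norm)
  then have dz: "\<bar>(plane_point (1 / 2 + a) (1 / 2 + b) - z) $ k\<bar> \<le> \<delta>" for k
    using component_le_norm_cart[of "plane_point (1 / 2 + a) (1 / 2 + b) - z" k] by linarith
  have "0 \<le> z $ 1" "z $ 1 \<le> 1" using dz[of 1] assms by (auto simp: abs_le_iff)
  moreover have "0 \<le> z $ 2" "z $ 2 \<le> 1" using dz[of 2] assms by (auto simp: abs_le_iff)
  ultimately show "z \<in> unit_square" by (simp add: unit_square_def forall_2)
qed

text \<open>A segment of length 1 through the middle of the square fits into it, and the width \<delta> fits too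
once the slope is bounded away from 0: then the horizontal extent falls short of 1 by more than the tilt
of the short side adds. A nearly horizontal tube would stick out.\<close>

lemma centred_strip_subset:
  assumes m: "1 / 4 \<le> m" "m \<le> 1 / 2" and c: "\<bar>c\<bar> \<le> 1 / 8" and d: "0 < \<delta>" "\<delta> \<le> 1 / 16"
  shows "centred_strip \<delta> 1 m c \<subseteq> unit_square"
proof
  fix z assume "z \<in> centred_strip \<delta> 1 m c"
  define n where "n = sqrt (1 + m\<^sup>2)"
  obtain s t where st: "0 \<le> s" "s \<le> \<delta>" "0 \<le> t" "t \<le> 1"
    and z: "z = (plane_point (1 / 2) (1 / 2 + c) - (\<delta> / 2) *\<^sub>R plane_point (- m / n) (1 / n)
      - (1 / 2) *\<^sub>R plane_point (1 / n) (m / n)) + s *\<^sub>R plane_point (- m / n) (1 / n) + t *\<^sub>R plane_point (1 / n) (m / n)"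
    using \<open>z \<in> centred_strip \<delta> 1 m c\<close> unfolding centred_strip_def Let_def n_def[symmetric] by blast
  define s' where "s' = s - \<delta> / 2"
  define t' where "t' = t - 1 / 2"
  have st': "\<bar>s'\<bar> \<le> \<delta> / 2" "\<bar>t'\<bar> \<le> 1 / 2" unfolding s'_def t'_def using st by linarith+
  have n1: "1 \<le> n" by (simp add: n_def)
  have z1: "z $ 1 = 1 / 2 + (t' - m * s') / n" and z2: "z $ 2 = 1 / 2 + c + (s' + m * t') / n"
    by (simp_all add: z s'_def t'_def algebra_simps add_divide_distrib diff_divide_distrib)
  have ms: "\<bar>m * s'\<bar> \<le> m * (\<delta> / 2)" "\<bar>m * t'\<bar> \<le> 1 / 2 * (1 / 2)"
    unfolding abs_mult using m st' by (intro mult_mono; simp)+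
  have "1 + m * \<delta> \<le> n" unfolding n_def
  proof (rule real_le_rsqrt)
    have "\<delta> * (2 + m * \<delta>) \<le> 1 / 16 * (2 + 1 / 2 * (1 / 16))" using d m by (intro mult_mono add_left_mono) auto
    also have "\<dots> \<le> m" using m by simp
    finally have "m * (\<delta> * (2 + m * \<delta>)) \<le> m * m" using m by (intro mult_left_mono) auto
    then show "(1 + m * \<delta>)\<^sup>2 \<le> 1 + m\<^sup>2" by (simp add: power2_eq_square algebra_simps)
  qed
  moreover have "\<bar>t' - m * s'\<bar> \<le> 1 / 2 + m * (\<delta> / 2)" using ms(1) st'(2) by linarith
  moreover have "1 / 2 + m * (\<delta> / 2) = (1 + m * \<delta>) / 2" by (simp add: add_divide_distrib)
  ultimately have "\<bar>t' - m * s'\<bar> \<le> n / 2" by linarith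
  then have "\<bar>(t' - m * s') / n\<bar> \<le> 1 / 2" using n1 by (simp add: abs_divide field_simps)
  then have 1: "0 \<le> z $ 1" "z $ 1 \<le> 1" unfolding z1 by linarith+
  have "\<bar>s' + m * t'\<bar> \<le> 9 / 32" using ms(2) st'(1) d by linarith
  then have "\<bar>(s' + m * t') / n\<bar> \<le> (9 / 32) / 1" unfolding abs_divide using n1 by (intro frac_le) auto
  then have 2: "0 \<le> z $ 2" "z $ 2 \<le> 1" unfolding z2 using c by linarith+
  show "z \<in> unit_square" using 1 2 by (simp add: unit_square_def forall_2)
qed

lemma ball_meets_strip:
  assumes a: "\<bar>a\<bar> \<le> 1 / 4" and m: "1 / 4 \<le> m" "m \<le> 1 / 2" and d: "0 < \<delta>"
    and inc: "\<bar>b - m * a - c\<bar> \<le> \<delta>"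
  shows "centred_ball \<delta> a b \<inter> centred_strip \<delta> 1 m c \<noteq> {}"
proof -
  define n where "n = sqrt (1 + m\<^sup>2)"
  have n1: "1 \<le> n" by (simp add: n_def)
  have "m\<^sup>2 \<le> 1 ^ 2" using m by (intro power_mono) auto
  then have n2: "n \<le> 2" unfolding n_def by (intro real_le_lsqrt) auto
  define z where "z = plane_point (1 / 2 + a) (1 / 2 + c + m * a)"
  have "dist (plane_point (1 / 2 + a) (1 / 2 + b)) z \<le> \<delta>"
    unfolding dist_norm z_def using inc
    by (intro order_trans[OF norm_le_coords[OF coords_12]]) (simp add: algebra_simps)
  then have 1: "z \<in> centred_ball \<delta> a b" by (simp add: centred_ball_def)
  have "\<bar>a * n\<bar> \<le> 1 / 4 * 2" unfolding abs_mult using a n1 n2 by (intro mult_mono) auto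
  then have t: "0 \<le> 1 / 2 + a * n" "1 / 2 + a * n \<le> 1" by (auto simp: abs_le_iff)
  have "z = (plane_point (1 / 2) (1 / 2 + c) - (\<delta> / 2) *\<^sub>R plane_point (- m / n) (1 / n)
      - (1 / 2) *\<^sub>R plane_point (1 / n) (m / n)) + (\<delta> / 2) *\<^sub>R plane_point (- m / n) (1 / n)
      + (1 / 2 + a * n) *\<^sub>R plane_point (1 / n) (m / n)"
    unfolding vec_eq_coords[OF coords_12] using n1 by (simp add: z_def algebra_simps)
  then have "z \<in> centred_strip \<delta> 1 m c"
    unfolding centred_strip_def Let_def n_def[symmetric] using t d
    by (intro CollectI exI[of _ "\<delta> / 2"] exI[of _ "1 / 2 + a * n"]) auto
  then show ?thesis using 1 by blast
qed

text \<open>Let U be the direction of the short side of R. The axes of both tubes are nearly orthogonal to U, and so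
is the difference of their midpoints, which is vertical. If U is not nearly horizontal, this compares
the slopes and the intercepts. If it is, then w is bounded below because the slopes are at most 1/2, and
there is nothing to show.\<close>

lemma strips_in_common_rectangle:
  assumes R: "is_rectangle w 2 R" "0 < w"
    and sub: "centred_strip \<delta> 1 m c \<subseteq> R" "centred_strip \<delta> 1 m' c' \<subseteq> R" and d: "0 < \<delta>"
    and m: "1 / 4 \<le> m" "m \<le> 1 / 2" "1 / 4 \<le> m'" "m' \<le> 1 / 2" and c: "\<bar>c\<bar> \<le> 1 / 8" "\<bar>c'\<bar> \<le> 1 / 8"
  shows "\<bar>m' - m\<bar> \<le> 5 * w \<and> \<bar>c' - c\<bar> \<le> 5 * w"
proof -
  obtain p U V where UV: "norm U = 1" "norm V = 1" "U \<bullet> V = 0"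
    and R_eq: "R = {p + s *\<^sub>R U + t *\<^sub>R V | s t. 0 \<le> s \<and> s \<le> w \<and> 0 \<le> t \<and> t \<le> 2}"
    using R(1) unfolding is_rectangle_def by blast
  have width: "\<bar>(z - z') \<bullet> U\<bar> \<le> w" if "z \<in> R" "z' \<in> R" for z z'
  proof -
    obtain s t where z: "z = p + s *\<^sub>R U + t *\<^sub>R V" "0 \<le> s" "s \<le> w" using \<open>z \<in> R\<close> R_eq by auto
    obtain s' t' where z': "z' = p + s' *\<^sub>R U + t' *\<^sub>R V" "0 \<le> s'" "s' \<le> w" using \<open>z' \<in> R\<close> R_eq by auto
    have "U \<bullet> U = 1" using UV(1) by (simp add: dot_square_norm)
    then have "(z - z') \<bullet> U = s - s'" using UV(3)
      by (simp add: z z' inner_diff_left inner_add_left inner_commute[of V U])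
    then show ?thesis using z z' by (simp add: abs_le_iff)
  qed
  have axis: "plane_point (1 / 2) (1 / 2 + c) + (t - 1 / 2) *\<^sub>R plane_point (1 / sqrt (1 + m\<^sup>2)) (m / sqrt (1 + m\<^sup>2))
      \<in> centred_strip \<delta> 1 m c" if "0 \<le> t" "t \<le> 1" for t m c
    unfolding centred_strip_def Let_def using that d
    by (intro CollectI exI[of _ "\<delta> / 2"] exI[of _ t]) (auto simp: algebra_simps)
  have centre: "plane_point (1 / 2) (1 / 2 + c) \<in> centred_strip \<delta> 1 m c" for m c
    using axis[of "1 / 2" c m] by simp
  have slope: "\<bar>U $ 1 + m * U $ 2\<bar> \<le> 6 / 5 * w"
    if "centred_strip \<delta> 1 m c \<subseteq> R" "0 \<le> m" "m \<le> 1 / 2" for m c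
  proof -
    define n where "n = sqrt (1 + m\<^sup>2)"
    have n1: "1 \<le> n" by (simp add: n_def)
    have "m\<^sup>2 \<le> (1 / 2)\<^sup>2" using that by (intro power_mono) auto
    then have "n \<le> 6 / 5" unfolding n_def by (intro real_le_lsqrt) (auto simp: power2_eq_square)
    let ?v = "plane_point (1 / n) (m / n)"
    have "\<bar>((plane_point (1 / 2) (1 / 2 + c) + (1 - 1 / 2) *\<^sub>R ?v)
          - (plane_point (1 / 2) (1 / 2 + c) + (0 - 1 / 2) *\<^sub>R ?v)) \<bullet> U\<bar> \<le> w"
      using axis[of 1 c m] axis[of 0 c m] that unfolding n_def by (intro width) auto
    also have "(plane_point (1 / 2) (1 / 2 + c) + (1 - 1 / 2) *\<^sub>R ?v)
          - (plane_point (1 / 2) (1 / 2 + c) + (0 - 1 / 2) *\<^sub>R ?v) = ?v"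
      by (simp add: vec_eq_coords[OF coords_12])
    also have "?v \<bullet> U = (U $ 1 + m * U $ 2) / n"
      by (simp add: inner_coords[OF coords_12] add_divide_distrib)
    finally have "\<bar>U $ 1 + m * U $ 2\<bar> \<le> w * n" using n1 by (simp add: abs_divide field_simps)
    also have "\<dots> \<le> w * (6 / 5)" using \<open>n \<le> 6 / 5\<close> R(2) by (intro mult_left_mono) auto
    finally show ?thesis by simp
  qed
  have s1: "\<bar>U $ 1 + m * U $ 2\<bar> \<le> 6 / 5 * w" and s2: "\<bar>U $ 1 + m' * U $ 2\<bar> \<le> 6 / 5 * w"
    using slope sub m by auto
  have "\<bar>(plane_point (1 / 2) (1 / 2 + c') - plane_point (1 / 2) (1 / 2 + c)) \<bullet> U\<bar> \<le> w"
    using centre[of c m] centre[of c' m'] sub by (intro width) auto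
  then have cc: "\<bar>c' - c\<bar> * \<bar>U $ 2\<bar> \<le> w" by (simp add: inner_coords[OF coords_12] abs_mult)
  have "(m' - m) * U $ 2 = (U $ 1 + m' * U $ 2) - (U $ 1 + m * U $ 2)" by (simp add: algebra_simps)
  then have "\<bar>(m' - m) * U $ 2\<bar> \<le> 12 / 5 * w" using s1 s2 by linarith
  then have mm: "\<bar>m' - m\<bar> * \<bar>U $ 2\<bar> \<le> 12 / 5 * w" by (simp add: abs_mult)
  show ?thesis
  proof (cases "1 / 2 \<le> \<bar>U $ 2\<bar>")
    case True
    have "\<bar>c' - c\<bar> * (1 / 2) \<le> \<bar>c' - c\<bar> * \<bar>U $ 2\<bar>" "\<bar>m' - m\<bar> * (1 / 2) \<le> \<bar>m' - m\<bar> * \<bar>U $ 2\<bar>"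
      using True by (intro mult_left_mono; simp)+
    then show ?thesis using cc mm R(2) by (intro conjI; linarith)
  next
    case False
    have "1 \<le> \<bar>U $ 1\<bar> + \<bar>U $ 2\<bar>" using norm_le_coords[OF coords_12, of U] UV(1) by simp
    moreover have "\<bar>m * U $ 2\<bar> \<le> 1 / 2 * \<bar>U $ 2\<bar>" unfolding abs_mult using m by (intro mult_right_mono) auto
    ultimately have "1 / 5 \<le> w" using False s1 by linarith
    then show ?thesis using m c by (intro conjI; linarith)
  qed
qed

lemma balls_of_dim_spaced:
  assumes sp: "dim_spaced \<delta> \<beta> K S x y" and d: "0 < \<delta>" "\<delta> \<le> 1 / 16"
    and b: "\<And>s. s \<in> S \<Longrightarrow> \<bar>x s\<bar> \<le> 1 / 4" "\<And>s. s \<in> S \<Longrightarrow> \<bar>y s\<bar> \<le> 1 / 4"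
  shows "ball_set \<delta> \<beta> K ((\<lambda>s. centred_ball \<delta> (x s) (y s)) ` S)"
  unfolding ball_set_def
proof (intro conjI allI impI ballI)
  let ?P = "(\<lambda>s. centred_ball \<delta> (x s) (y s)) ` S"
  have finS: "finite S" using sp by (rule dim_spaced_finite)
  fix p assume p: "p \<in> ?P"
  then show "is_ball \<delta> p" by (auto simp: is_ball_def centred_ball_def)
  show "p \<subseteq> unit_square" using p b d centred_ball_subset by blast
next
  let ?P = "(\<lambda>s. centred_ball \<delta> (x s) (y s)) ` S"
  have finS: "finite S" using sp by (rule dim_spaced_finite)
  fix w B assume w: "\<delta> \<le> w \<and> w \<le> 1 \<and> is_ball w B"
  then obtain q where B: "B = cball q w" by (auto simp: is_ball_def)
  show "finite {p\<in>?P. p \<subseteq> B}" using finS by auto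
  define A where "A = {s\<in>S. centred_ball \<delta> (x s) (y s) \<subseteq> B}"
  have "{p\<in>?P. p \<subseteq> B} = (\<lambda>s. centred_ball \<delta> (x s) (y s)) ` A" by (auto simp: A_def)
  then have "card {p\<in>?P. p \<subseteq> B} \<le> card A" using finS by (simp add: A_def card_image_le)
  also have "real (card A) \<le> K * (w / \<delta>) powr \<beta>"
  proof (rule dim_spacedD[OF sp])
    show "A \<subseteq> {s\<in>S. \<bar>x s - (q $ 1 - 1 / 2)\<bar> \<le> w \<and> \<bar>y s - (q $ 2 - 1 / 2)\<bar> \<le> w}"
    proof
      fix s assume s: "s \<in> A"
      have "plane_point (1 / 2 + x s) (1 / 2 + y s) \<in> centred_ball \<delta> (x s) (y s)"
        using d by (simp add: centred_ball_def)
      then have "norm (q - plane_point (1 / 2 + x s) (1 / 2 + y s)) \<le> w"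
        using s B by (auto simp: A_def dist_norm)
      then have "\<bar>(q - plane_point (1 / 2 + x s) (1 / 2 + y s)) $ k\<bar> \<le> w" for k
        using component_le_norm_cart[of "q - plane_point (1 / 2 + x s) (1 / 2 + y s)" k] by linarith
      from this[of 1] this[of 2]
      show "s \<in> {s\<in>S. \<bar>x s - (q $ 1 - 1 / 2)\<bar> \<le> w \<and> \<bar>y s - (q $ 2 - 1 / 2)\<bar> \<le> w}"
        using s by (auto simp: A_def abs_le_iff)
    qed
  qed (use w in auto)
  finally show "real (card {p\<in>?P. p \<subseteq> B}) \<le> K * (w / \<delta>) powr \<beta>" by simp
qed

lemma strips_in_rectangle_count:
  assumes sp: "dim_spaced \<delta> \<alpha> K S m c" and d: "0 < \<delta>" and a: "0 \<le> \<alpha>" "\<alpha> \<le> 2" "0 \<le> K"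
    and b: "\<And>s. s \<in> S \<Longrightarrow> 1 / 4 \<le> m s" "\<And>s. s \<in> S \<Longrightarrow> m s \<le> 1 / 2" "\<And>s. s \<in> S \<Longrightarrow> \<bar>c s\<bar> \<le> 1 / 8"
    and R: "is_rectangle w 2 R" "\<delta> \<le> w"
  shows "real (card {s\<in>S. centred_strip \<delta> 1 (m s) (c s) \<subseteq> R}) \<le> 25 * K * (w / \<delta>) powr \<alpha>"
proof (cases "{s\<in>S. centred_strip \<delta> 1 (m s) (c s) \<subseteq> R} = {}")
  case False
  then obtain s\<^sub>0 where s0: "s\<^sub>0 \<in> S" "centred_strip \<delta> 1 (m s\<^sub>0) (c s\<^sub>0) \<subseteq> R" by auto
  have "{s\<in>S. centred_strip \<delta> 1 (m s) (c s) \<subseteq> R}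
      \<subseteq> {s\<in>S. \<bar>m s - m s\<^sub>0\<bar> \<le> 5 * w \<and> \<bar>c s - c s\<^sub>0\<bar> \<le> 5 * w}"
    using strips_in_common_rectangle[OF R(1) _ s0(2) _ d] s0 b d R(2) by auto
  then have "real (card {s\<in>S. centred_strip \<delta> 1 (m s) (c s) \<subseteq> R}) \<le> 5\<^sup>2 * K * (w / \<delta>) powr \<alpha>"
    using a d R by (intro dim_spaced_scaled[OF sp]) auto
  then show ?thesis by simp
next
  case True
  then show ?thesis using a by (simp only: card.empty) simp
qed

lemma tubes_of_dim_spaced:
  assumes sp: "dim_spaced \<delta> \<alpha> K S m c" and d: "0 < \<delta>" "\<delta> \<le> 1 / 16" and a: "0 \<le> \<alpha>" "\<alpha> \<le> 2" "0 \<le> K"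
    and b: "\<And>s. s \<in> S \<Longrightarrow> 1 / 4 \<le> m s" "\<And>s. s \<in> S \<Longrightarrow> m s \<le> 1 / 2" "\<And>s. s \<in> S \<Longrightarrow> \<bar>c s\<bar> \<le> 1 / 8"
  shows "tube_set \<delta> \<alpha> (25 * K) ((\<lambda>s. centred_strip \<delta> 1 (m s) (c s)) ` S)"
  unfolding tube_set_def
proof (intro conjI allI impI ballI)
  let ?T = "(\<lambda>s. centred_strip \<delta> 1 (m s) (c s)) ` S"
  fix t assume t: "t \<in> ?T"
  then show "is_tube \<delta> t" using is_rectangle_centred_strip by auto
  show "t \<subseteq> unit_square" using t b d centred_strip_subset by blast
next
  let ?T = "(\<lambda>s. centred_strip \<delta> 1 (m s) (c s)) ` S"
  have finS: "finite S" using sp by (rule dim_spaced_finite)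
  fix w R assume w: "\<delta> \<le> w \<and> w \<le> 1 \<and> is_rectangle w 2 R"
  show "finite {t\<in>?T. t \<subseteq> R}" using finS by auto
  have "{t\<in>?T. t \<subseteq> R} = (\<lambda>s. centred_strip \<delta> 1 (m s) (c s)) ` {s\<in>S. centred_strip \<delta> 1 (m s) (c s) \<subseteq> R}"
    by auto
  then have "card {t\<in>?T. t \<subseteq> R} \<le> card {s\<in>S. centred_strip \<delta> 1 (m s) (c s) \<subseteq> R}"
    using finS by (simp add: card_image_le)
  also have "real (card {s\<in>S. centred_strip \<delta> 1 (m s) (c s) \<subseteq> R}) \<le> 25 * K * (w / \<delta>) powr \<alpha>"
    using w by (intro strips_in_rectangle_count[OF sp d(1) a b]) auto
  finally show "real (card {t\<in>?T. t \<subseteq> R}) \<le> 25 * K * (w / \<delta>) powr \<alpha>" by simp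
qed

lemma incidences_of_dim_spaced:
  assumes P: "dim_spaced \<delta> \<beta> K S x y" and T: "dim_spaced \<delta> \<alpha> K R m c"
    and d: "0 < \<delta>" "\<delta> \<le> 1 / 16" and a: "0 \<le> \<alpha>" "\<alpha> \<le> 2" "0 \<le> K"
    and bP: "\<And>s. s \<in> S \<Longrightarrow> \<bar>x s\<bar> \<le> 1 / 4"
    and bT: "\<And>s. s \<in> R \<Longrightarrow> 1 / 4 \<le> m s" "\<And>s. s \<in> R \<Longrightarrow> m s \<le> 1 / 2" "\<And>s. s \<in> R \<Longrightarrow> \<bar>c s\<bar> \<le> 1 / 8"
  shows "real (card (near_pairs \<delta> S x y R m c)) \<le> (25 * K\<^sup>2) *
     real (incidences ((\<lambda>s. centred_ball \<delta> (x s) (y s)) ` S) ((\<lambda>s. centred_strip \<delta> 1 (m s) (c s)) ` R))"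
proof -
  define F where "F = (\<lambda>(s, r). (centred_ball \<delta> (x s) (y s), centred_strip \<delta> 1 (m r) (c r)))"
  define A where "A = near_pairs \<delta> S x y R m c"
  have finS: "finite S" "finite R" using P T by (auto dest: dim_spaced_finite)
  have finA: "finite A" using finS by (simp add: A_def finite_near_pairs)
  have fibre: "real (card {a\<in>A. F a = F (s, r)}) \<le> 25 * K\<^sup>2" if sr: "s \<in> S" "r \<in> R" for s r
  proof -
    define S' where "S' = {s'\<in>S. centred_ball \<delta> (x s') (y s') = centred_ball \<delta> (x s) (y s)}"
    define R' where "R' = {r'\<in>R. centred_strip \<delta> 1 (m r') (c r') = centred_strip \<delta> 1 (m r) (c r)}"
    have fin: "finite S'" "finite R'" using finS by (auto simp: S'_def R'_def)
    have "{a\<in>A. F a = F (s, r)} \<subseteq> S' \<times> R'" by (auto simp: A_def near_pairs_def F_def S'_def R'_def)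
    then have "card {a\<in>A. F a = F (s, r)} \<le> card (S' \<times> R')" using fin by (intro card_mono) auto
    then have 1: "real (card {a\<in>A. F a = F (s, r)}) \<le> real (card S') * real (card R')"
      by (simp add: card_cartesian_product flip: of_nat_mult)
    have "real (card S') \<le> K * (\<delta> / \<delta>) powr \<beta>"
    proof (rule dim_spacedD[OF P])
      show "S' \<subseteq> {s'\<in>S. \<bar>x s' - x s\<bar> \<le> \<delta> \<and> \<bar>y s' - y s\<bar> \<le> \<delta>}"
      proof
        fix s' assume s': "s' \<in> S'"
        then have "plane_point (1 / 2 + x s') (1 / 2 + y s') = plane_point (1 / 2 + x s) (1 / 2 + y s)"
          using d by (auto simp: S'_def centred_ball_def cball_eq_cball_iff)
        then have "x s' = x s" "y s' = y s" by (auto simp: vec_eq_coords[OF coords_12])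
        then show "s' \<in> {s'\<in>S. \<bar>x s' - x s\<bar> \<le> \<delta> \<and> \<bar>y s' - y s\<bar> \<le> \<delta>}" using s' d by (auto simp: S'_def)
      qed
    qed simp
    then have cS: "real (card S') \<le> K" using d by simp
    let ?Q = "centred_strip \<delta> 2 (m r) (c r)"
    have "R' \<subseteq> {r'\<in>R. centred_strip \<delta> 1 (m r') (c r') \<subseteq> ?Q}"
      using centred_strip_mono[of 1 2 \<delta> "m r" "c r"] by (auto simp: R'_def)
    then have "card R' \<le> card {r'\<in>R. centred_strip \<delta> 1 (m r') (c r') \<subseteq> ?Q}"
      using finS by (intro card_mono) auto
    also have "real \<dots> \<le> 25 * K * (\<delta> / \<delta>) powr \<alpha>"
      using is_rectangle_centred_strip by (intro strips_in_rectangle_count[OF T d(1) a bT]) auto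
    finally have cR: "real (card R') \<le> 25 * K" using d by simp
    have "real (card S') * real (card R') \<le> K * (25 * K)" using cS cR a by (intro mult_mono) auto
    then show ?thesis using 1 by (simp add: power2_eq_square)
  qed
  have "real (card A) \<le> (25 * K\<^sup>2) * real (card (F ` A))"
  proof (rule card_le_fibre_bound[OF finA])
    fix b assume "b \<in> F ` A"
    then obtain s r where "b = F (s, r)" "s \<in> S" "r \<in> R" by (auto simp: A_def near_pairs_def)
    then show "real (card {a\<in>A. F a = b}) \<le> 25 * K\<^sup>2" using fibre by simp
  qed
  also have "card (F ` A) \<le> incidences ((\<lambda>s. centred_ball \<delta> (x s) (y s)) ` S)
      ((\<lambda>s. centred_strip \<delta> 1 (m s) (c s)) ` R)"
    unfolding incidences_def
  proof (intro card_mono)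
    show "F ` A \<subseteq> {(p, t). p \<in> (\<lambda>s. centred_ball \<delta> (x s) (y s)) ` S \<and>
        t \<in> (\<lambda>s. centred_strip \<delta> 1 (m s) (c s)) ` R \<and> p \<inter> t \<noteq> {}}"
    proof
      fix b assume "b \<in> F ` A"
      then obtain s r where b: "b = F (s, r)" "s \<in> S" "r \<in> R" "\<bar>y s - m r * x s - c r\<bar> \<le> \<delta>"
        by (auto simp: A_def near_pairs_def)
      then have "centred_ball \<delta> (x s) (y s) \<inter> centred_strip \<delta> 1 (m r) (c r) \<noteq> {}"
        using ball_meets_strip[OF bP bT(1,2) d(1)] by blast
      then show "b \<in> {(p, t). p \<in> (\<lambda>s. centred_ball \<delta> (x s) (y s)) ` S \<and>
        t \<in> (\<lambda>s. centred_strip \<delta> 1 (m s) (c s)) ` R \<and> p \<inter> t \<noteq> {}}" using b by (auto simp: F_def)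
    qed
    show "finite {(p, t). p \<in> (\<lambda>s. centred_ball \<delta> (x s) (y s)) ` S \<and>
        t \<in> (\<lambda>s. centred_strip \<delta> 1 (m s) (c s)) ` R \<and> p \<inter> t \<noteq> {}}"
      by (rule finite_subset[where B = "(\<lambda>s. centred_ball \<delta> (x s) (y s)) ` S \<times> (\<lambda>s. centred_strip \<delta> 1 (m s) (c s)) ` R"])
        (use finS in auto)
  qed
  finally show ?thesis by (simp add: A_def mult_left_mono)
qed

text \<open>The lower bound of the theorem with a free exponent e. It is monotone in \<alpha> and \<beta>, which
reduces the extreme ranges of these to their boundary.\<close>

definition sharp :: "real \<Rightarrow> real \<Rightarrow> real \<Rightarrow> bool" where
  "sharp \<alpha> \<beta> e \<longleftrightarrow> (\<exists>K\<ge>1. \<exists>c\<^sub>0>0. \<exists>\<delta>\<^sub>0>0. \<forall>\<delta>. 0 < \<delta> \<and> \<delta> < \<delta>\<^sub>0 \<longrightarrow>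
     (\<exists>P T. ball_set \<delta> \<beta> K P \<and> tube_set \<delta> \<alpha> K T \<and>
        real (incidences P T) \<ge> c\<^sub>0 * \<delta> powr - e))"

lemma sharpI:
  assumes "1 \<le> K" "0 < c\<^sub>0" "0 < \<delta>\<^sub>0"
    and "\<And>\<delta>. 0 < \<delta> \<Longrightarrow> \<delta> < \<delta>\<^sub>0 \<Longrightarrow> \<exists>P T. ball_set \<delta> \<beta> K P \<and> tube_set \<delta> \<alpha> K T \<and>
        real (incidences P T) \<ge> c\<^sub>0 * \<delta> powr - e"
  shows "sharp \<alpha> \<beta> e"
  using assms unfolding sharp_def by blast

lemma powr_count_mono:
  fixes X K K' w \<delta> \<gamma> \<gamma>' :: real
  assumes "X \<le> K * (w / \<delta>) powr \<gamma>" "0 < \<delta>" "\<delta> \<le> w" "\<gamma> \<le> \<gamma>'" "0 \<le> K" "K \<le> K'"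
  shows "X \<le> K' * (w / \<delta>) powr \<gamma>'"
proof -
  have "K * (w / \<delta>) powr \<gamma> \<le> K' * (w / \<delta>) powr \<gamma>'"
    using assms by (intro mult_mono powr_mono) auto
  then show ?thesis using assms(1) by linarith
qed

lemma ball_set_mono:
  assumes "ball_set \<delta> \<beta> K P" "0 < \<delta>" "\<beta> \<le> \<beta>'" "0 \<le> K" "K \<le> K'"
  shows "ball_set \<delta> \<beta>' K' P"
  using assms unfolding ball_set_def by (blast intro: powr_count_mono)

lemma tube_set_mono:
  assumes "tube_set \<delta> \<alpha> K T" "0 < \<delta>" "\<alpha> \<le> \<alpha>'" "0 \<le> K" "K \<le> K'"
  shows "tube_set \<delta> \<alpha>' K' T"
  using assms unfolding tube_set_def by (blast intro: powr_count_mono)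

lemma sharp_mono:
  assumes "sharp \<alpha> \<beta> e" "\<alpha> \<le> \<alpha>'" "\<beta> \<le> \<beta>'"
  shows "sharp \<alpha>' \<beta>' e"
proof -
  obtain K c\<^sub>0 \<delta>\<^sub>0 where K: "1 \<le> K" "0 < c\<^sub>0" "0 < \<delta>\<^sub>0"
    and ex: "\<And>\<delta>. 0 < \<delta> \<Longrightarrow> \<delta> < \<delta>\<^sub>0 \<Longrightarrow> \<exists>P T. ball_set \<delta> \<beta> K P \<and> tube_set \<delta> \<alpha> K T \<and>
        real (incidences P T) \<ge> c\<^sub>0 * \<delta> powr - e"
    using assms(1) unfolding sharp_def by blast
  have "\<exists>P T. ball_set \<delta> \<beta>' K P \<and> tube_set \<delta> \<alpha>' K T \<and> real (incidences P T) \<ge> c\<^sub>0 * \<delta> powr - e"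
    if d: "0 < \<delta>" "\<delta> < \<delta>\<^sub>0" for \<delta>
  proof -
    obtain P T where "ball_set \<delta> \<beta> K P" "tube_set \<delta> \<alpha> K T" "real (incidences P T) \<ge> c\<^sub>0 * \<delta> powr - e"
      using ex[OF d] by blast
    then show ?thesis using ball_set_mono[of \<delta> \<beta> K P \<beta>' K] tube_set_mono[of \<delta> \<alpha> K T \<alpha>' K] assms K d by auto
  qed
  then show ?thesis unfolding sharp_def using K by blast
qed

lemma sharp_of_coordinates:
  fixes \<alpha> \<beta> e K c\<^sub>0 :: real
  assumes a: "0 \<le> \<alpha>" "\<alpha> \<le> 2" and K: "1 \<le> K" "0 < c\<^sub>0"
    and ex: "\<And>\<delta>. 0 < \<delta> \<Longrightarrow> \<delta> \<le> 1 / 16 \<Longrightarrow> \<exists>(S :: 'a set) x y (R :: 'b set) m c.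
      dim_spaced \<delta> \<beta> K S x y \<and> dim_spaced \<delta> \<alpha> K R m c \<and>
      (\<forall>s\<in>S. \<bar>x s\<bar> \<le> 1 / 4 \<and> \<bar>y s\<bar> \<le> 1 / 4) \<and> (\<forall>t\<in>R. 1 / 4 \<le> m t \<and> m t \<le> 1 / 2 \<and> \<bar>c t\<bar> \<le> 1 / 8) \<and>
      real (card (near_pairs \<delta> S x y R m c)) \<ge> c\<^sub>0 * \<delta> powr - e"
  shows "sharp \<alpha> \<beta> e"
proof (rule sharpI[where K = "25 * K" and c\<^sub>0 = "c\<^sub>0 / (25 * K\<^sup>2)" and \<delta>\<^sub>0 = "1 / 16"])
  fix \<delta> :: real assume "0 < \<delta>" "\<delta> < 1 / 16"
  then have d: "0 < \<delta>" "\<delta> \<le> 1 / 16" by auto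
  obtain S :: "'a set" and x y and R :: "'b set" and m c where
    P: "dim_spaced \<delta> \<beta> K S x y" and T: "dim_spaced \<delta> \<alpha> K R m c"
    and bP: "\<And>s. s \<in> S \<Longrightarrow> \<bar>x s\<bar> \<le> 1 / 4" "\<And>s. s \<in> S \<Longrightarrow> \<bar>y s\<bar> \<le> 1 / 4"
    and bT: "\<And>t. t \<in> R \<Longrightarrow> 1 / 4 \<le> m t" "\<And>t. t \<in> R \<Longrightarrow> m t \<le> 1 / 2" "\<And>t. t \<in> R \<Longrightarrow> \<bar>c t\<bar> \<le> 1 / 8"
    and I: "real (card (near_pairs \<delta> S x y R m c)) \<ge> c\<^sub>0 * \<delta> powr - e"
    using ex[OF d] by blast
  let ?P = "(\<lambda>s. centred_ball \<delta> (x s) (y s)) ` S"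
  let ?T = "(\<lambda>s. centred_strip \<delta> 1 (m s) (c s)) ` R"
  have K0: "0 \<le> K" using K by simp
  have "ball_set \<delta> \<beta> (25 * K) ?P"
    using balls_of_dim_spaced[OF P d bP] d K by (intro ball_set_mono[of \<delta> \<beta> K _ \<beta> "25 * K"]) auto
  moreover have "tube_set \<delta> \<alpha> (25 * K) ?T" by (rule tubes_of_dim_spaced[OF T d a K0 bT])
  moreover have "c\<^sub>0 / (25 * K\<^sup>2) * \<delta> powr - e \<le> real (incidences ?P ?T)"
  proof -
    have "c\<^sub>0 * \<delta> powr - e \<le> (25 * K\<^sup>2) * real (incidences ?P ?T)"
      using incidences_of_dim_spaced[OF P T d a K0 bP(1) bT] I by linarith
    then show ?thesis using K by (simp add: field_simps)
  qed
  ultimately show "\<exists>P T. ball_set \<delta> \<beta> (25 * K) P \<and> tube_set \<delta> \<alpha> (25 * K) T \<and>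
      c\<^sub>0 / (25 * K\<^sup>2) * \<delta> powr - e \<le> real (incidences P T)" by blast
qed (use K in auto)

lemma half_powr_nfloor:
  assumes "0 < \<delta>" "\<delta> \<le> 1" "0 \<le> e"
  shows "1 \<le> nfloor (\<delta> powr - e)" "real (nfloor (\<delta> powr - e)) \<le> \<delta> powr - e"
    "\<delta> powr - e / 2 \<le> real (nfloor (\<delta> powr - e))"
proof -
  have "\<delta> powr 0 \<le> \<delta> powr - e" using assms by (intro powr_mono') auto
  then have "1 \<le> \<delta> powr - e" using assms by simp
  then show "1 \<le> nfloor (\<delta> powr - e)" "real (nfloor (\<delta> powr - e)) \<le> \<delta> powr - e"
    "\<delta> powr - e / 2 \<le> real (nfloor (\<delta> powr - e))"
    by (rule nfloor_bounds)+
qed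

section \<open>Extremal configurations\<close>

text \<open>With \<open>\<rho> = \<delta> powr r\<close>, each bush has its centre at an abscissa X i and has slope
1/4 + M k. Its balls are displaced by s along the line, and its tubes pass through the centre with an
additional slope q, so that a ball is off a tube by s q, at most \<open>\<rho> *
(\<delta>/\<rho>)\<close>. The height of the centre is M k, an increasing function of the slope: the
segments of different bushes over the same abscissa then diverge, which keeps the balls spread out, and
dually for the tubes. The two equations for \<nu> say that the number of bushes, about \<open>\<delta>
powr -\<nu>\<close>, exhausts what is permitted for the balls and for the tubes. The denominators 8 and
16 keep all balls and tubes inside the unit square.\<close>

lemma sharp_bushes:
  fixes \<alpha> \<beta> r \<nu> :: real
  assumes a: "0 \<le> \<alpha>" "\<alpha> \<le> 2" and b: "0 \<le> \<beta>" "\<beta> \<le> 2" and r: "0 \<le> r" "r \<le> 1"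
    and nu: "\<nu> = \<alpha> - min \<alpha> 1 * r" "\<nu> = \<beta> - min \<beta> 1 * (1 - r)" "\<nu> \<le> 1"
  shows "sharp \<alpha> \<beta> (\<alpha> + min \<beta> 1 * (1 - r))"
proof (rule sharp_of_coordinates[OF a, where K = 160000 and c\<^sub>0 = "1 / 16" and 'a = "nat \<times> nat \<times> nat" and 'b = "nat \<times> nat \<times> nat"])
  fix \<delta> :: real assume d: "0 < \<delta>" "\<delta> \<le> 1 / 16"
  have d1: "\<delta> \<le> 1" using d by simp
  have "min \<beta> 1 * (1 - r) \<le> \<beta> * 1" using b r by (intro mult_mono) auto
  then have nu0: "0 \<le> \<nu>" using nu by simp
  have e0: "0 \<le> r * \<nu>" "0 \<le> (1 - r) * \<nu>" "0 \<le> (1 - r) * min \<beta> 1" "0 \<le> r * min \<alpha> 1"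
    using r nu0 a b by auto
  define n where "n = nfloor (\<delta> powr - (r * \<nu>))"
  define n' where "n' = nfloor (\<delta> powr - ((1 - r) * \<nu>))"
  define L where "L = nfloor (\<delta> powr - ((1 - r) * min \<beta> 1))"
  define L' where "L' = nfloor (\<delta> powr - (r * min \<alpha> 1))"
  note nb = half_powr_nfloor[OF d(1) d1 e0(1), folded n_def]
  note n'b = half_powr_nfloor[OF d(1) d1 e0(2), folded n'_def]
  note Lb = half_powr_nfloor[OF d(1) d1 e0(3), folded L_def]
  note L'b = half_powr_nfloor[OF d(1) d1 e0(4), folded L'_def]
  define \<rho> where "\<rho> = \<delta> powr r"
  define \<sigma> where "\<sigma> = \<delta> powr (1 - r)"
  have rs: "0 < \<rho>" "\<rho> \<le> 1" "0 < \<sigma>" "\<sigma> \<le> 1" "\<rho> * \<sigma> = \<delta>"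
    using d d1 r by (auto simp: \<rho>_def \<sigma>_def intro!: powr_le1 simp flip: powr_add)
  define X where "X i = real i / (8 * real n)" for i :: nat
  define M where "M k = real k / (8 * real n')" for k :: nat
  define s where "s l = \<rho> * real l / (16 * real L)" for l :: nat
  define q where "q l = \<sigma> * real l / (16 * real L')" for l :: nat
  have X: "0 \<le> X i" "X i \<le> 1 / 8" if "i < n" for i using that by (auto simp: X_def field_simps)
  have M: "0 \<le> M k" "M k \<le> 1 / 8" if "k < n'" for k using that by (auto simp: M_def field_simps)
  have s: "0 \<le> s l" "s l \<le> \<rho> / 16" "s l \<le> 1 / 16" if "l < L" for l
  proof -
    have "\<rho> * real l \<le> \<rho> * real L" using that rs by (intro mult_left_mono) auto
    then show "0 \<le> s l" "s l \<le> \<rho> / 16" using that rs by (auto simp: s_def field_simps)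
    then show "s l \<le> 1 / 16" using rs by linarith
  qed
  have q: "0 \<le> q l" "q l \<le> \<sigma> / 16" "q l \<le> 1 / 16" if "l < L'" for l
  proof -
    have "\<sigma> * real l \<le> \<sigma> * real L'" using that rs by (intro mult_left_mono) auto
    then show "0 \<le> q l" "q l \<le> \<sigma> / 16" using that rs by (auto simp: q_def field_simps)
    then show "q l \<le> 1 / 16" using rs by linarith
  qed
  define x where "x = (\<lambda>(i, k :: nat, l). X i + s l)"
  define y where "y = (\<lambda>(i :: nat, k, l). M k + (1 / 4 + M k) * s l)"
  define m where "m = (\<lambda>(k, i :: nat, l). 1 / 4 + M k + q l)"
  define c where "c = (\<lambda>(k, i, l). M k - (1 / 4 + M k + q l) * X i)"
  have P: "dim_spaced \<delta> \<beta> 160000 (grid n n' L) x y"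
  proof (rule grid_dim_spaced_powers[OF d(1) d1 b r nu(2,3) nb(1) n'b(1) Lb(1) nb(2) n'b(2) Lb(2)])
    show "x (i, k, l) = 0 + real i / (8 * real n) + \<delta> powr r * real l / (16 * real L)" for i k l
      by (simp add: x_def X_def s_def \<rho>_def)
    show "y (i, k, l) = s l / 4 + (1 + s l) / 8 * (real k / real n')" for i k l
      by (simp add: y_def M_def add_divide_distrib algebra_simps)
    show "1 / 128 \<le> \<bar>(1 + s l) / 8\<bar>" if "l < L" for l
      using s[OF that] by (intro order_trans[OF _ abs_ge_self]) simp
  qed
  have T: "dim_spaced \<delta> \<alpha> 160000 (grid n' n L') m c"
  proof (rule grid_dim_spaced_powers[where r = "1 - r" and \<nu> = \<nu>, OF d(1) d1 a _ _ _ nu(3) n'b(1) nb(1) L'b(1)])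
    show "m (k, i, l) = 1 / 4 + real k / (8 * real n') + \<delta> powr (1 - r) * real l / (16 * real L')" for i k l
      by (simp add: m_def M_def q_def \<sigma>_def)
    show "c (k, i, l) = M k + (- ((1 / 4 + M k + q l) / 8)) * (real i / real n)" for i k l
      by (simp add: c_def X_def)
    show "1 / 128 \<le> \<bar>- ((1 / 4 + M k + q l) / 8)\<bar>" if "k < n'" "l < L'" for k l
      using M[OF that(1)] q[OF that(2)] by (intro order_trans[OF _ abs_ge_minus_self]) simp
  qed (use r nu nb(2) n'b(2) L'b(2) in auto)
  have bP: "\<bar>x t\<bar> \<le> 1 / 4 \<and> \<bar>y t\<bar> \<le> 1 / 4" if tg: "t \<in> grid n n' L" for t
  proof -
    obtain i k l where t: "t = (i, k, l)" "i < n" "k < n'" "l < L" using tg by (cases t) (auto simp: grid_def)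
    have "\<bar>(1 / 4 + M k) * s l\<bar> \<le> (3 / 8) * (1 / 16)"
      unfolding abs_mult using M[OF t(3)] s[OF t(4)] by (intro mult_mono) auto
    then show ?thesis using X[OF t(2)] M[OF t(3)] s[OF t(4)] unfolding t(1) x_def y_def by simp
  qed
  have bT: "1 / 4 \<le> m t \<and> m t \<le> 1 / 2 \<and> \<bar>c t\<bar> \<le> 1 / 8" if tg: "t \<in> grid n' n L'" for t
  proof -
    obtain i k l where t: "t = (k, i, l)" "i < n" "k < n'" "l < L'" using tg by (cases t) (auto simp: grid_def)
    have "(1 / 4 + M k + q l) * X i \<le> (1 / 2) * (1 / 8)" "0 \<le> (1 / 4 + M k + q l) * X i"
      using M[OF t(3)] q[OF t(4)] X[OF t(2)] by (intro mult_mono mult_nonneg_nonneg; simp)+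
    then have "\<bar>M k - (1 / 4 + M k + q l) * X i\<bar> \<le> 1 / 8" using M[OF t(3)] by linarith
    then show ?thesis using M[OF t(3)] q[OF t(4)] unfolding t(1) m_def c_def by simp
  qed
  define F where "F = (\<lambda>(i :: nat, k :: nat, l :: nat, l' :: nat). ((i, k, l), (k, i, l')))"
  define Q where "Q = {..<n} \<times> {..<n'} \<times> {..<L} \<times> {..<L'}"
  have "F ` Q \<subseteq> near_pairs \<delta> (grid n n' L) x y (grid n' n L') m c"
  proof
    fix z assume "z \<in> F ` Q"
    then obtain i k l l' where z: "z = ((i, k, l), (k, i, l'))" and t: "i < n" "k < n'" "l < L" "l' < L'"
      by (auto simp: F_def Q_def)
    have "y (i, k, l) - m (k, i, l') * x (i, k, l) - c (k, i, l') = - (q l' * s l)"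
      by (simp add: x_def y_def m_def c_def algebra_simps)
    moreover have "q l' * s l \<le> (\<sigma> / 16) * (\<rho> / 16)" using q[OF t(4)] s[OF t(3)] rs by (intro mult_mono) auto
    moreover have "(\<sigma> / 16) * (\<rho> / 16) \<le> \<delta>" using rs d by (simp add: mult.commute)
    moreover have "0 \<le> q l' * s l" using q[OF t(4)] s[OF t(3)] by simp
    ultimately have "\<bar>y (i, k, l) - m (k, i, l') * x (i, k, l) - c (k, i, l')\<bar> \<le> \<delta>" by linarith
    then show "z \<in> near_pairs \<delta> (grid n n' L) x y (grid n' n L') m c"
      using t by (simp add: z near_pairs_def grid_def)
  qed
  then have "card (F ` Q) \<le> card (near_pairs \<delta> (grid n n' L) x y (grid n' n L') m c)"
    by (intro card_mono finite_near_pairs) auto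
  moreover have "inj_on F Q" by (auto simp: inj_on_def F_def)
  then have "card (F ` Q) = n * n' * L * L'" by (simp add: card_image Q_def mult.assoc)
  ultimately have "real (n * n' * L * L') \<le> real (card (near_pairs \<delta> (grid n n' L) x y (grid n' n L') m c))"
    by linarith
  moreover have "1 / 16 * \<delta> powr - (\<alpha> + min \<beta> 1 * (1 - r)) \<le> real (n * n' * L * L')"
  proof -
    have "- (\<alpha> + min \<beta> 1 * (1 - r)) = - (r * \<nu>) + - ((1 - r) * \<nu>) + - ((1 - r) * min \<beta> 1) + - (r * min \<alpha> 1)"
      using nu(1) by (simp add: algebra_simps)
    then have "1 / 16 * \<delta> powr - (\<alpha> + min \<beta> 1 * (1 - r))
      = (\<delta> powr - (r * \<nu>) / 2) * (\<delta> powr - ((1 - r) * \<nu>) / 2) * (\<delta> powr - ((1 - r) * min \<beta> 1) / 2)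
          * (\<delta> powr - (r * min \<alpha> 1) / 2)"
      by (simp only: powr_add)
    also have "\<dots> \<le> real n * real n' * real L * real L'"
      using nb(3) n'b(3) Lb(3) L'b(3) by (intro mult_mono) auto
    finally show ?thesis by simp
  qed
  ultimately have I: "1 / 16 * \<delta> powr - (\<alpha> + min \<beta> 1 * (1 - r))
      \<le> real (card (near_pairs \<delta> (grid n n' L) x y (grid n' n L') m c))" by linarith
  show "\<exists>(S :: (nat \<times> nat \<times> nat) set) x y (R :: (nat \<times> nat \<times> nat) set) m c.
      dim_spaced \<delta> \<beta> 160000 S x y \<and> dim_spaced \<delta> \<alpha> 160000 R m c \<and>
      (\<forall>s\<in>S. \<bar>x s\<bar> \<le> 1 / 4 \<and> \<bar>y s\<bar> \<le> 1 / 4) \<and> (\<forall>t\<in>R. 1 / 4 \<le> m t \<and> m t \<le> 1 / 2 \<and> \<bar>c t\<bar> \<le> 1 / 8) \<and>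
      1 / 16 * \<delta> powr - (\<alpha> + min \<beta> 1 * (1 - r)) \<le> real (card (near_pairs \<delta> S x y R m c))"
    using P T bP bT I by blast
qed auto

text \<open>The balls are a product of an abscissa progression of step about \<delta> with \<open>\<delta> powr (1 -
\<beta>)\<close> rows, and the tubes have slopes in such a progression and \<open>\<delta> powr (1 -
\<alpha>)\<close> intercepts. The heights are chosen so that each line crosses every row above the
progression of abscissas, and it meets a ball where it does.\<close>

lemma sharp_product_grid:
  fixes \<alpha> \<beta> :: real
  assumes a: "1 \<le> \<alpha>" "\<alpha> \<le> 2" and b: "1 \<le> \<beta>" "\<beta> \<le> 2"
  shows "sharp \<alpha> \<beta> (\<alpha> + \<beta> - 1)"
proof (rule sharp_of_coordinates[where K = 160000 and c\<^sub>0 = "1 / 8" and 'a = "nat \<times> nat \<times> nat" and 'b = "nat \<times> nat \<times> nat"])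
  fix \<delta> :: real assume d: "0 < \<delta>" "\<delta> \<le> 1 / 16"
  have d1: "\<delta> \<le> 1" using d by simp
  have a0: "0 \<le> \<alpha>" "0 \<le> \<beta>" using a b by auto
  have e0: "0 \<le> \<beta> - 1" "0 \<le> \<alpha> - 1" "(0 :: real) \<le> 1" using a b by auto
  define N where "N = nfloor (\<delta> powr - (\<beta> - 1))"
  define N' where "N' = nfloor (\<delta> powr - (\<alpha> - 1))"
  define L where "L = nfloor (\<delta> powr - 1)"
  note Nb = half_powr_nfloor[OF d(1) d1 e0(1), folded N_def]
  note N'b = half_powr_nfloor[OF d(1) d1 e0(2), folded N'_def]
  note Lb = half_powr_nfloor[OF d(1) d1 e0(3), folded L_def]
  have L2: "1 / (2 * \<delta>) \<le> real L" using Lb(3) d by (simp add: powr_minus_divide)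
  define X where "X l = real l / (16 * real L)" for l :: nat
  have X: "0 \<le> X l" "X l \<le> 1 / 16" if "l < L" for l using that by (auto simp: X_def field_simps)
  define x where "x = (\<lambda>(i :: nat, k :: nat, l). X l)"
  define y where "y = (\<lambda>(i :: nat, k, l :: nat). 1 / 128 + 1 / 128 * (real k / real N))"
  define m where "m = (\<lambda>(i :: nat, k :: nat, l). 1 / 4 + X l)"
  define c where "c = (\<lambda>(i :: nat, k, l :: nat). 1 / 128 * (real k / real N'))"
  have P: "dim_spaced \<delta> \<beta> 160000 (grid 1 N L) (\<lambda>s. real (fst s) / 8 + x s) y"
    by (rule grid_dim_spaced_powers[where r = 0 and \<nu> = "\<beta> - 1" and u\<^sub>0 = 0 and n = 1 and n' = N and L = L
          and p = "\<lambda>_ _. 1 / 128" and h = "\<lambda>_ _. 1 / 128"])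
      (use d d1 a0 b Nb Lb in \<open>auto simp: x_def X_def y_def\<close>)
  have T: "dim_spaced \<delta> \<alpha> 160000 (grid 1 N' L) (\<lambda>s. real (fst s) / 8 + m s) c"
    by (rule grid_dim_spaced_powers[where r = 0 and \<nu> = "\<alpha> - 1" and u\<^sub>0 = "1 / 4" and n = 1 and n' = N' and L = L
          and p = "\<lambda>_ _. 0" and h = "\<lambda>_ _. 1 / 128"])
      (use d d1 a0 a N'b Lb in \<open>auto simp: m_def X_def c_def\<close>)
  define x' where "x' = (\<lambda>s. real (fst s) / 8 + x s)"
  define m' where "m' = (\<lambda>s. real (fst s) / 8 + m s)"
  have frac: "0 \<le> real k / real J" "real k / real J \<le> 1" "k < J \<Longrightarrow> real k / real J < 1" if "k < J" for k J :: nat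
    using that by auto
  have bP: "\<bar>x' t\<bar> \<le> 1 / 4 \<and> \<bar>y t\<bar> \<le> 1 / 4" if tg: "t \<in> grid 1 N L" for t
  proof -
    obtain k l where t: "t = (0, k, l)" "k < N" "l < L" using tg by (cases t) (auto simp: grid_def)
    show ?thesis using X[OF t(3)] frac[OF t(2)] unfolding t(1) x'_def x_def y_def by simp
  qed
  have bT: "1 / 4 \<le> m' t \<and> m' t \<le> 1 / 2 \<and> \<bar>c t\<bar> \<le> 1 / 8" if tg: "t \<in> grid 1 N' L" for t
  proof -
    obtain k l where t: "t = (0, k, l)" "k < N'" "l < L" using tg by (cases t) (auto simp: grid_def)
    show ?thesis using X[OF t(3)] frac[OF t(2)] unfolding t(1) m'_def m_def c_def by simp
  qed
  define Z where "Z j k l = (1 / 128 + 1 / 128 * (real k / real N) - 1 / 128 * (real j / real N')) / (1 / 4 + X l)"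
    for j k l :: nat
  \<comment> \<open>The line (j, l) crosses row k at abscissa Z j k l, and h j k l is the last grid abscissa before it.\<close>
  define h where "h j k l = nat \<lfloor>Z j k l * (16 * real L)\<rfloor>" for j k l
  define F where "F = (\<lambda>(j, k, l). ((0 :: nat, k, h j k l), (0 :: nat, j, l)))"
  define Q where "Q = {..<N'} \<times> {..<N} \<times> {..<L}"
  have "F ` Q \<subseteq> near_pairs \<delta> (grid 1 N L) x' y (grid 1 N' L) m' c"
  proof
    fix z assume "z \<in> F ` Q"
    then obtain j k l where z: "z = ((0, k, h j k l), (0, j, l))" and t: "j < N'" "k < N" "l < L"
      by (auto simp: F_def Q_def)
    define H where "H = 1 / 128 + 1 / 128 * (real k / real N) - 1 / 128 * (real j / real N')"
    define \<mu> where "\<mu> = 1 / 4 + X l"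
    have mu: "1 / 4 \<le> \<mu>" "\<mu> \<le> 1 / 2" using X[OF t(3)] by (auto simp: \<mu>_def)
    have H: "0 \<le> H" "H < 1 / 64"
      using frac(1)[OF t(1)] frac(2)[OF t(1)] frac(1)[OF t(2)] frac(3)[OF t(2) t(2)] unfolding H_def by linarith+
    have ZH: "Z j k l = H / \<mu>" by (simp add: Z_def H_def \<mu>_def)
    have Z0: "0 \<le> Z j k l" unfolding ZH using H mu by (intro divide_nonneg_nonneg) auto
    have "H / \<mu> \<le> H / (1 / 4)" using H mu by (intro divide_left_mono) auto
    then have "H / \<mu> \<le> 4 * H" by simp
    then have Z1: "Z j k l < 1 / 16" unfolding ZH using H by linarith
    have Lpos: "0 < real L" using Lb(1) by simp
    have h1: "real (h j k l) \<le> Z j k l * (16 * real L)" "Z j k l * (16 * real L) < real (h j k l) + 1"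
      unfolding h_def using Z0 Lpos by auto
    have "Z j k l * (16 * real L) < 1 / 16 * (16 * real L)" using Z1 Lpos by (intro mult_strict_right_mono) auto
    then have hL: "h j k l < L" using h1(1) by simp
    have XZ: "X (h j k l) \<le> Z j k l" "Z j k l \<le> X (h j k l) + 1 / (16 * real L)"
      using h1 Lpos by (auto simp: X_def field_simps)
    have step: "1 / (16 * real L) \<le> \<delta>"
    proof -
      have "1 \<le> real L * (2 * \<delta>)" using L2 d by (simp add: field_simps)
      then show ?thesis using Lpos d by (simp add: field_simps)
    qed
    have eq: "y (0, k, h j k l) - m' (0, j, l) * x' (0, k, h j k l) - c (0, j, l) = \<mu> * (Z j k l - X (h j k l))"
    proof -
      have "\<mu> * Z j k l = H" using mu by (simp add: ZH)
      then show ?thesis by (simp add: x'_def x_def y_def m'_def m_def c_def H_def \<mu>_def algebra_simps)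
    qed
    have "\<bar>\<mu> * (Z j k l - X (h j k l))\<bar> \<le> 1 * \<delta>"
      unfolding abs_mult using mu XZ step by (intro mult_mono) auto
    then show "z \<in> near_pairs \<delta> (grid 1 N L) x' y (grid 1 N' L) m' c"
      using t hL eq by (simp add: z near_pairs_def grid_def)
  qed
  then have "card (F ` Q) \<le> card (near_pairs \<delta> (grid 1 N L) x' y (grid 1 N' L) m' c)"
    by (intro card_mono finite_near_pairs) auto
  moreover have "inj_on F Q" by (auto simp: inj_on_def F_def)
  then have "card (F ` Q) = N' * N * L" by (simp add: card_image Q_def mult.assoc)
  ultimately have "real (N' * N * L) \<le> real (card (near_pairs \<delta> (grid 1 N L) x' y (grid 1 N' L) m' c))"
    by linarith
  moreover have "1 / 8 * \<delta> powr - (\<alpha> + \<beta> - 1) \<le> real (N' * N * L)"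
  proof -
    have "- (\<alpha> + \<beta> - 1) = - (\<alpha> - 1) + - (\<beta> - 1) + - 1" by simp
    then have "1 / 8 * \<delta> powr - (\<alpha> + \<beta> - 1)
        = (\<delta> powr - (\<alpha> - 1) / 2) * (\<delta> powr - (\<beta> - 1) / 2) * (\<delta> powr - 1 / 2)"
      by (simp only: powr_add)
    also have "\<dots> \<le> real N' * real N * real L"
      using Nb(3) N'b(3) Lb(3) by (intro mult_mono) auto
    finally show ?thesis by simp
  qed
  ultimately have I: "1 / 8 * \<delta> powr - (\<alpha> + \<beta> - 1)
      \<le> real (card (near_pairs \<delta> (grid 1 N L) x' y (grid 1 N' L) m' c))" by linarith
  show "\<exists>(S :: (nat \<times> nat \<times> nat) set) x y (R :: (nat \<times> nat \<times> nat) set) m c.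
      dim_spaced \<delta> \<beta> 160000 S x y \<and> dim_spaced \<delta> \<alpha> 160000 R m c \<and>
      (\<forall>s\<in>S. \<bar>x s\<bar> \<le> 1 / 4 \<and> \<bar>y s\<bar> \<le> 1 / 4) \<and> (\<forall>t\<in>R. 1 / 4 \<le> m t \<and> m t \<le> 1 / 2 \<and> \<bar>c t\<bar> \<le> 1 / 8) \<and>
      1 / 8 * \<delta> powr - (\<alpha> + \<beta> - 1) \<le> real (card (near_pairs \<delta> S x y R m c))"
    using P T bP bT I unfolding x'_def[symmetric] m'_def[symmetric] by blast
qed (use a in auto)

text \<open>For \<open>\<alpha> \<ge> \<beta> + 1\<close> the exponent does not grow with \<alpha>, so the
configuration for \<open>\<alpha> = \<beta> + 1\<close> serves, and dually. In the last case r solves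
the equation that equates the two expressions for \<nu> in \<open>sharp_bushes\<close>.\<close>

lemma sharp_incidence_exponent:
  assumes ab: "0 \<le> \<alpha>" "\<alpha> \<le> 2" "0 \<le> \<beta>" "\<beta> \<le> 2"
  shows "sharp \<alpha> \<beta> (incidence_exponent \<alpha> \<beta>)"
proof -
  consider "\<alpha> \<ge> \<beta> + 1" | "\<beta> \<ge> \<alpha> + 1" | "\<alpha> + \<beta> \<ge> 3" | "\<alpha> = 0" "\<beta> = 0"
    | "\<alpha> < \<beta> + 1" "\<beta> < \<alpha> + 1" "\<alpha> + \<beta> < 3" "\<alpha> \<noteq> 0 \<or> \<beta> \<noteq> 0" by linarith
  then show ?thesis
  proof cases
    case 1
    have "sharp (\<beta> + 1) \<beta> (\<beta> + 1 + min \<beta> 1 * (1 - 1))"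
      using ab 1 by (intro sharp_bushes[where \<nu> = \<beta>]) auto
    then show ?thesis using sharp_mono 1 incidence_exponent_cases(1)[OF ab 1] by simp
  next
    case 2
    have "sharp \<alpha> (\<alpha> + 1) (\<alpha> + min (\<alpha> + 1) 1 * (1 - 0))"
      using ab 2 by (intro sharp_bushes[where \<nu> = \<alpha>]) auto
    then show ?thesis using sharp_mono[of \<alpha> "\<alpha> + 1" _ \<alpha> \<beta>] 2 ab incidence_exponent_cases(2)[OF ab 2] by simp
  next
    case 3
    then show ?thesis using sharp_product_grid[of \<alpha> \<beta>] ab incidence_exponent_cases(3)[OF ab 3] by simp
  next
    case 4
    have "sharp 0 0 (0 + min 0 1 * (1 - 0))" by (intro sharp_bushes[where \<nu> = 0]) auto
    then show ?thesis using 4 by (simp add: incidence_exponent_def)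
  next
    case 5
    define a where "a = min \<alpha> 1"
    define b where "b = min \<beta> 1"
    define r where "r = (\<alpha> - \<beta> + b) / (a + b)"
    have ab0: "0 \<le> a" "a \<le> 1" "a \<le> \<alpha>" "0 \<le> b" "b \<le> 1" "b \<le> \<beta>" "\<alpha> - \<beta> \<le> a" "\<beta> - \<alpha> \<le> b"
      using ab 5 by (auto simp: a_def b_def)
    have pos: "0 < a + b" using ab 5 by (auto simp: a_def b_def min_def)
    have r: "0 \<le> r" "r \<le> 1" using ab0 pos by (auto simp: r_def pos_divide_le_eq)
    have r_eq: "(a + b) * r = \<alpha> - \<beta> + b" using pos by (simp add: r_def)
    have nu: "\<alpha> - a * r = \<beta> - b * (1 - r)" using r_eq by (simp add: algebra_simps)
    have ar: "0 \<le> a * r" "0 \<le> b * (1 - r)" using ab0 r by auto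
    have nu1: "\<alpha> - a * r \<le> 1"
    proof (cases "\<alpha> \<le> 1 \<or> \<beta> \<le> 1")
      case True
      then show ?thesis using nu ar by linarith
    next
      case False
      then have "a = 1" "b = 1" by (auto simp: a_def b_def)
      then show ?thesis using 5 by (simp add: r_def field_simps)
    qed
    have "sharp \<alpha> \<beta> (\<alpha> + b * (1 - r))"
      unfolding b_def using ab r nu nu1 by (intro sharp_bushes[where \<nu> = "\<alpha> - a * r"]) (auto simp: a_def b_def)
    moreover have "\<alpha> + b * (1 - r) = incidence_exponent \<alpha> \<beta>"
    proof -
      have "(a + b) * (\<alpha> + b * (1 - r)) = a * \<alpha> + b * \<beta> + a * b"
      proof -
        have "(a + b) * (\<alpha> + b * (1 - r)) = (a + b) * \<alpha> + b * ((a + b) - (a + b) * r)"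
          by (simp add: algebra_simps)
        then show ?thesis unfolding r_eq by (simp add: algebra_simps)
      qed
      then have "\<alpha> + b * (1 - r) = (a * \<alpha> + b * \<beta> + a * b) / (a + b)"
        using pos by (simp add: nonzero_eq_divide_eq mult.commute)
      then show ?thesis using 5 by (auto simp: incidence_exponent_def Let_def a_def b_def)
    qed
    ultimately show ?thesis by simp
  qed
qed

theorem theorem1p4:
  fixes \<alpha> \<beta> :: real
  assumes "0 \<le> \<alpha>" "\<alpha> \<le> 2" "0 \<le> \<beta>" "\<beta> \<le> 2"
  shows "(\<forall>\<epsilon>>0. \<exists>C>0. \<forall>K\<^sub>\<alpha>\<ge>1. \<forall>K\<^sub>\<beta>\<ge>1. \<forall>\<delta> P T.
            0 < \<delta> \<and> \<delta> \<le> 1 \<and> ball_set \<delta> \<beta> K\<^sub>\<beta> P \<and> tube_set \<delta> \<alpha> K\<^sub>\<alpha> T \<longrightarrow>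
            real (incidences P T) \<le> C * K\<^sub>\<alpha> * K\<^sub>\<beta> * \<delta> powr (- incidence_exponent \<alpha> \<beta> - \<epsilon>))
       \<and> (\<exists>K\<ge>1. \<exists>c\<^sub>0>0. \<exists>\<delta>\<^sub>0>0. \<forall>\<delta>. 0 < \<delta> \<and> \<delta> < \<delta>\<^sub>0 \<longrightarrow>
            (\<exists>P T. ball_set \<delta> \<beta> K P \<and> tube_set \<delta> \<alpha> K T \<and>
               real (incidences P T) \<ge> c\<^sub>0 * \<delta> powr (- incidence_exponent \<alpha> \<beta>)))"
proof (rule conjI)
  show "\<forall>\<epsilon>>0. \<exists>C>0. \<forall>K\<^sub>\<alpha>\<ge>1. \<forall>K\<^sub>\<beta>\<ge>1. \<forall>\<delta> P T.
            0 < \<delta> \<and> \<delta> \<le> 1 \<and> ball_set \<delta> \<beta> K\<^sub>\<beta> P \<and> tube_set \<delta> \<alpha> K\<^sub>\<alpha> T \<longrightarrow>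
            real (incidences P T) \<le> C * K\<^sub>\<alpha> * K\<^sub>\<beta> * \<delta> powr (- incidence_exponent \<alpha> \<beta> - \<epsilon>)"
    using incidences_upper_bound[OF assms] by blast
  show "\<exists>K\<ge>1. \<exists>c\<^sub>0>0. \<exists>\<delta>\<^sub>0>0. \<forall>\<delta>. 0 < \<delta> \<and> \<delta> < \<delta>\<^sub>0 \<longrightarrow>
            (\<exists>P T. ball_set \<delta> \<beta> K P \<and> tube_set \<delta> \<alpha> K T \<and>
               real (incidences P T) \<ge> c\<^sub>0 * \<delta> powr (- incidence_exponent \<alpha> \<beta>))"
    using sharp_incidence_exponent[OF assms] unfolding sharp_def .
qed

end
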